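(* Let $\mathcal{P}$ be a homogeneous Poisson point process on $\mathbb{R}^2$ of intensity $\lambda>0$, and let $\Phi$ be the user point process of type I associated with $\mathcal{P}$, i.e., $\Phi=\{U(V_{\mathcal{P}}(x)) : x\in\mathcal{P}\}$. Then the pair correlation function $g$ of $\Phi$ satisfies $$ g(r)=\Theta(r),\qquad r\to 0 .$$
   Context: For a point process $\mathcal{P}$ on $\mathbb{R}^2$ and $x\in\mathcal{P}$, $V_{\mathcal{P}}(x)$ denotes the Voronoi cell of $x$ with respect to $\mathcal{P}$. For $B\subset\mathbb{R}^2$, $U(B)$ denotes a point chosen uniformly at random from $B$, independently for different $B$ and independently of everything else. Thus the user point process of type I, $\Phi=\{U(V_{\mathcal{P}}(x)) : x\in\mathcal{P}\}$, is obtained by replacing each $x\in\mathcal{P}$ by a uniformly random point of its Voronoi cell, independently across cells given $\mathcal{P}$; $\Phi$ is stationary with the same intensity $\lambda$ as $\mathcal{P}$. Let $o=(0,0)$ and let $b(x,r)$ be the disk of radius $r$ centered at $x$. Define $K(r)=\mathbb{E}_o^!\,\Phi(b(o,r))$, where $\mathbb{E}_o^!$ is the expectation with respect to the reduced Palm measure of $\Phi$ at $o$; equivalently, for any bounded Borel set $B\subset\mathbb{R}^2$ of positive area $|B|$, $K(r)=\frac{1}{\lambda|B|}\,\mathbb{E}\sum_{x\in\Phi\cap B}\Phi\big(b(x,r)\setminus\{x\}\big)$. The pair correlation function is $g(r)=\frac{1}{2\pi r}K'(r)$. $g(r)=\Theta(r)$ as $r\to0$ means that there are constants $c_1,c_2,r_0>0$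 (possibly depending on $\lambda$) such that $c_1 r\le g(r)\le c_2 r$ for all $0<r<r_0$. *)

theory Defs
  imports "HOL-Probability.Probability"
begin

text \<open>
  A point process on the plane is a random point set \<open>P :: 'w \<Rightarrow> (real ^ 2) set\<close> on a
  probability space \<open>M\<close>.  The Poisson probabilities are written out because \<open>poisson_pmf\<close> is only
  specified for positive rates, whereas null sets \<open>A\<close> are allowed here.
\<close>

definition poisson_process :: "'w measure \<Rightarrow> real \<Rightarrow> ('w \<Rightarrow> (real ^ 2) set) \<Rightarrow> bool" where
  "poisson_process M lam P \<longleftrightarrow>
     prob_space M \<and>
     (\<forall>\<omega>\<in>space M. \<forall>A. bounded A \<longrightarrow> finite (P \<omega> \<inter> A)) \<and>
     (\<forall>A\<in>sets borel. bounded A \<longrightarrow>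
        (\<lambda>\<omega>. card (P \<omega> \<inter> A)) \<in> measurable M (count_space UNIV) \<and>
        (\<forall>k. measure M {\<omega> \<in> space M. card (P \<omega> \<inter> A) = k} =
               exp (- (lam * measure lborel A)) * (lam * measure lborel A) ^ k / fact k)) \<and>
     (\<forall>A :: nat \<Rightarrow> (real ^ 2) set.
        (\<forall>i. A i \<in> sets borel \<and> bounded (A i)) \<and> disjoint_family A \<longrightarrow>
        prob_space.indep_vars M (\<lambda>_. count_space UNIV) (\<lambda>i \<omega>. card (P \<omega> \<inter> A i)) UNIV)"

definition voronoi_cell :: "(real ^ 2) set \<Rightarrow> real ^ 2 \<Rightarrow> (real ^ 2) set" where
  "voronoi_cell S x = {y. \<forall>z\<in>S. dist y x \<le> dist y z}"

text \<open>
  The points of \<open>P\<close> are listed without repetition as \<open>X 0, X 1, \<dots>\<close>, and \<open>Y n\<close> is the point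
  that replaces \<open>X n\<close>.  The last clause is the integrated form of: conditionally on \<open>X\<close>, the
  \<open>Y n\<close> are independent and \<open>Y n\<close> is uniform on the Voronoi cell of \<open>X n\<close>.  An infinite
  enumeration exists because a Poisson process of positive intensity on the plane is almost
  surely infinite.
\<close>

definition user_process_I :: "'w measure \<Rightarrow> ('w \<Rightarrow> (real ^ 2) set) \<Rightarrow> ('w \<Rightarrow> (real ^ 2) set) \<Rightarrow> bool" where
  "user_process_I M P \<Phi> \<longleftrightarrow>
     (\<exists>X Y :: nat \<Rightarrow> 'w \<Rightarrow> real ^ 2.
        (\<forall>n. X n \<in> borel_measurable M) \<and> (\<forall>n. Y n \<in> borel_measurable M) \<and>
        (AE \<omega> in M. inj (\<lambda>n. X n \<omega>) \<and> P \<omega> = range (\<lambda>n. X n \<omega>) \<and> \<Phi> \<omega> = range (\<lambda>n. Y n \<omega>)) \<and>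
        (\<forall>S \<in> sets (Pi\<^sub>M UNIV (\<lambda>_::nat. borel)). \<forall>N. \<forall>C :: nat \<Rightarrow> (real ^ 2) set. (\<forall>n. C n \<in> sets borel) \<longrightarrow>
           emeasure M {\<omega> \<in> space M. (\<lambda>n. X n \<omega>) \<in> S \<and> (\<forall>n<N. Y n \<omega> \<in> C n)} =
           (\<integral>\<^sup>+\<omega>\<in>{\<omega> \<in> space M. (\<lambda>n. X n \<omega>) \<in> S}.
              (\<Prod>n<N. emeasure (uniform_measure lborel (voronoi_cell (P \<omega>) (X n \<omega>))) (C n)) \<partial>M)))"

text \<open>
  Expectation of \<open>h\<close> under the reduced Palm measure at the origin of a stationary process \<open>\<Phi>\<close> of
  intensity \<open>lam\<close>; stationarity makes it independent of the window \<open>B\<close> (bounded, Borel, of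
  positive area).  Sums over random point sets are integrals with respect to counting measure,
  with values in \<open>[0, \<infinity>]\<close>.
\<close>

definition reduced_palm_expectation ::
  "'w measure \<Rightarrow> ('w \<Rightarrow> (real ^ 2) set) \<Rightarrow> real \<Rightarrow> (real ^ 2) set \<Rightarrow> ((real ^ 2) set \<Rightarrow> ennreal) \<Rightarrow> ennreal" where
  "reduced_palm_expectation M \<Phi> lam B h =
     (\<integral>\<^sup>+\<omega>. (\<integral>\<^sup>+x. h ((\<lambda>y. y - x) ` (\<Phi> \<omega> - {x})) \<partial>count_space (\<Phi> \<omega> \<inter> B)) \<partial>M)
       / ennreal (lam * measure lborel B)"

definition K_function ::
  "'w measure \<Rightarrow> ('w \<Rightarrow> (real ^ 2) set) \<Rightarrow> real \<Rightarrow> (real ^ 2) set \<Rightarrow> real \<Rightarrow> real" where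
  "K_function M \<Phi> lam B r =
     enn2real (reduced_palm_expectation M \<Phi> lam B (\<lambda>\<psi>. emeasure (count_space UNIV) (\<psi> \<inter> cball 0 r)))"

definition pair_correlation ::
  "'w measure \<Rightarrow> ('w \<Rightarrow> (real ^ 2) set) \<Rightarrow> real \<Rightarrow> (real ^ 2) set \<Rightarrow> real \<Rightarrow> real" where
  "pair_correlation M \<Phi> lam B r = deriv (K_function M \<Phi> lam B) r / (2 * pi * r)"

lemma K_function_Campbell:
  "K_function M \<Phi> lam B r =
     enn2real ((\<integral>\<^sup>+\<omega>. (\<integral>\<^sup>+x. emeasure (count_space UNIV) (\<Phi> \<omega> \<inter> (cball x r - {x}))
                    \<partial>count_space (\<Phi> \<omega> \<inter> B)) \<partial>M) / ennreal (lam * measure lborel B))"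
proof -
  have "emeasure (count_space UNIV) ((\<lambda>y. y - x) ` (S - {x}) \<inter> cball 0 r) =
        emeasure (count_space UNIV) (S \<inter> (cball x r - {x}))" for S and x :: "real ^ 2"
  proof -
    have eq: "(\<lambda>y. y - x) ` (S - {x}) \<inter> cball 0 r = (\<lambda>y. y - x) ` (S \<inter> (cball x r - {x}))"
      by (auto simp: dist_norm norm_minus_commute)
    have inj: "inj_on (\<lambda>y. y - x) T" for T
      by (auto simp: inj_on_def)
    show ?thesis
      unfolding eq by (simp add: emeasure_count_space finite_image_iff[OF inj] card_image[OF inj])
  qed
  then show ?thesis
    by (simp add: K_function_def reduced_palm_expectation_def)
qed

end

theory Submission
  imports Defs
begin

text \<open>
  Let \<open>\<rho>(y, z)\<close> be the expectation of \<open>1 / (|V| |V'|)\<close> over the cells \<open>V \<ni> y\<close>, \<open>V' \<ni> z\<close> of the Poisson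
  process, taken as \<open>0\<close> when \<open>V = V'\<close>.  By stationarity it is a function \<open>h(z - y)\<close>, and \<open>K(r)\<close> is
  \<open>1 / \<lambda>\<close> times the integral of \<open>h\<close> over the disk of radius \<open>r\<close>.

  Upper bound: \<open>h(z) \<le> E 1[V \<noteq> V'] (1 / |V|^2 + 1 / |V'|^2)\<close>.  Averaging the point \<open>y\<close> over the unit
  disk, a convex cell contributes the area of \<open>{y \<in> V. y + z \<notin> V}\<close>, which is \<open>O(|z|)\<close>, divided by
  \<open>|V|^2\<close>.  It remains to see that the sum of \<open>1 / |V|^2\<close> over the cells meeting the unit disk has
  finite mean.  If \<open>d2 \<le> d3\<close> are the distances from the nucleus to the second and third nearest
  nuclei, then \<open>V\<close> contains a parallelogram of area \<open>d2 d3 / 16\<close>, and \<open>(d2 d3)\<^sup>-\<^sup>2\<close> is integrable with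
  respect to the fourth factorial moment measure; distant nuclei are controlled by the empty disk
  that they force around the origin.

  Lower bound: with positive probability all cells near the origin are bounded by a fixed constant,
  and then \<open>{y \<in> V. y + z \<notin> V}\<close> has area at least a multiple of \<open>|z| |V|\<close>, since a bounded number
  of order \<open>1 / |z|\<close> of its translates covers \<open>V\<close>.

  The same weights give \<open>h(z) - h(z') = O(|z - z'| powr (1/2))\<close>, so \<open>K\<close> is differentiable: on a thin
  annulus \<open>h\<close> may be replaced by its radial extension from the circle, whose integral scales with
  the area.
\<close>

section \<open>Voronoi cells\<close>

text \<open>Why the second and third neighbours: \<open>(d1 d2)\<^sup>-\<^sup>2\<close> would
  diverge logarithmically at \<open>d1 = 0\<close>. In \<open>(d2 d3)\<^sup>-\<^sup>2\<close> the
  two nearer nuclei are confined to disks of radius \<open>d2\<close> and \<open>d3\<close>, whose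
  areas cancel both factors. The nearest nucleus may be as close as it likes: it only decides on
  which side of \<open>x\<close> the parallelogram is placed. The hypotheses provide nothing but
  measurable counts in bounded Borel sets, so measurability and invariance of functionals of the
  whole configuration have to be produced. The cell relation is therefore encoded by countably many
  hitting events, and expectations over tuples of nuclei are built from independent counts in
  disjoint small boxes. As the boxes shrink, Fatou's lemma gives an inequality, which is the
  direction that the second moment requires. The exponent 1/2 arises from splitting a product of two
  inverse areas with a weight \<open>s\<close>: one square costs \<open>s\<^sup>2\<close> times the
  second moment, the other \<open>inverse (s\<^sup>2)\<close> times a probability-like term of order
  \<open>norm (z - z')\<close>, and \<open>s\<^sup>2 = sqrt (norm (z - z'))\<close> balances
  them.\<close>

definition locally_finite :: "'a::metric_space set \<Rightarrow> bool" where
  "locally_finite S \<longleftrightarrow> (\<forall>A. bounded A \<longrightarrow> finite (S \<inter> A))"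

text \<open>Being expressed by a relation between points of the plane, the area of the cell around \<open>y\<close> is
  a functional of the point set alone, without reference to an enumeration of the nuclei.\<close>

definition same_cell :: "(real^2) set \<Rightarrow> real^2 \<Rightarrow> real^2 \<Rightarrow> bool" where
  "same_cell S y w \<longleftrightarrow> (\<exists>x\<in>S. y \<in> voronoi_cell S x \<and> w \<in> voronoi_cell S x)"

definition inv_area :: "(real^2) set \<Rightarrow> real^2 \<Rightarrow> ennreal" where
  "inv_area S y = inverse (emeasure lborel {w. same_cell S y w})"

text \<open>Off the cell boundaries the nucleus of \<open>y\<close> is unique, and
  \<open>same_cell S y\<close> describes a single cell instead of a union of several.\<close>

definition tie_free :: "(real^2) set \<Rightarrow> real^2 \<Rightarrow> bool" where
  "tie_free S y \<longleftrightarrow> (\<forall>x\<in>S. \<forall>x'\<in>S. y \<in> voronoi_cell S x \<and> y \<in> voronoi_cell S x' \<longrightarrow> x = x')"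

section \<open>Areas, half-planes and ties between nuclei\<close>

lemma emeasure_cball_R2: "0 \<le> r \<Longrightarrow> emeasure lborel (cball (x::real^2) r) = ennreal (pi * r\<^sup>2)"
  by (simp add: emeasure_cball unit_ball_vol_2)

lemma emeasure_lborel_translate:
  fixes A :: "'a::euclidean_space set"
  assumes "A \<in> sets borel"
  shows "emeasure lborel ((+) t ` A) = emeasure lborel A"
proof -
  have eq: "(+) t ` A = (\<lambda>x. x - t) -` A \<inter> space borel"
    by (auto simp: image_iff) (metis add.commute diff_add_cancel)
  have "emeasure lborel A = emeasure (distr lborel borel ((+) (-t))) A"
    by (simp add: lborel_distr_plus)
  also have "\<dots> = emeasure lborel ((+) (-t) -` A \<inter> space lborel)"
    using assms by (subst emeasure_distr) auto
  also have "(+) (-t) -` A \<inter> space lborel = (+) t ` A"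
    unfolding eq by auto
  finally show ?thesis by simp
qed

lemma nn_integral_lborel_translate:
  fixes f :: "'a::euclidean_space \<Rightarrow> ennreal"
  assumes [measurable]: "f \<in> borel_measurable borel"
  shows "(\<integral>\<^sup>+x. f (t + x) \<partial>lborel) = (\<integral>\<^sup>+x. f x \<partial>lborel)"
proof -
  have "(\<integral>\<^sup>+x. f x \<partial>lborel) = (\<integral>\<^sup>+x. f x \<partial>distr lborel borel ((+) t))"
    by (simp add: lborel_distr_plus)
  also have "\<dots> = (\<integral>\<^sup>+x. f (t + x) \<partial>lborel)"
    by (subst nn_integral_distr) auto
  finally show ?thesis by simp
qed

lemma voronoi_cell_halfspaces:
  "voronoi_cell S x = (\<Inter>z\<in>S. {y. dist y x \<le> dist y z})"
  by (auto simp: voronoi_cell_def)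

lemma closed_voronoi_cell [simp, intro]: "closed (voronoi_cell S x)"
  unfolding voronoi_cell_halfspaces by (intro closed_INT ballI closed_Collect_le continuous_intros)

lemma voronoi_cell_borel [measurable, simp]: "voronoi_cell S x \<in> sets borel"
  by (intro borel_closed closed_voronoi_cell)

text \<open>The quadratic term in \<open>y\<close> cancels, which exhibits a closed half-space and
  hence the convexity of cells on which the upper bound rests.\<close>

lemma dist_le_dist_iff_inner:
  fixes y x z :: "'a::real_inner"
  shows "dist y x \<le> dist y z \<longleftrightarrow> (z - x) \<bullet> y \<le> (z \<bullet> z - x \<bullet> x) / 2"
proof -
  have "dist y x \<le> dist y z \<longleftrightarrow> (y - x) \<bullet> (y - x) \<le> (y - z) \<bullet> (y - z)"
    by (simp add: dist_norm norm_le)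
  also have "\<dots> \<longleftrightarrow> (z - x) \<bullet> y \<le> (z \<bullet> z - x \<bullet> x) / 2"
    by (simp add: inner_diff_left inner_diff_right inner_commute field_simps)
  finally show ?thesis .
qed

lemma convex_voronoi_cell [simp, intro]: "convex (voronoi_cell S x)"
  unfolding voronoi_cell_halfspaces dist_le_dist_iff_inner
  by (intro convex_INT convex_halfspace_le)

lemma center_in_voronoi_cell [simp, intro]: "x \<in> voronoi_cell S x"
  by (auto simp: voronoi_cell_def)

text \<open>Only points no farther from \<open>y\<close> than some fixed \<open>z0\<close> compete,
  and local finiteness leaves finitely many of these.\<close>

lemma exists_nearest:
  assumes "locally_finite S" "S \<noteq> {}"
  shows "\<exists>x\<in>S. \<forall>z\<in>S. dist y x \<le> dist y z"
proof -
  obtain z0 where z0: "z0 \<in> S" using assms by auto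
  define F where "F = S \<inter> cball y (dist y z0)"
  have F: "finite F" "z0 \<in> F"
    using assms z0 by (auto simp: F_def locally_finite_def)
  define x where "x = arg_min_on (dist y) F"
  have x: "x \<in> F" "\<And>z. z \<in> F \<Longrightarrow> dist y x \<le> dist y z"
    using F arg_min_if_finite(1)[of F "dist y"] arg_min_least[of F _ "dist y"] by (auto simp: x_def)
  have "dist y x \<le> dist y z" if "z \<in> S" for z
    using x(2)[OF F(2)] x(2)[of z] that by (cases "z \<in> F") (auto simp: F_def)
  then show ?thesis using x by (auto simp: F_def)
qed

lemma exists_voronoi_cell:
  assumes "locally_finite S" "S \<noteq> {}"
  shows "\<exists>x\<in>S. y \<in> voronoi_cell S x"
  using exists_nearest[OF assms, of y] by (auto simp: voronoi_cell_def)

lemma bisector_null: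
  fixes x z :: "'a::euclidean_space"
  assumes "x \<noteq> z"
  shows "{y. dist y x = dist y z} \<in> null_sets lborel"
proof -
  have "{y. dist y x = dist y z} = {y. (z - x) \<bullet> y = (z \<bullet> z - x \<bullet> x) / 2}"
    using dist_le_dist_iff_inner[of _ x z] dist_le_dist_iff_inner[of _ z x]
    by (auto simp: inner_diff_left algebra_simps intro!: antisym) (smt (verit) add_divide_distrib diff_divide_distrib)+
  moreover have "negligible {y. (z - x) \<bullet> y = (z \<bullet> z - x \<bullet> x) / 2}"
    using assms by (intro negligible_hyperplane) auto
  moreover have "{y. dist y x = dist y z} \<in> sets borel"
    by (intro borel_closed closed_Collect_eq continuous_intros)
  ultimately show ?thesis
    by (simp add: negligible_iff_null_sets null_sets_completion_iff)
qed

text \<open>A tie puts \<open>y\<close> on the bisector of two distinct points, and countably many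
  points have countably many bisectors.\<close>

lemma AE_tie_free:
  assumes "countable S"
  shows "AE y in lborel. tie_free S y"
proof -
  have "AE y in lborel. \<forall>x\<in>S. \<forall>z\<in>S. x \<noteq> z \<longrightarrow> dist y x \<noteq> dist y z"
    unfolding AE_ball_countable[OF assms]
  proof (intro ballI)
    fix x z :: "real^2"
    show "AE y in lborel. x \<noteq> z \<longrightarrow> dist y x \<noteq> dist y z"
    proof (cases "x = z")
      case False
      show ?thesis
        by (rule AE_I'[OF bisector_null[OF False]]) auto
    qed simp
  qed
  then show ?thesis
    by eventually_elim (unfold tie_free_def voronoi_cell_def, blast intro: antisym)
qed

lemma same_cell_eq_voronoi:
  assumes "tie_free S y" "x \<in> S" "y \<in> voronoi_cell S x"
  shows "{w. same_cell S y w} = voronoi_cell S x"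
  using assms by (auto simp: same_cell_def tie_free_def)

lemma inv_area_eq:
  assumes "tie_free S y" "x \<in> S" "y \<in> voronoi_cell S x"
  shows "inv_area S y = inverse (emeasure lborel (voronoi_cell S x))"
  by (simp add: inv_area_def same_cell_eq_voronoi[OF assms])

lemma same_cell_commute: "same_cell S y w \<longleftrightarrow> same_cell S w y"
  by (auto simp: same_cell_def)

text \<open>Since \<open>p1\<close> may be arbitrarily near to \<open>x\<close>, its distance cannot
  enter the bound. Its half-plane still contains one of the four rectangles at \<open>x\<close> with
  sides along and across \<open>p2 - x\<close>. Side lengths of one quarter of
  \<open>dist x p2\<close> and of \<open>t\<close> keep the rectangle on the near side of the
  bisector with \<open>p2\<close> and within \<open>t / 2\<close> of \<open>x\<close>, where no
  point at distance \<open>t\<close> or more can win. A fictitious \<open>p2\<close> is allowed,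
  which serves configurations with too few neighbours.\<close>

lemma voronoi_area_lower:
  fixes x p1 p2 :: "real^2"
  assumes s: "x \<noteq> p2" "dist x p2 \<le> t"
    and far: "\<And>p. p \<in> S \<Longrightarrow> p \<noteq> x \<Longrightarrow> p \<noteq> p1 \<Longrightarrow> p \<noteq> p2 \<Longrightarrow> t \<le> dist x p"
  shows "ennreal (dist x p2 * t / 16) \<le> emeasure lborel (voronoi_cell S x)"
proof -
  define e d where "e = p2 - x" and "d = p1 - x"
  define q :: "real^2" where "q = vector [- (e $ 2), e $ 1]"
  have q: "q $ 1 = - (e $ 2)" "q $ 2 = e $ 1" by (auto simp: q_def)
  have inner2: "u \<bullet> v = u $ 1 * v $ 1 + u $ 2 * v $ 2" for u v :: "real^2"
    by (simp add: inner_vec_def sum_2)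
  have eq0: "e \<bullet> q = 0" by (simp add: inner2 q)
  have nq: "norm q = norm e"
    by (simp add: norm_eq_sqrt_inner inner2 q)
  define r where "r = norm e"
  have r: "r > 0" "r = dist x p2" "r \<le> t" using s by (auto simp: r_def e_def dist_norm norm_minus_commute)
  \<comment> \<open>The signs turn both sides of the rectangle into the closed half-plane of
    directions facing away from \<open>p1\<close>; combinations with nonnegative coefficients stay
    there.\<close>
  define \<sigma> \<tau> where "\<sigma> = (if e \<bullet> d \<le> 0 then 1 else -1 :: real)" and "\<tau> = (if q \<bullet> d \<le> 0 then 1 else -1 :: real)"
  \<comment> \<open>\<open>q\<close> has length \<open>r\<close>, so \<open>b\<close> has length
    \<open>t / 4\<close>. Since \<open>r \<le> t\<close>, the two side lengths sum to at most
    \<open>t / 2\<close>.\<close>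
  define a b where "a = (\<sigma> / 4) *\<^sub>R e" and "b = (\<tau> * t / (4 * r)) *\<^sub>R q"
  define f :: "real^2 \<Rightarrow> real^2" where "f v = (v $ 1) *\<^sub>R a + (v $ 2) *\<^sub>R b" for v
  have lin: "linear f"
    by (rule linearI) (auto simp: f_def algebra_simps)
  have "det (matrix f) = a $ 1 * b $ 2 - b $ 1 * a $ 2"
    by (simp add: det_2 matrix_def f_def axis_def)
  also have "\<dots> = \<sigma> * \<tau> * t / (16 * r) * (e $ 1 * e $ 1 + e $ 2 * e $ 2)"
    by (simp add: a_def b_def q algebra_simps)
  also have "e $ 1 * e $ 1 + e $ 2 * e $ 2 = r * r"
    using dot_square_norm[of e] by (simp add: inner2 r_def power2_eq_square)
  finally have *: "det (matrix f) = \<sigma> * \<tau> * (r * t / 16)" using r by (simp add: field_simps)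
  then have det: "\<bar>det (matrix f)\<bar> = r * t / 16"
  proof -
    have "0 \<le> r * t" using r(1,3) by (intro mult_nonneg_nonneg) linarith+
    then have "\<bar>\<sigma>\<bar> = 1" "\<bar>\<tau>\<bar> = 1" "0 \<le> r * t / 16" by (auto simp: \<sigma>_def \<tau>_def)
    with * show ?thesis by (simp only: abs_mult abs_of_nonneg)
  qed
  define C where "C = f ` cbox 0 One"
  have meas: "measure lebesgue C = r * t / 16" "C \<in> lmeasurable"
    using measure_linear_image[OF lin lmeasurable_cbox] measurable_linear_image[OF lin lmeasurable_cbox] det
    by (auto simp: C_def)
  have "compact C" unfolding C_def
    by (intro compact_continuous_image compact_cbox linear_continuous_on linear_conv_bounded_linear[THEN iffD1] lin)
  then have Cb: "C \<in> sets borel" by (intro borel_compact)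
  have "emeasure lborel C = emeasure lebesgue C" using Cb by simp
  also have "\<dots> = ennreal (r * t / 16)"
    using meas(2) unfolding meas(1)[symmetric] by (rule emeasure_eq_measure2)
  finally have emC: "emeasure lborel ((+) x ` C) = ennreal (dist x p2 * t / 16)"
    using emeasure_lborel_translate[OF Cb, of x] r by simp
  have "(+) x ` C \<subseteq> voronoi_cell S x"
  proof
    fix w assume "w \<in> (+) x ` C"
    then obtain v where v: "v \<in> cbox 0 One" "w = x + f v" by (auto simp: C_def)
    have *: "0 \<le> v $ i \<and> v $ i \<le> 1" for i
    proof -
      have "axis i 1 \<in> (Basis :: (real^2) set)" by simp
      moreover have "(One :: real^2) \<bullet> axis i 1 = 1" by (intro inner_sum_Basis) simp
      ultimately show ?thesis using v(1) by (auto simp: mem_box inner_axis dest!: bspec[of _ _ "axis i 1"])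
    qed
    have v01: "0 \<le> v $ 1" "v $ 1 \<le> 1" "0 \<le> v $ 2" "v $ 2 \<le> 1"
      using *[of 1] *[of 2] by auto
    have na: "norm a = r / 4" by (simp add: a_def r_def \<sigma>_def)
    have nb: "norm b = t / 4" using r(1,3) unfolding b_def \<tau>_def by (simp add: nq flip: r_def)
    have "norm (f v) \<le> v $ 1 * norm a + v $ 2 * norm b"
      unfolding f_def using v01 by (intro norm_triangle_le) simp
    also have "\<dots> \<le> 1 * norm a + 1 * norm b"
      using v01 by (intro add_mono mult_right_mono) auto
    finally have nf: "norm (f v) \<le> t / 2" using na nb r by simp
    have fd: "f v \<bullet> d \<le> 0"
    proof -
      have "a \<bullet> d \<le> 0" by (auto simp: a_def \<sigma>_def)
      moreover have "b \<bullet> d \<le> 0" 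
      proof -
        have "b \<bullet> d = (t / (4 * r)) * (\<tau> * (q \<bullet> d))" by (simp add: b_def)
        moreover have "\<tau> * (q \<bullet> d) \<le> 0" by (auto simp: \<tau>_def)
        moreover have "0 \<le> t / (4 * r)" using r(1,3) by simp
        ultimately show ?thesis by (metis mult_nonneg_nonpos)
      qed
      ultimately show ?thesis using v01
        by (simp add: f_def inner_add_left mult_nonneg_nonpos add_nonpos_nonpos)
    qed
    have fe: "f v \<bullet> e \<le> (e \<bullet> e) / 2"
    proof -
      have "f v \<bullet> e = v $ 1 * \<sigma> / 4 * (e \<bullet> e)"
        using eq0 by (simp add: f_def a_def b_def inner_add_left inner_commute[of q e])
      also have "\<dots> \<le> 1 / 2 * (e \<bullet> e)"
        using v01 by (intro mult_right_mono) (auto simp: \<sigma>_def)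
      finally show ?thesis by simp
    qed
    have half: "dist w x \<le> dist w p" if "f v \<bullet> (p - x) \<le> ((p - x) \<bullet> (p - x)) / 2" for p
    proof -
      have c: "p \<bullet> x = x \<bullet> p" "f v \<bullet> p = p \<bullet> f v" "f v \<bullet> x = x \<bullet> f v" by (simp_all add: inner_commute)
      show ?thesis
        using that unfolding dist_le_dist_iff_inner v(2) inner_add_right inner_diff_left inner_diff_right c
        by argo
    qed
    have "dist w x \<le> dist w p" if pS: "p \<in> S" for p
    proof -
      consider "p = x" | "p = p1" | "p = p2" | "t \<le> dist x p" using far[OF pS] by blast
      then show ?thesis
      proof cases
        case 2
        then show ?thesis using fd inner_ge_zero[of "p1 - x"] unfolding 2 d_def by (intro half) linarith
      next
        case 3
        then show ?thesis using fe by (intro half) (auto simp: e_def)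
      next
        case 4
        have "dist w x \<le> t / 2" using nf by (simp add: v(2) dist_norm)
        then show ?thesis using 4 dist_triangle2[of x p w] by (simp add: dist_commute)
      qed simp
    qed
    then show "w \<in> voronoi_cell S x" by (simp add: voronoi_cell_def)
  qed
  then have "emeasure lborel ((+) x ` C) \<le> emeasure lborel (voronoi_cell S x)"
    by (intro emeasure_mono) auto
  then show ?thesis by (simp only: emC)
qed

text \<open>A packing argument: \<open>k\<close> translates of \<open>A\<close> fit disjointly into
  \<open>B\<close>. With \<open>k\<close> of order \<open>1 / norm u\<close> it turns a bounded area
  into one of order \<open>norm u\<close>.\<close>

lemma disjoint_shifts_measure:
  fixes A B :: "'a::euclidean_space set"
  assumes [measurable]: "A \<in> sets borel" "B \<in> sets borel"
    and disj: "\<And>a a' j. a \<in> A \<Longrightarrow> a' \<in> A \<Longrightarrow> j > 0 \<Longrightarrow> a \<noteq> a' + real j *\<^sub>R u"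
    and sub: "\<And>a j. a \<in> A \<Longrightarrow> j < k \<Longrightarrow> a + real j *\<^sub>R u \<in> B"
  shows "of_nat k * emeasure lborel A \<le> emeasure lborel B"
proof -
  define A' where "A' j = (+) (real j *\<^sub>R u) ` A" for j
  have A': "A' j = (\<lambda>x. x - real j *\<^sub>R u) -` A \<inter> space borel" for j
    by (auto simp: A'_def image_iff) (metis add.commute diff_add_cancel)
  have A'_sets: "A' j \<in> sets borel" for j
    unfolding A' by measurable
  have "disjoint_family_on A' {..<k}"
  proof (unfold disjoint_family_on_def, intro ballI impI)
    have *: "A' i \<inter> A' j = {}" if "i < j" for i j
    proof (rule ccontr)
      assume "A' i \<inter> A' j \<noteq> {}"
      then obtain a a' where a: "a \<in> A" "a' \<in> A" "real i *\<^sub>R u + a = real j *\<^sub>R u + a'"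
        by (auto simp: A'_def)
      have "a = (real i *\<^sub>R u + a) - real i *\<^sub>R u" by simp
      also have "\<dots> = a' + real (j - i) *\<^sub>R u"
        unfolding a(3) using that by (simp add: of_nat_diff algebra_simps)
      finally have "a = a' + real (j - i) *\<^sub>R u" .
      then show False using disj[of a a' "j - i"] a that by auto
    qed
    fix i j :: nat assume "i \<noteq> j"
    then consider "i < j" | "j < i" by linarith
    then show "A' i \<inter> A' j = {}" by cases (use *[of i j] *[of j i] in auto)
  qed
  then have "(\<Sum>j<k. emeasure lborel (A' j)) = emeasure lborel (\<Union>j<k. A' j)"
    using A'_sets by (intro sum_emeasure) auto
  also have "\<dots> \<le> emeasure lborel B"
    using sub by (intro emeasure_mono) (auto simp: A'_def add.commute)
  finally show ?thesis
    by (simp add: A'_def emeasure_lborel_translate)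
qed

text \<open>If \<open>y\<close> and \<open>y + j u\<close> both lay in the part of \<open>V\<close>
  that leaves under the shift, convexity would put \<open>y + u\<close> into \<open>V\<close>. Hence
  the translates of that part by multiples of \<open>u\<close> are disjoint. The bound is uniform
  over all convex \<open>V\<close>, however large or thin, as the cells require.\<close>

lemma convex_shift_boundary:
  fixes V :: "(real^2) set"
  assumes V: "convex V" "V \<in> sets borel" and u: "norm u \<le> 1"
  shows "emeasure lborel {y \<in> cball 0 1. y \<in> V \<and> y + u \<notin> V} \<le> ennreal (9 * pi * norm u)"
proof (cases "u = 0")
  case False
  define A where "A = {y \<in> cball 0 1. y \<in> V \<and> y + u \<notin> V}"
  have [measurable]: "V \<in> sets borel" by fact
  have A[measurable]: "A \<in> sets borel" unfolding A_def by measurable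
  \<comment> \<open>\<open>k * norm u\<close> lies between 1 and 2. The lower bound permits the
    division by \<open>k\<close> at the end; the upper bound keeps all translates inside the disk of
    radius 3, whence the 9.\<close>
  define k where "k = nat \<lceil>1 / norm u\<rceil>"
  have k1: "1 \<le> real k * norm u"
  proof -
    have "1 / norm u \<le> real k" using real_nat_ceiling_ge unfolding k_def .
    then show ?thesis using False by (simp add: divide_le_eq)
  qed
  have "real k \<le> 1 / norm u + 1"
    using of_int_ceiling_le_add_one[of "1 / norm u"] by (simp add: k_def)
  then have k2: "real k * norm u \<le> 2" using u False by (simp add: field_simps)
  have "of_nat k * emeasure lborel A \<le> emeasure lborel (cball (0::real^2) 3)"
  proof (rule disjoint_shifts_measure[where u = u])
    fix a a' :: "real^2" and j :: nat
    assume a: "a \<in> A" "a' \<in> A" "j > 0"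
    show "a \<noteq> a' + real j *\<^sub>R u"
    proof
      assume eq: "a = a' + real j *\<^sub>R u"
      have "a' + u = (1 - 1 / real j) *\<^sub>R a' + (1 / real j) *\<^sub>R a"
        using a(3) by (simp add: eq algebra_simps)
      also have "\<dots> \<in> V"
        using a by (intro convexD[OF V(1)]) (auto simp: A_def)
      finally show False using a(2) by (simp add: A_def)
    qed
  next
    fix a :: "real^2" and j assume a: "a \<in> A" "j < k"
    have "norm (a + real j *\<^sub>R u) \<le> norm a + real j * norm u"
      by (rule order_trans[OF norm_triangle_ineq]) simp
    also have "\<dots> \<le> 1 + real k * norm u"
      using a by (intro add_mono mult_right_mono) (auto simp: A_def)
    finally show "a + real j *\<^sub>R u \<in> cball 0 3" using k2 by simp
  qed auto
  then have *: "of_nat k * emeasure lborel A \<le> ennreal (9 * pi)"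
    by (simp add: emeasure_cball_R2 mult.commute)
  have "emeasure lborel A = 1 * emeasure lborel A" by simp
  also have "\<dots> \<le> ennreal (real k * norm u) * emeasure lborel A"
    using k1 by (intro mult_right_mono) (auto simp: ennreal_leI simp flip: ennreal_1)
  also have "\<dots> = ennreal (norm u) * (of_nat k * emeasure lborel A)"
    by (simp add: ennreal_mult mult_ac flip: ennreal_of_nat_eq_real_of_nat)
  also have "\<dots> \<le> ennreal (norm u) * ennreal (9 * pi)"
    using * by (rule mult_left_mono) simp
  finally show ?thesis
    by (simp add: A_def ennreal_mult[symmetric] mult_ac)
qed (auto simp: )

text \<open>A point of \<open>V\<close> that moves in steps of \<open>u\<close> must leave within
  \<open>k\<close> steps, because \<open>V\<close> has diameter at most \<open>2 * R\<close>. The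
  last position before the exit lies in the set on the right, so \<open>k\<close> translates of that
  set cover \<open>V\<close>.\<close>

lemma shift_boundary_lower:
  fixes V :: "'a::euclidean_space set"
  assumes V[measurable]: "V \<in> sets borel" and bd: "V \<subseteq> cball x R" and k: "2 * R < real k * norm u"
  shows "emeasure lborel V \<le> of_nat k * emeasure lborel {y \<in> V. y + u \<notin> V}"
proof -
  define A where "A = {y \<in> V. y + u \<notin> V}"
  have A[measurable]: "A \<in> sets borel" unfolding A_def by measurable
  define A' where "A' j = (+) (- real j *\<^sub>R u) ` A" for j
  have A': "A' j = (\<lambda>x. x + real j *\<^sub>R u) -` A \<inter> space borel" for j
    by (auto simp: A'_def image_iff) (metis add.commute add_uminus_conv_diff diff_add_cancel)
  have A'_sets: "A' j \<in> sets borel" for j unfolding A' by measurable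
  have "V \<subseteq> (\<Union>j<k. A' j)"
  proof
    fix y assume y: "y \<in> V"
    have "y + real k *\<^sub>R u \<notin> V"
    proof
      assume "y + real k *\<^sub>R u \<in> V"
      then have "dist y (y + real k *\<^sub>R u) \<le> dist x y + dist x (y + real k *\<^sub>R u)"
        by (metis dist_commute dist_triangle)
      also have "\<dots> \<le> R + R" using bd y \<open>y + real k *\<^sub>R u \<in> V\<close> by (intro add_mono) (auto simp: subset_iff)
      finally show False using k by (simp add: dist_norm)
    qed
    define n where "n = (LEAST n. y + real n *\<^sub>R u \<notin> V)"
    have n: "y + real n *\<^sub>R u \<notin> V"
      unfolding n_def by (rule LeastI) fact
    have nk: "n \<le> k" unfolding n_def by (rule Least_le) fact
    have "n \<noteq> 0" using y n by (intro notI) auto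
    then obtain m where m: "n = Suc m" by (cases n) auto
    have "y + real m *\<^sub>R u \<in> V" using not_less_Least[of m "\<lambda>n. y + real n *\<^sub>R u \<notin> V"] m by (auto simp: n_def)
    then have "y + real m *\<^sub>R u \<in> A" using n m by (simp add: A_def algebra_simps)
    then have "y \<in> A' m" by (auto simp: A')
    then show "y \<in> (\<Union>j<k. A' j)" using nk m by auto
  qed
  then have "emeasure lborel V \<le> emeasure lborel (\<Union>j<k. A' j)"
    using A'_sets by (intro emeasure_mono) auto
  also have "\<dots> \<le> (\<Sum>j<k. emeasure lborel (A' j))"
    using A'_sets by (intro emeasure_subadditive_finite) auto
  finally show ?thesis
    using emeasure_lborel_translate[OF A, of "- (real _ *\<^sub>R u)"] by (simp add: A'_def A_def[symmetric])
qed

text \<open>Density near the origin bounds the whole cell: a far point \<open>w\<close> would by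
  convexity yield a point of the cell at distance exactly \<open>2 * l\<close> from
  \<open>x\<close>, still inside the controlled disk, where another nucleus is nearer.\<close>

lemma voronoi_cell_small:
  assumes dense: "\<And>w. w \<in> cball 0 (10 * l) \<Longrightarrow> \<exists>p\<in>S. dist w p < 2 * l"
    and l: "l > 0" and y: "y \<in> voronoi_cell S x" "norm y \<le> 5 * l" and x: "x \<in> S"
  shows "dist y x < 2 * l" "voronoi_cell S x \<subseteq> cball x (2 * l)"
proof -
  show 1: "dist y x < 2 * l"
    using dense[of y] y l by (fastforce simp: voronoi_cell_def)
  show "voronoi_cell S x \<subseteq> cball x (2 * l)"
  proof
    fix w assume w: "w \<in> voronoi_cell S x"
    show "w \<in> cball x (2 * l)"
    proof (rule ccontr)
      assume "w \<notin> cball x (2 * l)"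
      then have far: "dist x w > 2 * l" by simp
      define t where "t = 2 * l / dist x w"
      have t: "0 < t" "t < 1" using far l by (auto simp: t_def divide_less_eq intro!: divide_pos_pos)
      define v where "v = (1 - t) *\<^sub>R x + t *\<^sub>R w"
      have v: "v \<in> voronoi_cell S x"
        unfolding v_def using t w by (intro convexD[OF convex_voronoi_cell]) auto
      have "v - x = t *\<^sub>R (w - x)" by (simp add: v_def algebra_simps)
      then have dv: "dist v x = 2 * l"
        using t far l by (auto simp: dist_norm t_def norm_minus_commute)
      \<comment> \<open>The three terms add up to at most \<open>9 * l\<close>, below the radius
        \<open>10 * l\<close> of the controlled disk.\<close>
      have "norm v \<le> norm y + dist y x + dist v x"
        by (smt (verit) dist_norm norm_triangle_ineq2 norm_minus_commute dist_commute)
      then have "v \<in> cball 0 (10 * l)" using y dv 1 l by simp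
      from dense[OF this] v dv show False
        by (fastforce simp: voronoi_cell_def)
    qed
  qed
qed

text \<open>In \<open>chain k v\<close> the neighbours \<open>v 1, v 2, \<dots>\<close> of \<open>v 0\<close> are listed from far to near.  Each factor
  divides by the squared radius of the disk to which \<open>v i\<close> is confined, so that integrating out
  \<open>v i\<close> costs at most \<open>pi\<close>.\<close>

definition chain_factor :: "nat \<Rightarrow> (nat \<Rightarrow> real^2) \<Rightarrow> ennreal" where
  "chain_factor i v = (let R = (if i = 1 then 1 else dist (v 0) (v (i - 1))) in
     indicator {w. dist (v 0) w \<le> R} (v i) * inverse (ennreal (R\<^sup>2)))"

definition chain :: "nat \<Rightarrow> (nat \<Rightarrow> real^2) \<Rightarrow> ennreal" where
  "chain k v = (\<Prod>i\<in>{1..<k}. chain_factor i v)"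

lemma ennreal_inverse_antimono:
  fixes a b :: ennreal
  assumes "a \<le> b"
  shows "inverse b \<le> inverse a"
proof (cases "a = 0 \<or> b = top")
  case False
  then have "a \<noteq> top" using assms top.extremum_uniqueI by auto
  with False assms show ?thesis
    by (cases a; cases b) (auto simp: inverse_ennreal ennreal_le_iff le_imp_inverse_le)
qed auto

text \<open>The 256 is the square of the 16 in \<open>voronoi_area_lower\<close>.\<close>

lemma inverse_area_bound:
  assumes "ennreal (s / 16) \<le> A" "0 < s"
  shows "(inverse A)\<^sup>2 \<le> 256 * inverse (ennreal (s\<^sup>2))"
proof -
  have "inverse A \<le> inverse (ennreal (s / 16))"
    using assms(1) by (rule ennreal_inverse_antimono)
  also have "\<dots> = ennreal (16 / s)" using assms(2) by (subst inverse_ennreal) auto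
  finally have "(inverse A)\<^sup>2 \<le> (ennreal (16 / s))\<^sup>2" by (rule power_mono) simp
  also have "\<dots> = ennreal ((16 / s)\<^sup>2)" using assms(2) by (subst ennreal_power) auto
  also have "(16 / s)\<^sup>2 = 256 * inverse (s\<^sup>2)"
    by (simp add: power_divide divide_inverse power_inverse)
  also have "ennreal \<dots> = ennreal 256 * ennreal (inverse (s\<^sup>2))"
    by (rule ennreal_mult) auto
  also have "ennreal (inverse (s\<^sup>2)) = inverse (ennreal (s\<^sup>2))"
    using assms(2) by (subst inverse_ennreal) auto
  finally show ?thesis by simp
qed

lemma finite_argmin:
  fixes f :: "'a \<Rightarrow> real"
  assumes "finite F" "F \<noteq> {}"
  obtains p where "p \<in> F" "\<And>q. q \<in> F \<Longrightarrow> f p \<le> f q"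
  using arg_min_if_finite(1)[OF assms, of f] arg_min_least[OF assms, of _ f] that by blast

text \<open>Distances are cut off at 1, so that every neighbour used lies in the unit disk around
  \<open>x\<close>. The cases are at most one, exactly two, and at least three further nuclei there.
  A single neighbour costs nothing because it can play the part of \<open>p1\<close> in
  \<open>voronoi_area_lower\<close>; this is why no chain of length 2 occurs.\<close>

lemma voronoi_area_chain:
  assumes lf: "locally_finite S" and x: "x \<in> S"
  defines "I \<equiv> (inverse (emeasure lborel (voronoi_cell S x)))\<^sup>2"
  obtains (1) "I \<le> 256 * chain 1 (\<lambda>i. [x] ! i)"
  | (2) p1 p2 where "p1 \<in> S" "p2 \<in> S" "distinct [x, p2, p1]" "I \<le> 256 * chain 3 (\<lambda>i. [x, p2, p1] ! i)"
  | (3) p1 p2 p3 where "p1 \<in> S" "p2 \<in> S" "p3 \<in> S" "distinct [x, p3, p2, p1]"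
      "I \<le> 256 * chain 4 (\<lambda>i. [x, p3, p2, p1] ! i)"
proof -
  define F where "F = S \<inter> cball x 1 - {x}"
  have F: "finite F" using lf by (auto simp: F_def locally_finite_def)
  have notF: "1 \<le> dist x p" if "p \<in> S" "p \<noteq> x" "p \<notin> F" for p
    using that by (auto simp: F_def)
  have inF: "p \<in> S" "p \<noteq> x" "dist x p \<le> 1" if "p \<in> F" for p
    using that by (auto simp: F_def)
  have set2: "{1..<3::nat} = {1,2}" and set3: "{1..<4::nat} = {1,2,3}" by auto
  consider "\<exists>p. F \<subseteq> {p}" | "\<nexists>p. F \<subseteq> {p}" by blast
  then show ?thesis
  proof cases
    case 1
    then obtain p1 where p1: "F \<subseteq> {p1}" by blast
    \<comment> \<open>With no second neighbour in the unit disk, an artificial point at distance 1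
      stands in for it.\<close>
    define p2 :: "real^2" where "p2 = x + axis 1 1"
    have p2: "dist x p2 = 1" by (simp add: p2_def dist_norm)
    have "ennreal (dist x p2 * 1 / 16) \<le> emeasure lborel (voronoi_cell S x)"
      using p2 p1 notF by (intro voronoi_area_lower[where ?p1.0 = p1]) auto
    then have "I \<le> 256 * inverse (ennreal (1\<^sup>2))"
      unfolding I_def p2 by (intro inverse_area_bound) auto
    then show ?thesis by (intro that(1)) (simp add: chain_def)
  next
    case 2
    then have "F \<noteq> {}" by auto
    from finite_argmin[OF F this] obtain p1 where p1: "p1 \<in> F" "\<And>q. q \<in> F \<Longrightarrow> dist x p1 \<le> dist x q"
      by blast
    have F1: "finite (F - {p1})" "F - {p1} \<noteq> {}" using F 2 by auto
    from finite_argmin[OF F1] obtain p2 where p2: "p2 \<in> F - {p1}"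
      "\<And>q. q \<in> F - {p1} \<Longrightarrow> dist x p2 \<le> dist x q" by blast
    show ?thesis
    proof (cases "F \<subseteq> {p1, p2}")
      case True
      have "1 \<le> dist x p" if "p \<in> S" "p \<noteq> x" "p \<noteq> p1" "p \<noteq> p2" for p
        using notF[of p] True that by auto
      then have "ennreal (dist x p2 * 1 / 16) \<le> emeasure lborel (voronoi_cell S x)"
        using inF[of p2] p2 by (intro voronoi_area_lower[where ?p1.0 = p1]) auto
      then have "I \<le> 256 * inverse (ennreal ((dist x p2)\<^sup>2))"
        unfolding I_def using inF[of p2] p2 by (intro inverse_area_bound) auto
      also have "inverse (ennreal ((dist x p2)\<^sup>2)) = chain 3 (\<lambda>i. [x, p2, p1] ! i)"
        using inF[of p2] p1(2)[of p2] p2(1) unfolding chain_def set2 by (simp add: chain_factor_def)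
      finally show ?thesis
        using inF[of p1] inF[of p2] p1 p2 by (intro that(2)[of p1 p2]) auto
    next
      case False
      have F2: "finite (F - {p1, p2})" "F - {p1, p2} \<noteq> {}" using F False by auto
      from finite_argmin[OF F2] obtain p3 where p3: "p3 \<in> F - {p1, p2}"
        "\<And>q. q \<in> F - {p1, p2} \<Longrightarrow> dist x p3 \<le> dist x q" by blast
      have le: "dist x p2 \<le> dist x p3" "dist x p1 \<le> dist x p2" "dist x p3 \<le> 1"
        using p1(2)[of p2] p2(2)[of p3] p2(1) p3(1) inF(3)[of p3] by auto
      have "t \<le> dist x p" if "p \<in> S" "p \<noteq> x" "p \<noteq> p1" "p \<noteq> p2" "t = dist x p3" for p t
        using notF[of p] p3(2)[of p] that le by (cases "p \<in> F") auto
      then have "ennreal (dist x p2 * dist x p3 / 16) \<le> emeasure lborel (voronoi_cell S x)"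
        using inF[of p2] p2 le by (intro voronoi_area_lower[where ?p1.0 = p1]) auto
      then have "I \<le> 256 * inverse (ennreal ((dist x p2 * dist x p3)\<^sup>2))"
        unfolding I_def using inF[of p2] inF[of p3] p2 p3 by (intro inverse_area_bound) auto
      also have "inverse (ennreal ((dist x p2 * dist x p3)\<^sup>2)) =
          inverse (ennreal ((dist x p2)\<^sup>2)) * inverse (ennreal ((dist x p3)\<^sup>2))"
        unfolding power_mult_distrib
        by (subst ennreal_mult) (auto intro!: ennreal_inverse_mult)
      also have "\<dots> = chain 4 (\<lambda>i. [x, p3, p2, p1] ! i)"
        using le unfolding chain_def set3
        by (simp add: chain_factor_def mult.commute)
      finally show ?thesis
        using inF[of p1] inF[of p2] inF[of p3] p1 p2 p3 by (intro that(3)[of p1 p2 p3]) auto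
    qed
  qed
qed

section \<open>Void events and stationarity\<close>

lemma dense_seq_exists: "\<exists>q :: nat \<Rightarrow> 'a::{metric_space, second_countable_topology}. \<forall>x. \<forall>e>0. \<exists>n. dist (q n) x < e"
proof -
  obtain D :: "'a set" where D: "countable D" "\<And>X. open X \<Longrightarrow> X \<noteq> {} \<Longrightarrow> \<exists>d\<in>D. d \<in> X"
    using countable_dense_exists by blast
  have *: "\<exists>n. from_nat_into D n = d" if "d \<in> D" for d
    by (rule from_nat_into_surj[OF D(1) that])
  show ?thesis
  proof (intro exI[of _ "from_nat_into D"] allI impI)
    fix x :: 'a and e :: real assume "e > 0"
    then obtain d where "d \<in> D" "d \<in> ball x e" using D(2)[of "ball x e"] by auto
    then show "\<exists>n. dist (from_nat_into D n) x < e" using *[of d] by (auto simp: dist_commute)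
  qed
qed

definition dense_seq :: "nat \<Rightarrow> real^2" where
  "dense_seq = (SOME q. \<forall>x. \<forall>e>0. \<exists>n. dist (q n) x < e)"

lemma dense_seq: "e > 0 \<Longrightarrow> \<exists>n. dist (dense_seq n) x < e"
  using someI_ex[OF dense_seq_exists[where 'a = "real^2"]] unfolding dense_seq_def[symmetric] by blast

text \<open>A countable encoding: which rational balls around a dense sequence meet the point set.  Open
  balls with real centres are recovered from the rational balls inside them.\<close>

definition ball_hits :: "(real^2) set \<Rightarrow> nat \<times> rat \<Rightarrow> bool" where
  "ball_hits S i \<longleftrightarrow> S \<inter> ball (dense_seq (fst i)) (of_rat (snd i)) \<noteq> {}"

text \<open>A strict numerical condition that forces the ball coded by \<open>i\<close> into the
  ball of radius \<open>s\<close> about \<open>y\<close>; as such it is plainly measurable in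
  \<open>y\<close>.\<close>

definition inside :: "nat \<times> rat \<Rightarrow> real^2 \<Rightarrow> rat \<Rightarrow> bool" where
  "inside i y s \<longleftrightarrow> dist (dense_seq (fst i)) y + of_rat (snd i) < of_rat s"

text \<open>In a locally finite set, \<open>y\<close> and \<open>w\<close> share a nearest point
  exactly if, whenever a disk around \<open>y\<close> and a disk around \<open>w\<close> both meet
  the set, so does their intersection. Rational radii suffice, hence only countable quantifiers
  occur. The first conjunct excludes the empty set.\<close>

definition same_cell_hits :: "(nat \<times> rat \<Rightarrow> bool) \<Rightarrow> real^2 \<Rightarrow> real^2 \<Rightarrow> bool" where
  "same_cell_hits f y w \<longleftrightarrow> (\<exists>i. f i) \<and>
     (\<forall>s t. (\<exists>i. f i \<and> inside i y s) \<and> (\<exists>i. f i \<and> inside i w t) \<longrightarrow>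
            (\<exists>i. f i \<and> inside i y s \<and> inside i w t))"

definition inv_area_hits :: "(nat \<times> rat \<Rightarrow> bool) \<Rightarrow> real^2 \<Rightarrow> ennreal" where
  "inv_area_hits f y = inverse (\<integral>\<^sup>+w. (if same_cell_hits f y w then 1 else 0) \<partial>lborel)"

abbreviation hit_space :: "(nat \<times> rat \<Rightarrow> bool) measure" where
  "hit_space \<equiv> Pi\<^sub>M UNIV (\<lambda>_. count_space UNIV)"

lemma hit_component [measurable]: "(\<lambda>f. f i) \<in> hit_space \<rightarrow>\<^sub>M count_space UNIV"
  by (rule measurable_component_singleton) simp

lemma inside_measurable [measurable]: "Measurable.pred borel (\<lambda>y. inside i y s)"
  unfolding inside_def by measurable

lemma same_cell_hits_measurable:
  assumes "F \<in> N \<rightarrow>\<^sub>M hit_space" "Y \<in> N \<rightarrow>\<^sub>M borel" "W \<in> N \<rightarrow>\<^sub>M borel"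
  shows "Measurable.pred N (\<lambda>x. same_cell_hits (F x) (Y x) (W x))"
proof -
  have F: "Measurable.pred N (\<lambda>x. F x i)" for i
    using measurable_compose[OF assms(1) hit_component[of i]] by simp
  have Y: "Measurable.pred N (\<lambda>x. inside i (Y x) s)" for i s
    by (rule measurable_compose[OF assms(2) inside_measurable])
  have W: "Measurable.pred N (\<lambda>x. inside i (W x) s)" for i s
    by (rule measurable_compose[OF assms(3) inside_measurable])
  show ?thesis
    unfolding same_cell_hits_def
    by (intro pred_intros_logic(2-8) pred_intros_countable F Y W)
qed

lemma inv_area_hits_measurable:
  assumes "F \<in> N \<rightarrow>\<^sub>M hit_space" "Y \<in> N \<rightarrow>\<^sub>M borel"
  shows "(\<lambda>x. inv_area_hits (F x) (Y x)) \<in> borel_measurable N"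
proof -
  have snd: "snd \<in> N \<Otimes>\<^sub>M lborel \<rightarrow>\<^sub>M (borel :: (real^2) measure)"
    using measurable_snd[of N "lborel :: (real^2) measure"] by simp
  have m: "Measurable.pred (N \<Otimes>\<^sub>M lborel) (\<lambda>x. same_cell_hits (F (fst x)) (Y (fst x)) (snd x))"
    by (rule same_cell_hits_measurable[OF measurable_compose[OF measurable_fst assms(1)]
        measurable_compose[OF measurable_fst assms(2)] snd])
  have "(\<lambda>x. if same_cell_hits (F (fst x)) (Y (fst x)) (snd x) then 1 else 0 :: ennreal)
      \<in> borel_measurable (N \<Otimes>\<^sub>M lborel)"
    by (rule measurable_If[OF measurable_const measurable_const m[unfolded pred_def]]) simp_all
  then have "(\<lambda>x. \<integral>\<^sup>+w. (if same_cell_hits (F x) (Y x) w then 1 else 0) \<partial>lborel) \<in> borel_measurable N"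
    by (intro lborel.borel_measurable_nn_integral) (simp add: split_beta')
  then show ?thesis unfolding inv_area_hits_def by (rule borel_measurable_inverse_ennreal)
qed

text \<open>Finitely many strict inequalities at \<open>x\<close> survive on a small rational ball.
  The set \<open>Q\<close> lets one statement serve no, one or two disks.\<close>

lemma exists_hit_inside:
  assumes "\<And>y s. (y, s) \<in> Q \<Longrightarrow> dist x y < of_rat s" "finite Q" "x \<in> S"
  shows "\<exists>i. ball_hits S i \<and> (\<forall>(y, s)\<in>Q. inside i y s)"
proof -
  \<comment> \<open>The least slack, with 1 covering the case of empty \<open>Q\<close>. Centre and
    radius will each use less than half of it.\<close>
  define e where "e = Min (insert 1 ((\<lambda>(y, s). of_rat s - dist x y) ` Q))"
  have e: "e > 0"
    using assms(1,2) by (auto simp: e_def)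
  have e': "e \<le> of_rat s - dist x y" if "(y, s) \<in> Q" for y s
    unfolding e_def using assms(2) that by (intro Min_le) force+
  obtain r :: rat where r: "0 < real_of_rat r" "real_of_rat r < e / 2"
    using of_rat_dense[of 0 "e / 2"] e by auto
  obtain n where n: "dist (dense_seq n) x < of_rat r" using dense_seq[OF r(1)] by blast
  have "inside (n, r) y s" if "(y, s) \<in> Q" for y s
    using e'[OF that] n r dist_triangle[of "dense_seq n" y x] by (simp add: inside_def)
  moreover have "ball_hits S (n, r)" using n assms(3) by (auto simp: ball_hits_def)
  ultimately show ?thesis by blast
qed

lemma inside_hit: "x \<in> ball (dense_seq (fst i)) (of_rat (snd i)) \<Longrightarrow> inside i y s \<Longrightarrow> dist x y < of_rat s"
  using dist_triangle[of x y "dense_seq (fst i)"] by (simp add: inside_def dist_commute)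

lemma ex_hit1: "(\<exists>i. ball_hits S i \<and> inside i y s) \<longleftrightarrow> (\<exists>x\<in>S. dist x y < of_rat s)"
  using exists_hit_inside[of "{(y, s)}" _ S] inside_hit[of _ _ y s] by (fastforce simp: ball_hits_def)

lemma ex_hit2: "(\<exists>i. ball_hits S i \<and> inside i y s \<and> inside i w t) \<longleftrightarrow> (\<exists>x\<in>S. dist x y < of_rat s \<and> dist x w < of_rat t)"
  using exists_hit_inside[of "{(y, s), (w, t)}" _ S] inside_hit[of _ _ y s] inside_hit[of _ _ w t] 
  by (fastforce simp: ball_hits_def)

lemma ex_hit0: "(\<exists>i. ball_hits S i) \<longleftrightarrow> S \<noteq> {}"
  using exists_hit_inside[of "{}" _ S] by (auto simp: ball_hits_def)

text \<open>Yields a rational radius just beyond the nearest distance \<open>d\<close> that admits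
  none of finitely many strictly farther points. The bound \<open>d + 1\<close> fixes in advance the
  disk in which those points have to be listed.\<close>

lemma finite_gap:
  assumes "finite F" "\<And>x. x \<in> F \<Longrightarrow> (d::real) < g x"
  shows "\<exists>s::rat. d < of_rat s \<and> of_rat s < d + 1 \<and> (\<forall>x\<in>F. of_rat s < g x)"
proof -
  define m where "m = Min (insert (d + 1) (g ` F))"
  have "d < m" using assms by (auto simp: m_def)
  then obtain s where s: "d < real_of_rat s" "real_of_rat s < m" using of_rat_dense by blast
  have "m \<le> d + 1" "\<And>x. x \<in> F \<Longrightarrow> m \<le> g x" using assms by (auto simp: m_def)
  with s show ?thesis by (intro exI[of _ s]) (fastforce intro: less_le_trans)
qed

lemma same_cell_hits_iff:
  assumes lf: "locally_finite S"
  shows "same_cell_hits (ball_hits S) y w \<longleftrightarrow> same_cell S y w"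
proof
  assume L: "same_cell_hits (ball_hits S) y w"
  then have ne: "S \<noteq> {}" by (auto simp: same_cell_hits_def ball_hits_def)
  obtain a where a: "a \<in> S" "\<And>z. z \<in> S \<Longrightarrow> dist y a \<le> dist y z"
    using exists_nearest[OF lf ne, of y] by blast
  obtain b where b: "b \<in> S" "\<And>z. z \<in> S \<Longrightarrow> dist w b \<le> dist w z"
    using exists_nearest[OF lf ne, of w] by blast
  have fin: "finite (S \<inter> cball u r)" for u r using lf by (auto simp: locally_finite_def)
  have fin': "finite {x \<in> S \<inter> cball u r. d < dist u x}" for u r d
    by (rule finite_subset[OF _ fin[of u r]]) auto
  \<comment> \<open>The radii are so tight that the disks around \<open>y\<close> and
    \<open>w\<close> contain only nearest points; a point in both is a common nucleus.\<close>
  obtain s where s: "dist y a < of_rat s" "of_rat s < dist y a + 1"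
     "\<forall>x\<in>{x\<in>S \<inter> cball y (dist y a + 1). dist y a < dist y x}. of_rat s < dist y x"
    using finite_gap[OF fin'[of y "dist y a + 1" "dist y a"], of "dist y a" "dist y"] by blast
  obtain t where t: "dist w b < of_rat t" "of_rat t < dist w b + 1"
     "\<forall>x\<in>{x\<in>S \<inter> cball w (dist w b + 1). dist w b < dist w x}. of_rat t < dist w x"
    using finite_gap[OF fin'[of w "dist w b + 1" "dist w b"], of "dist w b" "dist w"] by blast
  have "\<exists>i. ball_hits S i \<and> inside i y s"
    unfolding ex_hit1 using a(1) s(1) by (auto simp: dist_commute)
  moreover have "\<exists>i. ball_hits S i \<and> inside i w t"
    unfolding ex_hit1 using b(1) t(1) by (auto simp: dist_commute)
  ultimately have "\<exists>i. ball_hits S i \<and> inside i y s \<and> inside i w t"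
    using L unfolding same_cell_hits_def by blast
  then obtain x where x: "x \<in> S" "dist y x < of_rat s" "dist w x < of_rat t"
    unfolding ex_hit2 by (auto simp: dist_commute)
  have "\<not> dist y a < dist y x" using s x by auto
  then have 1: "dist y x \<le> dist y z" if "z \<in> S" for z using a(2)[OF that] by linarith
  have "\<not> dist w b < dist w x" using t x by auto
  then have 2: "dist w x \<le> dist w z" if "z \<in> S" for z using b(2)[OF that] by linarith
  show "same_cell S y w"
    using x(1) 1 2 unfolding same_cell_def voronoi_cell_def by blast
next
  assume "same_cell S y w"
  then obtain x where x: "x \<in> S" "\<And>z. z \<in> S \<Longrightarrow> dist y x \<le> dist y z" "\<And>z. z \<in> S \<Longrightarrow> dist w x \<le> dist w z"
    by (auto simp: same_cell_def voronoi_cell_def)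
  \<comment> \<open>Conversely, a common nearest point lies in every disk around \<open>y\<close> or
    \<open>w\<close> that meets the set at all.\<close>
  have "\<exists>x\<in>S. dist x y < of_rat s \<and> dist x w < of_rat t"
    if "a \<in> S" "dist a y < of_rat s" "b \<in> S" "dist b w < of_rat t" for s t a b
  proof (rule bexI[OF _ x(1)])
    show "dist x y < of_rat s \<and> dist x w < of_rat t"
      using x(2)[of a] x(3)[of b] that unfolding dist_commute[of y] dist_commute[of w] by linarith
  qed
  then show "same_cell_hits (ball_hits S) y w"
    unfolding same_cell_hits_def ex_hit0 ex_hit1 ex_hit2 using x(1) by blast
qed

lemma same_cell_borel:
  assumes "locally_finite S"
  shows "{w. same_cell S y w} \<in> sets borel"
proof -
  have c: "(\<lambda>_. ball_hits S) \<in> borel \<rightarrow>\<^sub>M hit_space"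
    by (rule measurable_const) (simp add: space_PiM)
  have "Measurable.pred borel (\<lambda>w. same_cell_hits (ball_hits S) y w)"
    by (rule same_cell_hits_measurable[OF c]) simp_all
  then show ?thesis by (simp add: pred_def same_cell_hits_iff[OF assms])
qed

lemma inv_area_hits_eq:
  assumes lf: "locally_finite S"
  shows "inv_area_hits (ball_hits S) y = inv_area S y"
proof -
  have "(\<integral>\<^sup>+w. (if same_cell S y w then 1 else 0) \<partial>lborel) =
      (\<integral>\<^sup>+w. indicator {w. same_cell S y w} w \<partial>lborel)"
    by (intro nn_integral_cong) (auto simp: indicator_def)
  then show ?thesis
    using same_cell_borel[OF lf] by (simp add: inv_area_hits_def inv_area_def same_cell_hits_iff[OF lf])
qed

section \<open>Behaviour under translations\<close>

lemma voronoi_cell_translate: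
  "t + y \<in> voronoi_cell ((+) t ` S) (t + x) \<longleftrightarrow> y \<in> voronoi_cell S x"
  by (simp add: voronoi_cell_def)

lemma same_cell_translate: "same_cell ((+) t ` S) (t + y) (t + w) \<longleftrightarrow> same_cell S y w"
  by (simp add: same_cell_def voronoi_cell_translate)

lemma locally_finite_translate:
  fixes S :: "'a::real_normed_vector set"
  assumes "locally_finite S"
  shows "locally_finite ((+) t ` S)"
  unfolding locally_finite_def
proof (intro allI impI)
  fix A :: "'a set" assume "bounded A"
  then have "finite (S \<inter> (+) (-t) ` A)"
    using assms bounded_translation[of A "-t"] by (auto simp: locally_finite_def)
  moreover have "(+) t ` S \<inter> A = (+) t ` (S \<inter> (+) (-t) ` A)" by (force simp: image_iff)
  ultimately show "finite ((+) t ` S \<inter> A)" by simp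
qed

lemma inv_area_translate:
  assumes "locally_finite S"
  shows "inv_area ((+) t ` S) (t + y) = inv_area S y"
proof -
  have "{w. same_cell ((+) t ` S) (t + y) w} = (+) t ` {w. same_cell S y w}"
  proof (intro set_eqI iffI)
    fix w assume "w \<in> {w. same_cell ((+) t ` S) (t + y) w}"
    then show "w \<in> (+) t ` {w. same_cell S y w}"
      using same_cell_translate[of t S y "w - t"] by (auto simp: image_iff intro!: exI[of _ "w - t"])
  qed (auto simp: same_cell_translate)
  then show ?thesis
    by (simp add: inv_area_def emeasure_lborel_translate same_cell_borel[OF assms])
qed

lemma ball_hits_shift_iff:
  "ball_hits ((+) t ` S) i \<longleftrightarrow> S \<inter> ball (dense_seq (fst i) - t) (of_rat (snd i)) \<noteq> {}"
  by (auto simp: ball_hits_def dist_norm algebra_simps)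

lemma void_cylinder:
  assumes "finite J"
  shows "{f. \<forall>i\<in>J. \<not> f i} \<in> sets hit_space"
proof -
  have "{f \<in> space hit_space. \<not> f i} \<in> sets hit_space" for i
    using pred_intros_logic(2)[OF hit_component[of i]] by (simp add: pred_def)
  then have "{f \<in> space hit_space. \<forall>i\<in>J. \<not> f i} \<in> sets hit_space"
    using assms by (intro sets.sets_Collect_finite_All)
  then show ?thesis by (simp add: space_PiM)
qed

section \<open>The Poisson process: void probabilities and stationarity\<close>

locale poisson = prob_space M for M :: "'w measure" +
  fixes lam :: real and P :: "'w \<Rightarrow> (real^2) set"
  assumes lam: "lam > 0" and poisson: "poisson_process M lam P"
begin

lemma P_locally_finite [simp, intro]: "\<omega> \<in> space M \<Longrightarrow> locally_finite (P \<omega>)"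
  using poisson by (auto simp: poisson_process_def locally_finite_def)

lemma count_measurable:
  "A \<in> sets borel \<Longrightarrow> bounded A \<Longrightarrow> (\<lambda>\<omega>. card (P \<omega> \<inter> A)) \<in> M \<rightarrow>\<^sub>M count_space UNIV"
  using poisson by (auto simp: poisson_process_def)

lemma count_prob:
  "A \<in> sets borel \<Longrightarrow> bounded A \<Longrightarrow> prob {\<omega> \<in> space M. card (P \<omega> \<inter> A) = k} =
     exp (- (lam * measure lborel A)) * (lam * measure lborel A) ^ k / fact k"
  using poisson by (auto simp: poisson_process_def)

text \<open>\<open>card\<close> also vanishes on infinite sets; local finiteness is what makes a
  zero count mean emptiness.\<close>

lemma empty_iff_count: "\<omega> \<in> space M \<Longrightarrow> bounded A \<Longrightarrow> P \<omega> \<inter> A = {} \<longleftrightarrow> card (P \<omega> \<inter> A) = 0"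
  using P_locally_finite by (auto simp: locally_finite_def)

lemma empty_measurable:
  assumes "A \<in> sets borel" "bounded A"
  shows "{\<omega> \<in> space M. P \<omega> \<inter> A = {}} \<in> sets M"
proof -
  note [measurable] = count_measurable[OF assms]
  have "{\<omega> \<in> space M. card (P \<omega> \<inter> A) = 0} \<in> sets M" by measurable
  then show ?thesis using empty_iff_count[OF _ assms(2)] by (simp cong: conj_cong)
qed

lemma empty_prob:
  assumes "A \<in> sets borel" "bounded A"
  shows "prob {\<omega> \<in> space M. P \<omega> \<inter> A = {}} = exp (- (lam * measure lborel A))"
  using count_prob[OF assms, of 0] empty_iff_count[OF _ assms(2)] by (simp cong: conj_cong)

lemma ball_hits_measurable:
  "(\<lambda>\<omega>. ball_hits ((+) t ` P \<omega>)) \<in> M \<rightarrow>\<^sub>M hit_space"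
proof (rule measurable_PiM_single')
  fix i :: "nat \<times> rat"
  have "Measurable.pred M (\<lambda>\<omega>. P \<omega> \<inter> ball (dense_seq (fst i) - t) (of_rat (snd i)) = {})"
    unfolding pred_def by (rule empty_measurable) auto
  then show "(\<lambda>\<omega>. ball_hits ((+) t ` P \<omega>) i) \<in> M \<rightarrow>\<^sub>M count_space UNIV"
    unfolding ball_hits_shift_iff by (rule pred_intros_logic)
qed auto

text \<open>The void events are stable under intersection, so by Renyi's argument their probabilities
  already determine the law; this yields stationarity without using independence.\<close>

lemma hits_law_shift:
  "distr M hit_space (\<lambda>\<omega>. ball_hits ((+) t ` P \<omega>)) = distr M hit_space (\<lambda>\<omega>. ball_hits (P \<omega>))"
proof (rule measure_eqI_generator_eq)
  define E :: "(nat \<times> rat \<Rightarrow> bool) set set" where "E = (\<lambda>J. {f. \<forall>i\<in>J. \<not> f i}) ` {J. finite J}"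
  show "Int_stable E"
  proof (rule Int_stableI)
    fix a b assume "a \<in> E" "b \<in> E"
    then obtain J K where "finite J" "finite K" "a = {f. \<forall>i\<in>J. \<not> f i}" "b = {f. \<forall>i\<in>K. \<not> f i}"
      unfolding E_def by blast
    moreover from this have "a \<inter> b = {f. \<forall>i\<in>J \<union> K. \<not> f i}" by blast
    ultimately show "a \<inter> b \<in> E" unfolding E_def by blast
  qed
  show "E \<subseteq> Pow UNIV" by simp
  \<comment> \<open>Translation moves the union of the balls rigidly, so its void probability does
    not depend on \<open>t\<close>; the instance \<open>t = 0\<close> gives the unshifted
    law.\<close>
  have void: "emeasure (distr M hit_space (\<lambda>\<omega>. ball_hits ((+) t ` P \<omega>))) X =
      ennreal (exp (- (lam * measure lborel (\<Union>i\<in>J. ball (dense_seq (fst i)) (of_rat (snd i))))))"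
    if J: "finite J" "X = {f. \<forall>i\<in>J. \<not> f i}" for t J X
  proof -
    define A where "A = (\<Union>i\<in>J. ball (dense_seq (fst i)) (of_rat (snd i)))"
    define A' where "A' = (\<Union>i\<in>J. ball (dense_seq (fst i) - t) (of_rat (snd i)))"
    have A: "A \<in> sets borel" unfolding A_def by auto
    have A': "A' \<in> sets borel" "bounded A'" unfolding A'_def using J by auto
    have "A' = (+) (-t) ` A"
      unfolding A_def A'_def image_UN by (simp add: ball_translation_subtract cong: image_cong_simp)
    then have eqA: "measure lborel A' = measure lborel A"
      using emeasure_lborel_translate[OF A, of "-t"] by (simp add: measure_def)
    have "emeasure (distr M hit_space (\<lambda>\<omega>. ball_hits ((+) t ` P \<omega>))) X
        = emeasure M ((\<lambda>\<omega>. ball_hits ((+) t ` P \<omega>)) -` X \<inter> space M)"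
      unfolding J(2) by (intro emeasure_distr ball_hits_measurable void_cylinder J(1))
    also have "(\<lambda>\<omega>. ball_hits ((+) t ` P \<omega>)) -` X \<inter> space M = {\<omega> \<in> space M. P \<omega> \<inter> A' = {}}"
      unfolding J(2) by (auto simp: ball_hits_shift_iff A'_def)
    also have "emeasure M \<dots> = ennreal (exp (- (lam * measure lborel A')))"
      by (simp add: emeasure_eq_measure empty_prob[OF A'])
    finally show ?thesis unfolding eqA A_def .
  qed
  show "emeasure (distr M hit_space (\<lambda>\<omega>. ball_hits ((+) t ` P \<omega>))) X =
        emeasure (distr M hit_space (\<lambda>\<omega>. ball_hits (P \<omega>))) X" if X: "X \<in> E" for X
  proof -
    obtain J where J: "finite J" "X = {f. \<forall>i\<in>J. \<not> f i}" using X unfolding E_def by blast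
    show ?thesis using void[OF J, of t] void[OF J, of 0] by simp
  qed
  have gen: "sets hit_space = sigma_sets UNIV E"
  proof
    have E_sub: "\<And>X. X \<in> E \<Longrightarrow> X \<in> sets hit_space"
    proof -
      fix X assume "X \<in> E"
      then obtain J where J: "finite J" "X = {f. \<forall>i\<in>J. \<not> f i}" unfolding E_def by blast
      then show "X \<in> sets hit_space" by (simp add: void_cylinder)
    qed
    show "sigma_sets UNIV E \<subseteq> sets hit_space"
      using sets.sigma_sets_subset[of E hit_space] E_sub by (auto simp: space_PiM)
    \<comment> \<open>The generators are void events, so a coordinate becomes measurable through its
      negation.\<close>
    have "(\<lambda>f. f) \<in> sigma UNIV E \<rightarrow>\<^sub>M hit_space"
    proof (rule measurable_PiM_single')
      fix i :: "nat \<times> rat"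
      have "{f :: nat \<times> rat \<Rightarrow> bool. \<not> f i} \<in> E" unfolding E_def by (intro image_eqI[of _ _ "{i}"]) auto
      then have "{f \<in> space (sigma UNIV E). \<not> f i} \<in> sets (sigma UNIV E)" by auto
      then have "Measurable.pred (sigma UNIV E) (\<lambda>f. \<not> f i)" by (simp add: pred_def)
      then have "Measurable.pred (sigma UNIV E) (\<lambda>f. \<not> \<not> f i)" by (rule pred_intros_logic)
      then show "(\<lambda>f. f i) \<in> sigma UNIV E \<rightarrow>\<^sub>M count_space UNIV" by simp
    qed auto
    from measurable_sets[OF this]
    show "sets hit_space \<subseteq> sigma_sets UNIV E" by auto
  qed
  show "sets (distr M hit_space (\<lambda>\<omega>. ball_hits ((+) t ` P \<omega>))) = sigma_sets UNIV E"
    "sets (distr M hit_space (\<lambda>\<omega>. ball_hits (P \<omega>))) = sigma_sets UNIV E"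
    by (simp_all add: gen)
  show "range (\<lambda>_::nat. UNIV) \<subseteq> E" unfolding E_def by (auto intro!: image_eqI[of _ _ "{}"])
  show "(\<Union>i::nat. UNIV) = (UNIV :: (nat \<times> rat \<Rightarrow> bool) set)" by simp
  show "emeasure (distr M hit_space (\<lambda>\<omega>. ball_hits ((+) t ` P \<omega>))) UNIV \<noteq> \<infinity>" for i :: nat
    using prob_space.emeasure_space_1[OF prob_space_distr[OF ball_hits_measurable[of t]]]
    by (simp add: space_PiM)
qed

lemma ball_hits_measurable0 [measurable]: "(\<lambda>\<omega>. ball_hits (P \<omega>)) \<in> M \<rightarrow>\<^sub>M hit_space"
  using ball_hits_measurable[of 0] by simp

lemma same_cell_measurable:
  assumes [measurable]: "F \<in> N \<rightarrow>\<^sub>M M" "Y \<in> N \<rightarrow>\<^sub>M borel" "W \<in> N \<rightarrow>\<^sub>M borel"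
  shows "Measurable.pred N (\<lambda>x. same_cell (P (F x)) (Y x) (W x))"
proof -
  have "Measurable.pred N (\<lambda>x. same_cell_hits (ball_hits (P (F x))) (Y x) (W x))"
    by (rule same_cell_hits_measurable) measurable
  then show ?thesis
    by (rule measurable_cong[THEN iffD1, rotated]) (simp add: same_cell_hits_iff measurable_space[OF assms(1)])
qed

lemma inv_area_measurable:
  assumes [measurable]: "F \<in> N \<rightarrow>\<^sub>M M" "Y \<in> N \<rightarrow>\<^sub>M borel"
  shows "(\<lambda>x. inv_area (P (F x)) (Y x)) \<in> borel_measurable N"
proof -
  have "(\<lambda>x. inv_area_hits (ball_hits (P (F x))) (Y x)) \<in> borel_measurable N"
    by (rule inv_area_hits_measurable) measurable
  then show ?thesis
    by (rule measurable_cong[THEN iffD1, rotated]) (simp add: inv_area_hits_eq measurable_space[OF assms(1)])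
qed

text \<open>The three arguments of \<open>g\<close> are measurable functions of the hit pattern,
  whose law is shift invariant. Leaving \<open>g\<close> free lets one proof serve the pair density,
  the cut moment and the second moment.\<close>

lemma stationary:
  assumes [measurable]: "(\<lambda>(b, a, c). g b a c) \<in> borel_measurable (count_space UNIV \<Otimes>\<^sub>M borel \<Otimes>\<^sub>M borel)"
  shows "(\<integral>\<^sup>+\<omega>. g (same_cell (P \<omega>) (t + y) (t + z)) (inv_area (P \<omega>) (t + y)) (inv_area (P \<omega>) (t + z)) \<partial>M) =
         (\<integral>\<^sup>+\<omega>. (g :: bool \<Rightarrow> ennreal \<Rightarrow> ennreal \<Rightarrow> ennreal) (same_cell (P \<omega>) y z) (inv_area (P \<omega>) y) (inv_area (P \<omega>) z) \<partial>M)"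
proof -
  define \<Psi> where "\<Psi> f = g (same_cell_hits f y z) (inv_area_hits f y) (inv_area_hits f z)" for f
  have [measurable]: "Measurable.pred hit_space (\<lambda>f. same_cell_hits f y z)"
    "(\<lambda>f. inv_area_hits f y) \<in> borel_measurable hit_space" "(\<lambda>f. inv_area_hits f z) \<in> borel_measurable hit_space"
    by (auto intro!: same_cell_hits_measurable inv_area_hits_measurable)
  have "(\<lambda>f. (\<lambda>(b, a, c). g b a c) (same_cell_hits f y z, inv_area_hits f y, inv_area_hits f z)) \<in> borel_measurable hit_space"
    by measurable
  then have m[measurable]: "\<Psi> \<in> borel_measurable hit_space" by (simp add: \<Psi>_def[abs_def])
  have eq: "\<Psi> (ball_hits ((+) (-t) ` P \<omega>)) =
      g (same_cell (P \<omega>) (t + y) (t + z)) (inv_area (P \<omega>) (t + y)) (inv_area (P \<omega>) (t + z))"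
    if "\<omega> \<in> space M" for t \<omega>
  proof -
    have lf: "locally_finite (P \<omega>)" "locally_finite ((+) (-t) ` P \<omega>)"
      by (rule P_locally_finite[OF that], rule locally_finite_translate[OF P_locally_finite[OF that]])
    have "same_cell ((+) (-t) ` P \<omega>) y z = same_cell (P \<omega>) (t + y) (t + z)"
      "inv_area ((+) (-t) ` P \<omega>) y = inv_area (P \<omega>) (t + y)"
      "inv_area ((+) (-t) ` P \<omega>) z = inv_area (P \<omega>) (t + z)"
      using same_cell_translate[of "-t" "P \<omega>" "t + y" "t + z"]
        inv_area_translate[OF lf(1), of "-t" "t + y"] inv_area_translate[OF lf(1), of "-t" "t + z"]
      by simp_all
    then show ?thesis
      unfolding \<Psi>_def same_cell_hits_iff[OF lf(2)] inv_area_hits_eq[OF lf(2)] by simp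
  qed
  have m': "\<Psi> \<in> borel_measurable (distr M hit_space T)" for T using m by simp
  have "(\<integral>\<^sup>+\<omega>. \<Psi> (ball_hits ((+) (-t) ` P \<omega>)) \<partial>M) = (\<integral>\<^sup>+\<omega>. \<Psi> (ball_hits (P \<omega>)) \<partial>M)"
    using arg_cong[OF hits_law_shift[of "-t"], of "\<lambda>D. nn_integral D \<Psi>"]
    unfolding nn_integral_distr[OF ball_hits_measurable m'] nn_integral_distr[OF ball_hits_measurable0 m'] .
  moreover have "(\<integral>\<^sup>+\<omega>. \<Psi> (ball_hits ((+) (-t) ` P \<omega>)) \<partial>M) =
      (\<integral>\<^sup>+\<omega>. g (same_cell (P \<omega>) (t + y) (t + z)) (inv_area (P \<omega>) (t + y)) (inv_area (P \<omega>) (t + z)) \<partial>M)"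
    by (intro nn_integral_cong eq)
  moreover have "(\<integral>\<^sup>+\<omega>. \<Psi> (ball_hits (P \<omega>)) \<partial>M) =
      (\<integral>\<^sup>+\<omega>. g (same_cell (P \<omega>) y z) (inv_area (P \<omega>) y) (inv_area (P \<omega>) z) \<partial>M)"
    using eq[of _ 0] by (intro nn_integral_cong) simp
  ultimately show ?thesis by simp
qed

end

section \<open>Factorial moments\<close>

locale enumerated_poisson = poisson +
  fixes X :: "nat \<Rightarrow> 'a \<Rightarrow> real^2"
  assumes X_measurable [measurable]: "\<And>n. X n \<in> borel_measurable M"
    and X_enumerates: "AE \<omega> in M. inj (\<lambda>n. X n \<omega>) \<and> P \<omega> = range (\<lambda>n. X n \<omega>)"
begin

lemma count_as_sum:
  assumes "bounded A"
  shows "AE \<omega> in M. (\<integral>\<^sup>+n. indicator A (X n \<omega>) \<partial>count_space UNIV) = of_nat (card (P \<omega> \<inter> A))"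
  using X_enumerates AE_space
proof eventually_elim
  fix \<omega> assume *: "inj (\<lambda>n. X n \<omega>) \<and> P \<omega> = range (\<lambda>n. X n \<omega>)" "\<omega> \<in> space M"
  define I where "I = {n. X n \<omega> \<in> A}"
  have img: "(\<lambda>n. X n \<omega>) ` I = P \<omega> \<inter> A" using * by (auto simp: I_def)
  have inj: "inj_on (\<lambda>n. X n \<omega>) I" using * by (auto intro: inj_on_subset)
  have fin: "finite (P \<omega> \<inter> A)" using P_locally_finite[OF *(2)] assms by (auto simp: locally_finite_def)
  then have finI: "finite I" using finite_imageD[OF _ inj] img by simp
  have "(\<integral>\<^sup>+n. indicator A (X n \<omega>) \<partial>count_space UNIV) = (\<integral>\<^sup>+n. indicator I n \<partial>count_space UNIV)"
    by (intro nn_integral_cong) (auto simp: I_def indicator_def)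
  also have "\<dots> = of_nat (card I)" using finI by simp
  also have "card I = card (P \<omega> \<inter> A)" using card_image[OF inj] img by simp
  finally show "(\<integral>\<^sup>+n. indicator A (X n \<omega>) \<partial>count_space UNIV) = of_nat (card (P \<omega> \<inter> A))" .
qed

lemma expected_count:
  assumes A: "A \<in> sets borel" "bounded A"
  shows "(\<integral>\<^sup>+\<omega>. of_nat (card (P \<omega> \<inter> A)) \<partial>M) = ennreal (lam * measure lborel A)"
proof -
  define m where "m = lam * measure lborel A"
  have m: "m \<ge> 0" using lam by (simp add: m_def)
  define N where "N \<omega> = card (P \<omega> \<inter> A)" for \<omega>
  have N[measurable]: "N \<in> M \<rightarrow>\<^sub>M count_space UNIV"
    unfolding N_def by (rule count_measurable[OF A])
  have ev: "{\<omega> \<in> space M. N \<omega> = k} \<in> sets M" for k by measurable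
  have "(\<integral>\<^sup>+\<omega>. of_nat (N \<omega>) \<partial>M) = (\<integral>\<^sup>+\<omega>. (\<Sum>k. of_nat k * indicator {\<omega> \<in> space M. N \<omega> = k} \<omega>) \<partial>M)"
  proof (rule nn_integral_cong)
    fix \<omega> assume "\<omega> \<in> space M"
    then have "(\<Sum>k. of_nat k * indicator {\<omega> \<in> space M. N \<omega> = k} \<omega>) =
        (\<Sum>k\<in>{N \<omega>}. of_nat k * indicator {\<omega> \<in> space M. N \<omega> = k} \<omega> :: ennreal)"
      by (intro suminf_finite) auto
    then show "of_nat (N \<omega>) = (\<Sum>k. of_nat k * indicator {\<omega> \<in> space M. N \<omega> = k} \<omega> :: ennreal)"
      using \<open>\<omega> \<in> space M\<close> by simp
  qed
  also have "\<dots> = (\<Sum>k. \<integral>\<^sup>+\<omega>. of_nat k * indicator {\<omega> \<in> space M. N \<omega> = k} \<omega> \<partial>M)"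
    using ev by (intro nn_integral_suminf) auto
  also have "\<dots> = (\<Sum>k. ennreal (real k * (exp (- m) * m ^ k / fact k)))"
  proof (rule suminf_cong)
    fix k
    have "(\<integral>\<^sup>+\<omega>. of_nat k * indicator {\<omega> \<in> space M. N \<omega> = k} \<omega> \<partial>M) = of_nat k * emeasure M {\<omega> \<in> space M. N \<omega> = k}"
      using ev by (intro nn_integral_cmult_indicator)
    also have "\<dots> = of_nat k * ennreal (exp (- m) * m ^ k / fact k)"
      using count_prob[OF A, of k] by (simp add: emeasure_eq_measure N_def m_def)
    also have "\<dots> = ennreal (real k * (exp (- m) * m ^ k / fact k))"
      unfolding ennreal_of_nat_eq_real_of_nat using m by (intro ennreal_mult[symmetric]) auto
    finally show "(\<integral>\<^sup>+\<omega>. of_nat k * indicator {\<omega> \<in> space M. N \<omega> = k} \<omega> \<partial>M) = ennreal (real k * (exp (- m) * m ^ k / fact k))" .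
  qed
  also have "\<dots> = ennreal m"
  proof (rule suminf_ennreal_eq)
    show "0 \<le> real k * (exp (- m) * m ^ k / fact k)" for k using m by simp
    have "(\<lambda>k. m ^ k / fact k) sums exp m"
      using exp_converges[of m] by (simp add: divide_inverse mult.commute)
    \<comment> \<open>The term with \<open>k = 0\<close> vanishes; the others are \<open>m\<close>
      times the Poisson weights with the index lowered by one.\<close>
    then have "(\<lambda>k. m * exp (- m) * (m ^ k / fact k)) sums (m * exp (- m) * exp m)"
      by (rule sums_mult)
    moreover have "m * exp (- m) * (m ^ k / fact k) = real (Suc k) * (exp (- m) * m ^ Suc k / fact (Suc k))" for k
      by (simp add: fact_Suc del: of_nat_Suc) 
    ultimately have "(\<lambda>k. real (Suc k) * (exp (- m) * m ^ Suc k / fact (Suc k))) sums m"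
      using exp_minus_inverse[of m] by (simp add: mult_ac del: of_nat_Suc fact_Suc)
    then show "(\<lambda>k. real k * (exp (- m) * m ^ k / fact k)) sums m"
      by (subst (asm) sums_Suc_iff) simp
  qed
  finally show ?thesis by (simp add: N_def m_def)
qed

definition void :: "(real^2) set \<Rightarrow> 'a \<Rightarrow> ennreal" where
  "void W \<omega> = (if P \<omega> \<inter> W = {} then 1 else 0)"

lemma void_measurable:
  "W \<in> sets borel \<Longrightarrow> bounded W \<Longrightarrow> void W \<in> borel_measurable M"
  unfolding void_def by (intro measurable_If empty_measurable) auto

text \<open>Disjoint sets have independent counts, and emptiness of \<open>W\<close> is itself a
  statement about a count.\<close>

lemma expected_void_product:
  fixes k :: nat
  assumes W: "W \<in> sets borel" "bounded W"
    and A: "\<And>i. i < k \<Longrightarrow> A i \<in> sets borel" "\<And>i. i < k \<Longrightarrow> bounded (A i)"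
    and disj: "\<And>i. i < k \<Longrightarrow> A i \<inter> W = {}" "\<And>i j. i < k \<Longrightarrow> j < k \<Longrightarrow> i \<noteq> j \<Longrightarrow> A i \<inter> A j = {}"
  shows "(\<integral>\<^sup>+\<omega>. void W \<omega> * (\<Prod>i<k. of_nat (card (P \<omega> \<inter> A i))) \<partial>M) =
         ennreal (exp (- (lam * measure lborel W))) * (\<Prod>i<k. ennreal (lam * measure lborel (A i)))"
proof -
  \<comment> \<open>Independence is assumed for infinite sequences of sets: \<open>W\<close> takes
    index 0, the \<open>A i\<close> follow shifted by one, and empty sets fill the rest.\<close>
  define B where "B i = (if i = (0::nat) then W else if i \<le> k then A (i - 1) else {})" for i
  define g where "g i = (if i = 0 then (\<lambda>c::nat. if c = 0 then 1 else 0) else of_nat :: nat \<Rightarrow> ennreal)" for i :: nat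
  have B: "B i \<in> sets borel" "bounded (B i)" for i
    using W A[of "i - 1"] by (auto simp: B_def)
  have "disjoint_family B"
  proof (unfold disjoint_family_on_def, intro ballI impI)
    have *: "B i \<inter> B j = {}" if "i < j" for i j
    proof (cases "j \<le> k")
      case j: True
      then have Bj: "B j = A (j - 1)" "j - 1 < k" using that by (auto simp: B_def)
      show ?thesis
      proof (cases "i = 0")
        case True
        then have "B i = W" by (simp add: B_def)
        then show ?thesis using disj(1)[OF Bj(2)] Bj(1) by (simp add: Int_commute)
      next
        case False
        then have "B i = A (i - 1)" "i - 1 < k" "i - 1 \<noteq> j - 1" using that j by (auto simp: B_def)
        then show ?thesis using disj(2)[of "i - 1" "j - 1"] Bj by simp
      qed
    qed (use that in \<open>simp add: B_def\<close>)
    fix i j :: nat assume "i \<noteq> j"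
    then consider "i < j" | "j < i" by linarith
    then show "B i \<inter> B j = {}" by cases (use *[of i j] *[of j i] in auto)
  qed
  then have "indep_vars (\<lambda>_. count_space UNIV) (\<lambda>i \<omega>. card (P \<omega> \<inter> B i)) UNIV"
    using poisson B unfolding poisson_process_def by blast
  then have "indep_vars (\<lambda>_. count_space UNIV) (\<lambda>i \<omega>. card (P \<omega> \<inter> B i)) {..<Suc k}"
    by (rule indep_vars_subset) auto
  then have "indep_vars (\<lambda>_. borel) (\<lambda>i \<omega>. g i (card (P \<omega> \<inter> B i))) {..<Suc k}"
    by (rule indep_vars_compose2) auto
  from indep_vars_nn_integral[OF _ this]
  have "(\<integral>\<^sup>+\<omega>. (\<Prod>i<Suc k. g i (card (P \<omega> \<inter> B i))) \<partial>M) =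
      (\<Prod>i<Suc k. \<integral>\<^sup>+\<omega>. g i (card (P \<omega> \<inter> B i)) \<partial>M)" by simp
  moreover have "(\<Prod>i<Suc k. g i (card (P \<omega> \<inter> B i))) = void W \<omega> * (\<Prod>i<k. of_nat (card (P \<omega> \<inter> A i)))"
    if "\<omega> \<in> space M" for \<omega>
  proof -
    have "(\<Prod>i<Suc k. g i (card (P \<omega> \<inter> B i))) = g 0 (card (P \<omega> \<inter> B 0)) * (\<Prod>i<k. g (Suc i) (card (P \<omega> \<inter> B (Suc i))))"
      by (rule prod.lessThan_Suc_shift)
    also have "g 0 (card (P \<omega> \<inter> B 0)) = void W \<omega>"
      using empty_iff_count[OF that W(2)] by (auto simp: g_def B_def void_def)
    also have "(\<Prod>i<k. g (Suc i) (card (P \<omega> \<inter> B (Suc i)))) = (\<Prod>i<k. of_nat (card (P \<omega> \<inter> A i)))"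
      by (intro prod.cong) (auto simp: g_def B_def)
    finally show ?thesis .
  qed
  then have "(\<integral>\<^sup>+\<omega>. (\<Prod>i<Suc k. g i (card (P \<omega> \<inter> B i))) \<partial>M) =
      (\<integral>\<^sup>+\<omega>. void W \<omega> * (\<Prod>i<k. of_nat (card (P \<omega> \<inter> A i))) \<partial>M)"
    by (rule nn_integral_cong)
  moreover have "(\<Prod>i<Suc k. \<integral>\<^sup>+\<omega>. g i (card (P \<omega> \<inter> B i)) \<partial>M) =
      ennreal (exp (- (lam * measure lborel W))) * (\<Prod>i<k. ennreal (lam * measure lborel (A i)))"
  proof -
    have "(\<integral>\<^sup>+\<omega>. g 0 (card (P \<omega> \<inter> B 0)) \<partial>M) = (\<integral>\<^sup>+\<omega>. indicator {\<omega>\<in>space M. P \<omega> \<inter> W = {}} \<omega> \<partial>M)"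
      using empty_iff_count[OF _ W(2)] by (intro nn_integral_cong) (auto simp: g_def B_def indicator_def)
    also have "\<dots> = ennreal (exp (- (lam * measure lborel W)))"
      using empty_measurable[OF W] by (simp add: emeasure_eq_measure empty_prob[OF W])
    finally have 0: "(\<integral>\<^sup>+\<omega>. g 0 (card (P \<omega> \<inter> B 0)) \<partial>M) = ennreal (exp (- (lam * measure lborel W)))" .
    have "(\<integral>\<^sup>+\<omega>. g (Suc i) (card (P \<omega> \<inter> B (Suc i))) \<partial>M) = ennreal (lam * measure lborel (A i))" if "i < k" for i
      using expected_count[OF A(1)[OF that] A(2)[OF that]] that by (simp add: g_def B_def)
    then show ?thesis
      unfolding prod.lessThan_Suc_shift 0 by (intro arg_cong2[where f = "(*)"] refl prod.cong) auto
  qed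
  ultimately show ?thesis by simp
qed

text \<open>Sums over \<open>k\<close>-tuples of indices are written as integrals for a product of
  counting measures, which makes Tonelli's theorem and the product formulas available.\<close>

definition tuples :: "nat \<Rightarrow> (nat \<Rightarrow> nat) measure" where
  "tuples k = Pi\<^sub>M {..<k} (\<lambda>_. count_space UNIV)"

definition pick :: "nat \<Rightarrow> 'a \<Rightarrow> (nat \<Rightarrow> nat) \<Rightarrow> nat \<Rightarrow> real^2" where
  "pick k \<omega> \<sigma> = (\<lambda>i\<in>{..<k}. X (\<sigma> i) \<omega>)"

end

lemma product_sigma_finite_nat: "product_sigma_finite (\<lambda>_. count_space (UNIV :: nat set))"
  by (intro product_sigma_finite.intro sigma_finite_measure_count_space)

lemma product_sigma_finite_lborel: "product_sigma_finite (\<lambda>_. lborel :: 'a::euclidean_space measure)"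
  by (intro product_sigma_finite.intro lborel.sigma_finite_measure_axioms)

abbreviation plane_tuples :: "nat \<Rightarrow> (nat \<Rightarrow> real^2) measure" where
  "plane_tuples k \<equiv> Pi\<^sub>M {..<k} (\<lambda>_. lborel)"

context enumerated_poisson
begin

lemma sigma_finite_tuples: "sigma_finite_measure (tuples k)"
proof -
  interpret product_sigma_finite "\<lambda>_::nat. count_space (UNIV :: nat set)" by (rule product_sigma_finite_nat)
  show ?thesis unfolding tuples_def by (rule sigma_finite) simp
qed

lemma pick_component_measurable:
  assumes "i < k"
  shows "(\<lambda>x. X (snd x i) (fst x)) \<in> borel_measurable (M \<Otimes>\<^sub>M tuples k)"
proof (rule measurable_compose_countable[of "\<lambda>n x. X n (fst x)" _ _ "\<lambda>x. snd x i"])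
  show "(\<lambda>x. X n (fst x)) \<in> borel_measurable (M \<Otimes>\<^sub>M tuples k)" for n
    by (rule measurable_compose[OF measurable_fst X_measurable])
  show "(\<lambda>x. snd x i) \<in> M \<Otimes>\<^sub>M tuples k \<rightarrow>\<^sub>M count_space UNIV"
    unfolding tuples_def using assms
    by (intro measurable_compose[OF measurable_snd measurable_component_singleton]) auto
qed

lemma pick_measurable: "(\<lambda>x. pick k (fst x) (snd x)) \<in> M \<Otimes>\<^sub>M tuples k \<rightarrow>\<^sub>M plane_tuples k"
proof -
  have "(\<lambda>x. X (snd x i) (fst x)) \<in> M \<Otimes>\<^sub>M tuples k \<rightarrow>\<^sub>M lborel" if "i < k" for i
    using pick_component_measurable[OF that] by simp
  then show ?thesis
    unfolding pick_def by (intro measurable_restrict) auto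
qed

lemma sum_prod_tuples:
  "(\<integral>\<^sup>+\<sigma>. (\<Prod>i<k. f i (\<sigma> i)) \<partial>tuples k) = (\<Prod>i<k. \<integral>\<^sup>+n. f i n \<partial>count_space UNIV)"
proof -
  interpret product_sigma_finite "\<lambda>_::nat. count_space (UNIV :: nat set)" by (rule product_sigma_finite_nat)
  show ?thesis unfolding tuples_def by (rule product_nn_integral_prod) auto
qed

lemma box_integrand_measurable:
  assumes W: "W \<in> sets borel" "bounded W" and Q: "\<And>i. i < k \<Longrightarrow> Q i \<in> sets borel"
    and f: "f \<in> borel_measurable (plane_tuples k)"
  shows "(\<lambda>x. void W (fst x) * (\<Prod>i<k. indicator (Q i) (X (snd x i) (fst x))) * f (pick k (fst x) (snd x)))
      \<in> borel_measurable (M \<Otimes>\<^sub>M tuples k)"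
proof (intro borel_measurable_times_ennreal borel_measurable_prod_ennreal)
  show "(\<lambda>x. indicator (Q i) (X (snd x i) (fst x)) :: ennreal) \<in> borel_measurable (M \<Otimes>\<^sub>M tuples k)" if "i \<in> {..<k}" for i
    using that Q by (intro measurable_compose[OF pick_component_measurable borel_measurable_indicator]) auto
  show "(\<lambda>x. void W (fst x)) \<in> borel_measurable (M \<Otimes>\<^sub>M tuples k)"
    by (rule measurable_compose[OF measurable_fst void_measurable[OF W]])
  show "(\<lambda>x. f (pick k (fst x) (snd x))) \<in> borel_measurable (M \<Otimes>\<^sub>M tuples k)"
    by (rule measurable_compose[OF pick_measurable f])
qed

text \<open>Tuples confined to disjoint boxes have distinct entries automatically, so factorial
  moments become expectations of products of counts. Both sides, divided by the void probability,
  are integrals of \<open>f\<close> for measures on tuples of points; these measures agree on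
  products of sets and hence coincide.\<close>

lemma box_factorial_moment:
  assumes W: "W \<in> sets borel" "bounded W"
    and Q: "\<And>i. i < k \<Longrightarrow> Q i \<in> sets borel" "\<And>i. i < k \<Longrightarrow> bounded (Q i)"
    and disj: "\<And>i. i < k \<Longrightarrow> Q i \<inter> W = {}" "\<And>i j. i < k \<Longrightarrow> j < k \<Longrightarrow> i \<noteq> j \<Longrightarrow> Q i \<inter> Q j = {}"
    and f: "f \<in> borel_measurable (plane_tuples k)"
  shows "(\<integral>\<^sup>+\<omega>. (\<integral>\<^sup>+\<sigma>. void W \<omega> * (\<Prod>i<k. indicator (Q i) (X (\<sigma> i) \<omega>)) * f (pick k \<omega> \<sigma>) \<partial>tuples k) \<partial>M) =
     ennreal (exp (- (lam * measure lborel W))) * (\<integral>\<^sup>+x. ennreal (lam ^ k) * (\<Prod>i<k. indicator (Q i) (x i)) * f x \<partial>plane_tuples k)"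
proof -
  interpret tup: sigma_finite_measure "tuples k" by (rule sigma_finite_tuples)
  interpret PL: product_sigma_finite "\<lambda>_::nat. lborel :: (real^2) measure" by (rule product_sigma_finite_lborel)
  define D where "D i = density lborel (\<lambda>x. ennreal lam * indicator (Q i) x)" for i
  have Dm: "emeasure (D i) B = ennreal (lam * measure lborel (B \<inter> Q i))" if "i < k" "B \<in> sets borel" for i B
  proof -
    note [measurable] = Q(1)[OF that(1)] that(2)
    have "emeasure (D i) B = (\<integral>\<^sup>+x. ennreal lam * indicator (B \<inter> Q i) x \<partial>lborel)"
      unfolding D_def by (subst emeasure_density) (auto simp: indicator_inter_arith mult_ac intro!: nn_integral_cong)
    also have "\<dots> = ennreal lam * emeasure lborel (B \<inter> Q i)"
      by (rule nn_integral_cmult_indicator) simp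
    also have "emeasure lborel (B \<inter> Q i) = ennreal (measure lborel (B \<inter> Q i))"
      using emeasure_bounded_finite[OF bounded_subset[OF Q(2)[OF that(1)] Int_lower2], of B]
      by (intro emeasure_eq_ennreal_measure less_imp_neq) simp
    finally show ?thesis using lam by (simp add: ennreal_mult)
  qed
  \<comment> \<open>Indices from \<open>k\<close> on are padded because the product locale asks for
    a sigma-finite measure at every index.\<close>
  define D' where "D' i = (if i < k then D i else lborel)" for i
  have setsD': "sets (D' i) = sets lborel" for i by (simp add: D'_def D_def)
  interpret PD: product_sigma_finite D'
  proof (rule product_sigma_finite.intro)
    fix i
    show "sigma_finite_measure (D' i)"
    proof (cases "i < k")
      case True
      then have "emeasure (D' i) (space (D' i)) \<noteq> \<infinity>"
        using Dm[OF True, of UNIV] by (simp add: D'_def D_def)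
      then have "finite_measure (D' i)" by (rule finite_measureI)
      then show ?thesis by (simp add: finite_measure_def)
    qed (simp add: D'_def lborel.sigma_finite_measure_axioms)
  qed
  have setsPD: "sets (Pi\<^sub>M {..<k} D') = sets (plane_tuples k)"
    by (intro sets_PiM_cong setsD') simp
  \<comment> \<open>Multiplying by \<open>e\<close> cancels the probability that \<open>W\<close> is
    empty, leaving a genuine product measure.\<close>
  define e where "e = ennreal (exp (lam * measure lborel W))"
  have [measurable]: "void W \<in> borel_measurable M" by (rule void_measurable[OF W])
  define w where "w = (\<lambda>x. e * void W (fst x) * (\<Prod>i<k. indicator (Q i) (X (snd x i) (fst x)) :: ennreal))"
  have [measurable]: "w \<in> borel_measurable (M \<Otimes>\<^sub>M tuples k)"
  proof -
    have "(\<lambda>x. indicator (Q i) (X (snd x i) (fst x)) :: ennreal) \<in> borel_measurable (M \<Otimes>\<^sub>M tuples k)" if "i < k" for i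
      using pick_component_measurable[OF that] Q(1)[OF that]
      by (rule measurable_compose[OF _ borel_measurable_indicator]) 
    then show ?thesis unfolding w_def by (intro borel_measurable_times_ennreal borel_measurable_prod_ennreal) auto
  qed
  note [measurable] = pick_measurable[of k]
  define \<mu> where "\<mu> = distr (density (M \<Otimes>\<^sub>M tuples k) w) (plane_tuples k) (\<lambda>x. pick k (fst x) (snd x))"
  define \<nu> where "\<nu> = density (plane_tuples k) (\<lambda>x. ennreal (lam ^ k) * (\<Prod>i<k. indicator (Q i) (x i)))"
  have prodQ[measurable]: "(\<lambda>x. ennreal (lam ^ k) * (\<Prod>i<k. indicator (Q i) (x i))) \<in> borel_measurable (plane_tuples k)"
  proof -
    have "(\<lambda>x. indicator (Q i) (x i) :: ennreal) \<in> borel_measurable (plane_tuples k)" if "i < k" for i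
      using that Q(1)[OF that] by (intro measurable_compose[OF measurable_component_singleton borel_measurable_indicator]) auto
    then show ?thesis by (intro borel_measurable_times_ennreal borel_measurable_prod_ennreal) auto
  qed
  have \<mu>: "\<mu> = Pi\<^sub>M {..<k} D'"
  proof (rule PD.PiM_eqI)
    show "sets \<mu> = sets (Pi\<^sub>M {..<k} D')" by (simp add: \<mu>_def setsPD)
    fix A assume "\<And>i. i \<in> {..<k} \<Longrightarrow> A i \<in> sets (D' i)"
    then have A: "A i \<in> sets borel" if "i < k" for i using that by (simp add: setsD')
    have AQ: "A i \<inter> Q i \<in> sets borel" "bounded (A i \<inter> Q i)" if "i < k" for i
      using A[OF that] Q[OF that] by (auto intro: bounded_subset)
    have S: "Pi\<^sub>E {..<k} A \<in> sets (plane_tuples k)" using A by (intro sets_PiM_I_finite) auto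
    have "emeasure \<mu> (Pi\<^sub>E {..<k} A) = (\<integral>\<^sup>+x. indicator (Pi\<^sub>E {..<k} A) x \<partial>\<mu>)"
      using S by (simp add: \<mu>_def)
    also have "\<dots> = (\<integral>\<^sup>+x. w x * indicator (Pi\<^sub>E {..<k} A) (pick k (fst x) (snd x)) \<partial>(M \<Otimes>\<^sub>M tuples k))"
      unfolding \<mu>_def using S
      by (subst nn_integral_distr) (auto intro!: nn_integral_density simp: measurable_compose[OF pick_measurable borel_measurable_indicator])
    also have "\<dots> = (\<integral>\<^sup>+x. e * void W (fst x) * (\<Prod>i<k. indicator (A i \<inter> Q i) (X (snd x i) (fst x))) \<partial>(M \<Otimes>\<^sub>M tuples k))"
    proof (rule nn_integral_cong)
      fix x
      have "indicator (Pi\<^sub>E {..<k} A) (pick k (fst x) (snd x)) = (\<Prod>i<k. indicator (A i) (X (snd x i) (fst x)) :: ennreal)"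
        by (auto simp: indicator_def pick_def PiE_iff prod_zero_iff)
      then show "w x * indicator (Pi\<^sub>E {..<k} A) (pick k (fst x) (snd x)) =
          e * void W (fst x) * (\<Prod>i<k. indicator (A i \<inter> Q i) (X (snd x i) (fst x)))"
        by (simp add: w_def prod.distrib[symmetric] indicator_inter_arith mult_ac)
    qed
    also have "\<dots> = (\<integral>\<^sup>+\<omega>. (\<integral>\<^sup>+\<sigma>. e * void W \<omega> * (\<Prod>i<k. indicator (A i \<inter> Q i) (X (\<sigma> i) \<omega>)) \<partial>tuples k) \<partial>M)"
    proof (subst tup.nn_integral_fst[symmetric])
      have "(\<lambda>x. indicator (A i \<inter> Q i) (X (snd x i) (fst x)) :: ennreal) \<in> borel_measurable (M \<Otimes>\<^sub>M tuples k)" if "i < k" for i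
        using pick_component_measurable[OF that] AQ(1)[OF that]
        by (rule measurable_compose[OF _ borel_measurable_indicator])
      then show "(\<lambda>x. e * void W (fst x) * (\<Prod>i<k. indicator (A i \<inter> Q i) (X (snd x i) (fst x)))) \<in> borel_measurable (M \<Otimes>\<^sub>M tuples k)"
        by (intro borel_measurable_times_ennreal borel_measurable_prod_ennreal) auto
    qed simp
    also have "\<dots> = (\<integral>\<^sup>+\<omega>. e * (void W \<omega> * (\<Prod>i<k. of_nat (card (P \<omega> \<inter> (A i \<inter> Q i))))) \<partial>M)"
    proof (rule nn_integral_cong_AE)
      have "AE \<omega> in M. \<forall>i\<in>{..<k}. (\<integral>\<^sup>+n. indicator (A i \<inter> Q i) (X n \<omega>) \<partial>count_space UNIV) = of_nat (card (P \<omega> \<inter> (A i \<inter> Q i)))"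
        using AQ count_as_sum by (intro AE_finite_allI) auto
      then show "AE \<omega> in M. (\<integral>\<^sup>+\<sigma>. e * void W \<omega> * (\<Prod>i<k. indicator (A i \<inter> Q i) (X (\<sigma> i) \<omega>)) \<partial>tuples k) =
         e * (void W \<omega> * (\<Prod>i<k. of_nat (card (P \<omega> \<inter> (A i \<inter> Q i)))))"
      proof eventually_elim
        case (elim \<omega>)
        have m: "(\<lambda>\<sigma>. (\<Prod>i<k. indicator (A i \<inter> Q i) (X (\<sigma> i) \<omega>) :: ennreal)) \<in> borel_measurable (tuples k)"
          unfolding tuples_def
          by (intro borel_measurable_prod_ennreal measurable_compose[OF measurable_component_singleton]) auto
        have "(\<integral>\<^sup>+\<sigma>. e * void W \<omega> * (\<Prod>i<k. indicator (A i \<inter> Q i) (X (\<sigma> i) \<omega>)) \<partial>tuples k) =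
            e * void W \<omega> * (\<integral>\<^sup>+\<sigma>. (\<Prod>i<k. indicator (A i \<inter> Q i) (X (\<sigma> i) \<omega>)) \<partial>tuples k)"
          by (rule nn_integral_cmult[OF m])
        also have "(\<integral>\<^sup>+\<sigma>. (\<Prod>i<k. indicator (A i \<inter> Q i) (X (\<sigma> i) \<omega>)) \<partial>tuples k) =
            (\<Prod>i<k. \<integral>\<^sup>+n. indicator (A i \<inter> Q i) (X n \<omega>) \<partial>count_space UNIV)"
          by (rule sum_prod_tuples)
        also have "\<dots> = (\<Prod>i<k. of_nat (card (P \<omega> \<inter> (A i \<inter> Q i))))"
          using elim by (intro prod.cong) auto
        finally show ?case by (simp add: mult.assoc)
      qed
    qed
    also have "\<dots> = e * (\<integral>\<^sup>+\<omega>. void W \<omega> * (\<Prod>i<k. of_nat (card (P \<omega> \<inter> (A i \<inter> Q i)))) \<partial>M)"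
    proof (rule nn_integral_cmult)
      have "(\<lambda>\<omega>. of_nat (card (P \<omega> \<inter> (A i \<inter> Q i))) :: ennreal) \<in> borel_measurable M" if "i < k" for i
        using count_measurable[OF AQ[OF that]] by (rule measurable_compose) simp
      then show "(\<lambda>\<omega>. void W \<omega> * (\<Prod>i<k. of_nat (card (P \<omega> \<inter> (A i \<inter> Q i))))) \<in> borel_measurable M"
        by (intro borel_measurable_times_ennreal borel_measurable_prod_ennreal) auto
    qed
    also have "(\<integral>\<^sup>+\<omega>. void W \<omega> * (\<Prod>i<k. of_nat (card (P \<omega> \<inter> (A i \<inter> Q i)))) \<partial>M) =
        ennreal (exp (- (lam * measure lborel W))) * (\<Prod>i<k. ennreal (lam * measure lborel (A i \<inter> Q i)))"
      using disj AQ by (intro expected_void_product W) blast+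
    also have "e * (ennreal (exp (- (lam * measure lborel W))) * (\<Prod>i<k. ennreal (lam * measure lborel (A i \<inter> Q i)))) =
        (\<Prod>i<k. ennreal (lam * measure lborel (A i \<inter> Q i)))"
      by (simp add: e_def mult.assoc[symmetric] ennreal_mult[symmetric] exp_minus)
    also have "\<dots> = (\<Prod>i<k. emeasure (D' i) (A i))"
      using A by (intro prod.cong) (auto simp: Dm D'_def)
    finally show "emeasure \<mu> (Pi\<^sub>E {..<k} A) = (\<Prod>i\<in>{..<k}. emeasure (D' i) (A i))" .
  qed simp
  have \<nu>: "\<nu> = Pi\<^sub>M {..<k} D'"
  proof (rule PD.PiM_eqI)
    show "sets \<nu> = sets (Pi\<^sub>M {..<k} D')" by (simp add: \<nu>_def setsPD)
    fix A assume "\<And>i. i \<in> {..<k} \<Longrightarrow> A i \<in> sets (D' i)"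
    then have A: "A i \<in> sets borel" if "i < k" for i using that by (simp add: setsD')
    have S: "Pi\<^sub>E {..<k} A \<in> sets (plane_tuples k)" using A by (intro sets_PiM_I_finite) auto
    have "emeasure \<nu> (Pi\<^sub>E {..<k} A) =
       (\<integral>\<^sup>+x. ennreal (lam ^ k) * (\<Prod>i<k. indicator (Q i) (x i)) * indicator (Pi\<^sub>E {..<k} A) x \<partial>plane_tuples k)"
      unfolding \<nu>_def using S by (intro emeasure_density prodQ) 
    also have "\<dots> = (\<integral>\<^sup>+x. (\<Prod>i<k. ennreal lam * indicator (A i \<inter> Q i) (x i)) \<partial>plane_tuples k)"
    proof (rule nn_integral_cong)
      fix x assume "x \<in> space (plane_tuples k)"
      then have "indicator (Pi\<^sub>E {..<k} A) x = (\<Prod>i<k. indicator (A i) (x i) :: ennreal)"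
        by (auto simp: indicator_def PiE_iff prod_zero_iff space_PiM)
      then show "ennreal (lam ^ k) * (\<Prod>i<k. indicator (Q i) (x i)) * indicator (Pi\<^sub>E {..<k} A) x =
          (\<Prod>i<k. ennreal lam * indicator (A i \<inter> Q i) (x i))"
        using lam by (simp add: prod.distrib indicator_inter_arith mult_ac ennreal_power)
    qed
    also have "\<dots> = (\<Prod>i<k. \<integral>\<^sup>+x. ennreal lam * indicator (A i \<inter> Q i) x \<partial>lborel)"
      using A Q by (intro PL.product_nn_integral_prod) auto
    also have "\<dots> = (\<Prod>i<k. emeasure (D' i) (A i))"
    proof (rule prod.cong)
      fix i assume "i \<in> {..<k}"
      then have i: "i < k" by simp
      note [measurable] = Q(1)[OF i] A[OF i]
      show "(\<integral>\<^sup>+x. ennreal lam * indicator (A i \<inter> Q i) x \<partial>lborel) = emeasure (D' i) (A i)"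
        using i unfolding D'_def D_def
        by (simp, subst emeasure_density) (auto simp: indicator_inter_arith mult_ac intro!: nn_integral_cong)
    qed simp
    finally show "emeasure \<nu> (Pi\<^sub>E {..<k} A) = (\<Prod>i\<in>{..<k}. emeasure (D' i) (A i))" .
  qed simp
  have eq: "(\<integral>\<^sup>+x. f x \<partial>\<mu>) = (\<integral>\<^sup>+x. f x \<partial>\<nu>)" by (simp only: \<mu> \<nu>)
  have fp[measurable]: "(\<lambda>x. f (pick k (fst x) (snd x))) \<in> borel_measurable (M \<Otimes>\<^sub>M tuples k)"
    by (rule measurable_compose[OF pick_measurable f])
  have "(\<integral>\<^sup>+x. f x \<partial>\<mu>) = (\<integral>\<^sup>+x. w x * f (pick k (fst x) (snd x)) \<partial>(M \<Otimes>\<^sub>M tuples k))"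
    unfolding \<mu>_def using f by (subst nn_integral_distr) (auto intro!: nn_integral_density)
  also have "\<dots> = (\<integral>\<^sup>+\<omega>. (\<integral>\<^sup>+\<sigma>. w (\<omega>, \<sigma>) * f (pick k \<omega> \<sigma>) \<partial>tuples k) \<partial>M)"
    by (subst tup.nn_integral_fst[symmetric]) auto
  also have "\<dots> = (\<integral>\<^sup>+\<omega>. e * (\<integral>\<^sup>+\<sigma>. void W \<omega> * (\<Prod>i<k. indicator (Q i) (X (\<sigma> i) \<omega>)) * f (pick k \<omega> \<sigma>) \<partial>tuples k) \<partial>M)"
  proof (rule nn_integral_cong)
    fix \<omega> assume \<omega>: "\<omega> \<in> space M"
    have "(\<integral>\<^sup>+\<sigma>. w (\<omega>, \<sigma>) * f (pick k \<omega> \<sigma>) \<partial>tuples k) =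
        (\<integral>\<^sup>+\<sigma>. e * (void W \<omega> * (\<Prod>i<k. indicator (Q i) (X (\<sigma> i) \<omega>)) * f (pick k \<omega> \<sigma>)) \<partial>tuples k)"
      by (simp add: w_def mult.assoc)
    also have "\<dots> = e * (\<integral>\<^sup>+\<sigma>. void W \<omega> * (\<Prod>i<k. indicator (Q i) (X (\<sigma> i) \<omega>)) * f (pick k \<omega> \<sigma>) \<partial>tuples k)"
    proof (rule nn_integral_cmult)
      have 1: "(\<lambda>\<sigma>. f (pick k \<omega> \<sigma>)) \<in> borel_measurable (tuples k)"
        using measurable_compose[OF measurable_Pair1'[OF \<omega>] fp] by simp
      have 2: "(\<lambda>\<sigma>. (\<Prod>i<k. indicator (Q i) (X (\<sigma> i) \<omega>) :: ennreal)) \<in> borel_measurable (tuples k)"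
        unfolding tuples_def
        by (intro borel_measurable_prod_ennreal measurable_compose[OF measurable_component_singleton]) auto
      show "(\<lambda>\<sigma>. void W \<omega> * (\<Prod>i<k. indicator (Q i) (X (\<sigma> i) \<omega>)) * f (pick k \<omega> \<sigma>)) \<in> borel_measurable (tuples k)"
        by (intro borel_measurable_times_ennreal 1 2) auto
    qed
    finally show "(\<integral>\<^sup>+\<sigma>. w (\<omega>, \<sigma>) * f (pick k \<omega> \<sigma>) \<partial>tuples k) =
      e * (\<integral>\<^sup>+\<sigma>. void W \<omega> * (\<Prod>i<k. indicator (Q i) (X (\<sigma> i) \<omega>)) * f (pick k \<omega> \<sigma>) \<partial>tuples k)" .
  qed
  also have "\<dots> = e * (\<integral>\<^sup>+\<omega>. (\<integral>\<^sup>+\<sigma>. void W \<omega> * (\<Prod>i<k. indicator (Q i) (X (\<sigma> i) \<omega>)) * f (pick k \<omega> \<sigma>) \<partial>tuples k) \<partial>M)"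
  proof (rule nn_integral_cmult)
    from tup.borel_measurable_nn_integral_fst[OF box_integrand_measurable[OF W Q(1) f]]
    show "(\<lambda>\<omega>. \<integral>\<^sup>+\<sigma>. void W \<omega> * (\<Prod>i<k. indicator (Q i) (X (\<sigma> i) \<omega>)) * f (pick k \<omega> \<sigma>) \<partial>tuples k) \<in> borel_measurable M"
      by simp
  qed
  finally have 1: "(\<integral>\<^sup>+x. f x \<partial>\<mu>) = e * (\<integral>\<^sup>+\<omega>. (\<integral>\<^sup>+\<sigma>. void W \<omega> * (\<Prod>i<k. indicator (Q i) (X (\<sigma> i) \<omega>)) * f (pick k \<omega> \<sigma>) \<partial>tuples k) \<partial>M)" .
  have 2: "(\<integral>\<^sup>+x. f x \<partial>\<nu>) = (\<integral>\<^sup>+x. ennreal (lam ^ k) * (\<Prod>i<k. indicator (Q i) (x i)) * f x \<partial>plane_tuples k)"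
    unfolding \<nu>_def by (rule nn_integral_density[OF prodQ f])
  have "ennreal (exp (- (lam * measure lborel W))) * e = 1"
    by (simp add: e_def ennreal_mult[symmetric] exp_minus)
  then show ?thesis
    using arg_cong[OF eq[unfolded 1 2], of "(*) (ennreal (exp (- (lam * measure lborel W))))"]
    by (simp add: mult.assoc[symmetric])
qed

end

text \<open>The level sets partition the plane into Borel pieces whose points are pairwise closer
  than \<open>2 * (1/2) ^ n\<close>. They are boxes for the moment computation and unrelated to
  Voronoi cells.\<close>

definition cell_index :: "nat \<Rightarrow> real^2 \<Rightarrow> nat" where
  "cell_index n x = (LEAST m. dist (dense_seq m) x < (1/2) ^ n)"

lemma cell_index_dist: "dist (dense_seq (cell_index n x)) x < (1/2) ^ n"
  unfolding cell_index_def using dense_seq[of "(1/2)^n" x] by (auto intro: LeastI)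

lemma cell_index_measurable: "cell_index n \<in> borel \<rightarrow>\<^sub>M count_space UNIV"
  unfolding cell_index_def[abs_def] by measurable

lemma cell_index_close: "cell_index n x = cell_index n y \<Longrightarrow> dist x y < 2 * (1/2) ^ n"
  using cell_index_dist[of n x] cell_index_dist[of n y] dist_triangle3[of x y "dense_seq (cell_index n x)"]
  by simp

lemma bounded_cell: "bounded {x. cell_index n x = c}"
  by (rule bounded_subset[OF bounded_ball[of "dense_seq c" "(1/2)^n"]]) (auto intro: cell_index_dist)

lemma cell_borel: "{x. cell_index n x = c} \<in> sets borel"
  using measurable_sets[OF cell_index_measurable[of n], of "{c}"] by (simp add: vimage_def)

definition inj_index :: "nat \<Rightarrow> (nat \<Rightarrow> nat) set" where
  "inj_index k = {c \<in> {..<k} \<rightarrow>\<^sub>E UNIV. inj_on c {..<k}}"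

lemma countable_inj_index: "countable (inj_index k)"
  by (rule countable_subset[of _ "{..<k} \<rightarrow>\<^sub>E UNIV"]) (auto simp: inj_index_def intro!: countable_PiE)

text \<open>Only the assignment recording the piece of each \<open>v i\<close> contributes, and it
  is injective exactly if the pieces are distinct.\<close>

lemma sum_over_cells:
  "(\<integral>\<^sup>+c. (\<Prod>i<k. indicator {x. cell_index n x = c i} (v i)) * a \<partial>count_space (inj_index k)) =
   (if inj_on (\<lambda>i. cell_index n (v i)) {..<k} then a else 0)"
proof -
  define c0 where "c0 = (\<lambda>i\<in>{..<k}. cell_index n (v i))"
  have "(\<integral>\<^sup>+c. (\<Prod>i<k. indicator {x. cell_index n x = c i} (v i)) * a \<partial>count_space (inj_index k)) =
     (\<integral>\<^sup>+c. a * indicator ({c0} \<inter> inj_index k) c \<partial>count_space (inj_index k))"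
  proof (rule nn_integral_cong)
    fix c assume "c \<in> space (count_space (inj_index k))"
    then have c: "c \<in> inj_index k" by simp
    then have "c = c0 \<longleftrightarrow> (\<forall>i<k. cell_index n (v i) = c i)"
      by (auto simp: c0_def inj_index_def fun_eq_iff PiE_def extensional_def restrict_def)
    then show "(\<Prod>i<k. indicator {x. cell_index n x = c i} (v i)) * a = a * indicator ({c0} \<inter> inj_index k) c"
      using c by (auto simp: indicator_def prod_zero_iff)
  qed
  also have "\<dots> = a * emeasure (count_space (inj_index k)) ({c0} \<inter> inj_index k)"
    by (rule nn_integral_cmult_indicator) auto
  also have "c0 \<in> inj_index k \<longleftrightarrow> inj_on (\<lambda>i. cell_index n (v i)) {..<k}"
    by (auto simp: c0_def inj_index_def inj_on_def)
  then have "a * emeasure (count_space (inj_index k)) ({c0} \<inter> inj_index k) =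
     (if inj_on (\<lambda>i. cell_index n (v i)) {..<k} then a else 0)"
    by (cases "c0 \<in> inj_index k") (auto simp: Int_insert_left)
  finally show ?thesis .
qed

section \<open>Factorial moments of tuples of distinct nuclei\<close>

context enumerated_poisson
begin

text \<open>Summation over injective assignments of pieces reduces to disjoint boxes. An inequality
  results because the right-hand side also contains the tuples with two entries in one piece and
  those touching \<open>W\<close>.\<close>

lemma level_factorial_moment:
  assumes W: "W \<in> sets borel" "bounded W" and f: "f \<in> borel_measurable (plane_tuples k)"
  shows "(\<integral>\<^sup>+x. void W (fst x) * (if inj_on (\<lambda>i. cell_index n (X (snd x i) (fst x))) {..<k} then f (pick k (fst x) (snd x)) else 0) \<partial>(M \<Otimes>\<^sub>M tuples k))
    \<le> ennreal (exp (- (lam * measure lborel W))) * (ennreal (lam ^ k) * (\<integral>\<^sup>+x. f x \<partial>plane_tuples k))"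
proof -
  interpret tup: sigma_finite_measure "tuples k" by (rule sigma_finite_tuples)
  define J where "J = inj_index k"
  \<comment> \<open>Removing \<open>W\<close> makes the boxes disjoint from it and loses nothing on
    the event that \<open>W\<close> contains no nucleus.\<close>
  define Q where "Q c i = {x. cell_index n x = c i} - W" for c :: "nat \<Rightarrow> nat" and i
  define g where "g c x = void W (fst x) * (\<Prod>i<k. indicator (Q c i) (X (snd x i) (fst x))) * f (pick k (fst x) (snd x))" for c x
  have Q: "Q c i \<in> sets borel" "bounded (Q c i)" "Q c i \<inter> W = {}" for c i
    unfolding Q_def using W cell_borel bounded_cell by (auto intro: bounded_subset)
  have gm: "g c \<in> borel_measurable (M \<Otimes>\<^sub>M tuples k)" for c
    unfolding g_def by (rule box_integrand_measurable[OF W Q(1) f])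
  have "AE \<omega> in M. \<forall>n. X n \<omega> \<in> P \<omega>"
    using X_enumerates by eventually_elim auto
  then have "AE x in M \<Otimes>\<^sub>M tuples k. \<forall>n. X n (fst x) \<in> P (fst x)"
  proof -
    assume "AE \<omega> in M. \<forall>n. X n \<omega> \<in> P \<omega>"
    then obtain N where N: "{\<omega> \<in> space M. \<not> (\<forall>n. X n \<omega> \<in> P \<omega>)} \<subseteq> N" "N \<in> null_sets M" by (auto elim: AE_E simp: null_sets_def)
    have "N \<times> space (tuples k) \<in> null_sets (M \<Otimes>\<^sub>M tuples k)"
      using N(2) tup.emeasure_pair_measure_Times[of N M "space (tuples k)"] by (auto simp: null_sets_def)
    then show ?thesis
      by (rule AE_I') (use N(1) in \<open>fastforce simp: space_pair_measure\<close>)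
  qed
  then have "(\<integral>\<^sup>+x. void W (fst x) * (if inj_on (\<lambda>i. cell_index n (X (snd x i) (fst x))) {..<k} then f (pick k (fst x) (snd x)) else 0) \<partial>(M \<Otimes>\<^sub>M tuples k)) =
     (\<integral>\<^sup>+x. (\<integral>\<^sup>+c. g c x \<partial>count_space J) \<partial>(M \<Otimes>\<^sub>M tuples k))"
  proof (intro nn_integral_cong_AE, eventually_elim)
    fix x :: "'a \<times> (nat \<Rightarrow> nat)" assume x: "\<forall>n. X n (fst x) \<in> P (fst x)"
    show "void W (fst x) * (if inj_on (\<lambda>i. cell_index n (X (snd x i) (fst x))) {..<k} then f (pick k (fst x) (snd x)) else 0) =
      (\<integral>\<^sup>+c. g c x \<partial>count_space J)"
    proof (cases "P (fst x) \<inter> W = {}")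
      case False
      then show ?thesis by (simp add: void_def g_def)
    next
      case True
      then have "X m (fst x) \<notin> W" for m using x by auto
      then have "g c x = (\<Prod>i<k. indicator {y. cell_index n y = c i} (X (snd x i) (fst x))) * f (pick k (fst x) (snd x))" for c
        using True by (simp add: g_def void_def Q_def indicator_def)
      then show ?thesis using True unfolding J_def by (simp add: sum_over_cells void_def)
    qed
  qed
  also have "\<dots> = (\<integral>\<^sup>+c. (\<integral>\<^sup>+x. g c x \<partial>(M \<Otimes>\<^sub>M tuples k)) \<partial>count_space J)"
    unfolding J_def by (rule nn_integral_count_space_nn_integral[OF countable_inj_index gm])
  also have "\<dots> = (\<integral>\<^sup>+c. ennreal (exp (- (lam * measure lborel W))) *
      (\<integral>\<^sup>+x. ennreal (lam ^ k) * (\<Prod>i<k. indicator (Q c i) (x i)) * f x \<partial>plane_tuples k) \<partial>count_space J)"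
  proof (rule nn_integral_cong)
    fix c assume "c \<in> space (count_space J)"
    then have c: "inj_on c {..<k}" by (simp add: J_def inj_index_def)
    have "(\<integral>\<^sup>+x. g c x \<partial>(M \<Otimes>\<^sub>M tuples k)) = (\<integral>\<^sup>+\<omega>. (\<integral>\<^sup>+\<sigma>. g c (\<omega>, \<sigma>) \<partial>tuples k) \<partial>M)"
      by (subst tup.nn_integral_fst[symmetric, OF gm]) simp
    also have "\<dots> = ennreal (exp (- (lam * measure lborel W))) *
      (\<integral>\<^sup>+x. ennreal (lam ^ k) * (\<Prod>i<k. indicator (Q c i) (x i)) * f x \<partial>plane_tuples k)"
      unfolding g_def fst_conv snd_conv
    proof (rule box_factorial_moment[OF W Q(1) Q(2) Q(3) _ f])
      show "Q c i \<inter> Q c j = {}" if "i < k" "j < k" "i \<noteq> j" for i j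
        using c that by (auto simp: Q_def inj_on_def)
    qed
    finally show "(\<integral>\<^sup>+x. g c x \<partial>(M \<Otimes>\<^sub>M tuples k)) = ennreal (exp (- (lam * measure lborel W))) *
      (\<integral>\<^sup>+x. ennreal (lam ^ k) * (\<Prod>i<k. indicator (Q c i) (x i)) * f x \<partial>plane_tuples k)" .
  qed
  also have "\<dots> = ennreal (exp (- (lam * measure lborel W))) *
     (\<integral>\<^sup>+c. (\<integral>\<^sup>+x. ennreal (lam ^ k) * (\<Prod>i<k. indicator (Q c i) (x i)) * f x \<partial>plane_tuples k) \<partial>count_space J)"
    by (rule nn_integral_cmult) simp
  also have "(\<integral>\<^sup>+c. (\<integral>\<^sup>+x. ennreal (lam ^ k) * (\<Prod>i<k. indicator (Q c i) (x i)) * f x \<partial>plane_tuples k) \<partial>count_space J) =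
     (\<integral>\<^sup>+x. (\<integral>\<^sup>+c. ennreal (lam ^ k) * (\<Prod>i<k. indicator (Q c i) (x i)) * f x \<partial>count_space J) \<partial>plane_tuples k)"
    unfolding J_def
  proof (rule nn_integral_count_space_nn_integral[OF countable_inj_index, symmetric])
    fix c
    have "(\<lambda>x. indicator (Q c i) (x i) :: ennreal) \<in> borel_measurable (plane_tuples k)" if "i < k" for i
      using that Q(1) by (intro measurable_compose[OF measurable_component_singleton borel_measurable_indicator]) auto
    then show "(\<lambda>x. ennreal (lam ^ k) * (\<Prod>i<k. indicator (Q c i) (x i)) * f x) \<in> borel_measurable (plane_tuples k)"
      by (intro borel_measurable_times_ennreal borel_measurable_prod_ennreal f) auto
  qed
  also have "\<dots> \<le> (\<integral>\<^sup>+x. ennreal (lam ^ k) * f x \<partial>plane_tuples k)"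
  proof (rule nn_integral_mono)
    fix v :: "nat \<Rightarrow> real^2"
    have "(\<integral>\<^sup>+c. ennreal (lam ^ k) * (\<Prod>i<k. indicator (Q c i) (v i)) * f v \<partial>count_space J) \<le>
      (\<integral>\<^sup>+c. (\<Prod>i<k. indicator {x. cell_index n x = c i} (v i)) * (ennreal (lam ^ k) * f v) \<partial>count_space J)"
    proof (rule nn_integral_mono)
      fix c :: "nat \<Rightarrow> nat"
      have "(\<Prod>i<k. indicator (Q c i) (v i) :: ennreal) \<le> (\<Prod>i<k. indicator {x. cell_index n x = c i} (v i))"
      proof (cases "\<forall>i<k. v i \<in> Q c i")
        case True
        then have "\<forall>i<k. cell_index n (v i) = c i" by (simp add: Q_def)
        with True show ?thesis by (simp add: indicator_def)
      next
        case False
        then have "(\<Prod>i<k. indicator (Q c i) (v i) :: ennreal) = 0"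
          by (intro prod_zero) (auto simp: indicator_def)
        then show ?thesis by (rule ord_eq_le_trans) simp
      qed
      then have "ennreal (lam ^ k) * f v * (\<Prod>i<k. indicator (Q c i) (v i)) \<le>
          ennreal (lam ^ k) * f v * (\<Prod>i<k. indicator {x. cell_index n x = c i} (v i))"
        by (rule mult_left_mono) simp
      then show "ennreal (lam ^ k) * (\<Prod>i<k. indicator (Q c i) (v i)) * f v \<le>
         (\<Prod>i<k. indicator {x. cell_index n x = c i} (v i)) * (ennreal (lam ^ k) * f v)"
        by (simp add: mult_ac)
    qed
    also have "\<dots> \<le> ennreal (lam ^ k) * f v"
      unfolding J_def sum_over_cells by simp
    finally show "(\<integral>\<^sup>+c. ennreal (lam ^ k) * (\<Prod>i<k. indicator (Q c i) (v i)) * f v \<partial>count_space J) \<le> ennreal (lam ^ k) * f v" .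
  qed
  also have "\<dots> = ennreal (lam ^ k) * (\<integral>\<^sup>+x. f x \<partial>plane_tuples k)"
    by (rule nn_integral_cmult[OF f])
  finally show ?thesis by (simp add: mult_left_mono)
qed

text \<open>Distinct nuclei lie in different pieces once \<open>n\<close> is large, so the
  integrands of level \<open>n\<close> eventually dominate. Fatou's lemma is applied twice, to the
  sum over tuples and to the expectation.\<close>

lemma factorial_moment_bound:
  assumes W: "W \<in> sets borel" "bounded W" and f: "f \<in> borel_measurable (plane_tuples k)"
  shows "(\<integral>\<^sup>+\<omega>. (\<integral>\<^sup>+\<sigma>. void W \<omega> * (if inj_on \<sigma> {..<k} then f (pick k \<omega> \<sigma>) else 0) \<partial>tuples k) \<partial>M)
    \<le> ennreal (exp (- (lam * measure lborel W))) * (ennreal (lam ^ k) * (\<integral>\<^sup>+x. f x \<partial>plane_tuples k))"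
    (is "_ \<le> ?B")
proof -
  interpret tup: sigma_finite_measure "tuples k" by (rule sigma_finite_tuples)
  define u where "u n x = void W (fst x) * (if inj_on (\<lambda>i. cell_index n (X (snd x i) (fst x))) {..<k} then f (pick k (fst x) (snd x)) else 0)" for n x
  have um: "u n \<in> borel_measurable (M \<Otimes>\<^sub>M tuples k)" for n
  proof -
    have c: "(\<lambda>x. cell_index n (X (snd x i) (fst x))) \<in> M \<Otimes>\<^sub>M tuples k \<rightarrow>\<^sub>M count_space UNIV" if "i < k" for i
      by (rule measurable_compose[OF pick_component_measurable[OF that] cell_index_measurable])
    have "Measurable.pred (M \<Otimes>\<^sub>M tuples k) (\<lambda>x. cell_index n (X (snd x i) (fst x)) = cell_index n (X (snd x j) (fst x)))" if "i < k" "j < k" for i j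
      by (rule measurable_compose_countable[OF _ c[OF that(1)],
            where f = "\<lambda>m x. m = cell_index n (X (snd x j) (fst x))"])
        (rule measurable_compose[OF c[OF that(2)]], simp)
    then have "Measurable.pred (M \<Otimes>\<^sub>M tuples k) (\<lambda>x. \<forall>i\<in>{..<k}. \<forall>j\<in>{..<k}. cell_index n (X (snd x i) (fst x)) = cell_index n (X (snd x j) (fst x)) \<longrightarrow> i = j)"
      by (intro pred_intros_finite pred_intros_logic) auto
    then have m: "{x \<in> space (M \<Otimes>\<^sub>M tuples k). inj_on (\<lambda>i. cell_index n (X (snd x i) (fst x))) {..<k}} \<in> sets (M \<Otimes>\<^sub>M tuples k)"
      by (simp add: inj_on_def pred_def)
    show ?thesis unfolding u_def[abs_def]
      by (intro borel_measurable_times_ennreal measurable_compose[OF measurable_fst void_measurable[OF W]]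
          measurable_If[OF _ _ m] measurable_compose[OF pick_measurable f] measurable_const) simp
  qed
  have bound: "(\<integral>\<^sup>+\<omega>. (\<integral>\<^sup>+\<sigma>. u n (\<omega>, \<sigma>) \<partial>tuples k) \<partial>M) \<le> ?B" for n
    unfolding tup.nn_integral_fst[OF um] unfolding u_def[abs_def] by (rule level_factorial_moment[OF W f])
  have "(\<integral>\<^sup>+\<omega>. (\<integral>\<^sup>+\<sigma>. void W \<omega> * (if inj_on \<sigma> {..<k} then f (pick k \<omega> \<sigma>) else 0) \<partial>tuples k) \<partial>M)
     \<le> (\<integral>\<^sup>+\<omega>. liminf (\<lambda>n. \<integral>\<^sup>+\<sigma>. u n (\<omega>, \<sigma>) \<partial>tuples k) \<partial>M)"
  proof (rule nn_integral_mono_AE)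
    from X_enumerates AE_space
    show "AE \<omega> in M. (\<integral>\<^sup>+\<sigma>. void W \<omega> * (if inj_on \<sigma> {..<k} then f (pick k \<omega> \<sigma>) else 0) \<partial>tuples k) \<le>
        liminf (\<lambda>n. \<integral>\<^sup>+\<sigma>. u n (\<omega>, \<sigma>) \<partial>tuples k)"
    proof eventually_elim
      fix \<omega> assume inj: "inj (\<lambda>n. X n \<omega>) \<and> P \<omega> = range (\<lambda>n. X n \<omega>)" and \<omega>: "\<omega> \<in> space M"
      have "(\<integral>\<^sup>+\<sigma>. void W \<omega> * (if inj_on \<sigma> {..<k} then f (pick k \<omega> \<sigma>) else 0) \<partial>tuples k) \<le>
         (\<integral>\<^sup>+\<sigma>. liminf (\<lambda>n. u n (\<omega>, \<sigma>)) \<partial>tuples k)"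
      proof (rule nn_integral_mono)
        fix \<sigma> :: "nat \<Rightarrow> nat"
        show "void W \<omega> * (if inj_on \<sigma> {..<k} then f (pick k \<omega> \<sigma>) else 0) \<le> liminf (\<lambda>n. u n (\<omega>, \<sigma>))"
        proof (cases "inj_on \<sigma> {..<k}")
          case True
          have sep: "\<forall>\<^sub>F n in sequentially. cell_index n (X (\<sigma> i) \<omega>) \<noteq> cell_index n (X (\<sigma> j) \<omega>)"
            if "i < k" "j < k" "i \<noteq> j" for i j
          proof -
            have "\<sigma> i \<noteq> \<sigma> j" using True that by (auto simp: inj_on_def)
            then have "X (\<sigma> i) \<omega> \<noteq> X (\<sigma> j) \<omega>" using inj by (auto dest: injD)
            then have d: "dist (X (\<sigma> i) \<omega>) (X (\<sigma> j) \<omega>) > 0" by simp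
            have "(\<lambda>n. 2 * (1/2 :: real) ^ n) \<longlonglongrightarrow> 2 * 0"
              by (intro tendsto_mult tendsto_const LIMSEQ_realpow_zero) auto
            from order_tendstoD(2)[OF this, of "dist (X (\<sigma> i) \<omega>) (X (\<sigma> j) \<omega>)"] d
            have "\<forall>\<^sub>F n in sequentially. 2 * (1/2 :: real) ^ n < dist (X (\<sigma> i) \<omega>) (X (\<sigma> j) \<omega>)" by simp
            then show ?thesis by eventually_elim (use cell_index_close in fastforce)
          qed
          have "\<forall>\<^sub>F n in sequentially. \<forall>i\<in>{..<k}. \<forall>j\<in>{..<k}. i \<noteq> j \<longrightarrow> cell_index n (X (\<sigma> i) \<omega>) \<noteq> cell_index n (X (\<sigma> j) \<omega>)"
            using sep by (intro eventually_ball_finite ballI) (auto simp: eventually_mono)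
          then have "\<forall>\<^sub>F n in sequentially. void W \<omega> * f (pick k \<omega> \<sigma>) \<le> u n (\<omega>, \<sigma>)"
            by eventually_elim (auto simp: u_def inj_on_def)
          then show ?thesis using True by (auto intro!: Liminf_bounded)
        qed simp
      qed
      also have "\<dots> \<le> liminf (\<lambda>n. \<integral>\<^sup>+\<sigma>. u n (\<omega>, \<sigma>) \<partial>tuples k)"
        by (rule nn_integral_liminf) (rule measurable_compose[OF measurable_Pair1'[OF \<omega>] um])
      finally show "(\<integral>\<^sup>+\<sigma>. void W \<omega> * (if inj_on \<sigma> {..<k} then f (pick k \<omega> \<sigma>) else 0) \<partial>tuples k) \<le>
        liminf (\<lambda>n. \<integral>\<^sup>+\<sigma>. u n (\<omega>, \<sigma>) \<partial>tuples k)" .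
    qed
  qed
  also have "\<dots> \<le> liminf (\<lambda>n. \<integral>\<^sup>+\<omega>. (\<integral>\<^sup>+\<sigma>. u n (\<omega>, \<sigma>) \<partial>tuples k) \<partial>M)"
    by (rule nn_integral_liminf) (rule tup.borel_measurable_nn_integral_fst[OF um])
  also have "\<dots> \<le> ?B"
    by (rule order_trans[OF Liminf_le_Limsup Limsup_bounded]) (simp_all add: bound del: mult.assoc)
  finally show ?thesis .
qed

end

section \<open>Second moment of the inverse cell area\<close>

lemma chain_Suc: "1 \<le> k \<Longrightarrow> chain (Suc k) v = chain k v * chain_factor k v"
  unfolding chain_def by (simp add: prod.atLeastLessThan_Suc mult.commute)

lemma chain_cong: "(\<And>i. i < k \<Longrightarrow> v i = w i) \<Longrightarrow> 1 \<le> k \<Longrightarrow> chain k v = chain k w"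
  unfolding chain_def chain_factor_def by (intro prod.cong) auto

lemma chain_factor_measurable:
  assumes "1 \<le> i" "i < k"
  shows "chain_factor i \<in> borel_measurable (plane_tuples k)"
proof -
  have c: "(\<lambda>v. v j) \<in> plane_tuples k \<rightarrow>\<^sub>M borel" if "j < k" for j
    using measurable_component_singleton[of j "{..<k}" "\<lambda>_. lborel :: (real^2) measure"] that by simp
  have [measurable]: "(\<lambda>v. v 0) \<in> plane_tuples k \<rightarrow>\<^sub>M borel" "(\<lambda>v. v i) \<in> plane_tuples k \<rightarrow>\<^sub>M borel"
    "(\<lambda>v. v (i - 1)) \<in> plane_tuples k \<rightarrow>\<^sub>M borel"
    using assms by (auto intro!: c)
  define R where "R v = (if i = 1 then 1 else dist (v 0) (v (i - 1)))" for v :: "nat \<Rightarrow> real^2"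
  have [measurable]: "R \<in> borel_measurable (plane_tuples k)"
  proof (cases "i = 1")
    case False
    have "(\<lambda>v. dist (v 0) (v (i - 1))) \<in> borel_measurable (plane_tuples k)"
      using assms by (intro borel_measurable_dist c) auto
    then show ?thesis using False by (simp add: R_def[abs_def])
  qed (simp add: R_def[abs_def])
  have "chain_factor i = (\<lambda>v. (if dist (v 0) (v i) \<le> R v then 1 else 0) * inverse (ennreal ((R v)\<^sup>2)))"
    by (auto simp: chain_factor_def R_def fun_eq_iff indicator_def Let_def)
  then show ?thesis by simp
qed

lemma chain_measurable: "k \<le> l \<Longrightarrow> chain k \<in> borel_measurable (plane_tuples l)"
  unfolding chain_def[abs_def] by (intro borel_measurable_prod_ennreal chain_factor_measurable) auto

text \<open>The area of the disk cancels the inverse square of its radius; in the degenerate case of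
  radius 0 an infinite factor meets a null set.\<close>

lemma chain_factor_integral:
  assumes "1 \<le> i"
  shows "(\<integral>\<^sup>+y. chain_factor i (v(i := y)) \<partial>lborel) \<le> ennreal pi"
proof -
  define R where "R = (if i = 1 then 1 else dist (v 0) (v (i - 1)))"
  have R: "R \<ge> 0" by (simp add: R_def)
  have "(\<integral>\<^sup>+y. chain_factor i (v(i := y)) \<partial>lborel) = (\<integral>\<^sup>+y. inverse (ennreal (R\<^sup>2)) * indicator (cball (v 0) R) y \<partial>lborel)"
    using assms by (intro nn_integral_cong) (auto simp: chain_factor_def R_def cball_def indicator_def)
  also have "\<dots> = inverse (ennreal (R\<^sup>2)) * ennreal (pi * R\<^sup>2)"
    using R by (simp add: nn_integral_cmult_indicator emeasure_cball_R2)
  also have "\<dots> \<le> ennreal pi"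
    using R by (cases "R = 0") (auto simp: inverse_ennreal ennreal_mult[symmetric])
  finally show ?thesis .
qed

text \<open>The coordinate of highest index is the nearest neighbour and occurs in the last factor
  only, so integrating it out first costs at most \<open>pi\<close> and leaves the shorter
  chain.\<close>

lemma chain_integral:
  fixes A :: "(real^2) set"
  assumes [measurable]: "A \<in> sets borel"
  shows "(\<integral>\<^sup>+v. indicator A (v 0) * chain (Suc k) v \<partial>plane_tuples (Suc k)) \<le> emeasure lborel A * ennreal pi ^ k"
proof (induction k)
  interpret PL: product_sigma_finite "\<lambda>_::nat. lborel :: (real^2) measure" by (rule product_sigma_finite_lborel)
  case 0
  have "{..<Suc 0} = {0}" by auto
  moreover have "(\<integral>\<^sup>+v. indicator A (v 0) \<partial>Pi\<^sub>M {0::nat} (\<lambda>_. lborel)) = (\<integral>\<^sup>+x. indicator A x \<partial>lborel)"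
    using PL.product_nn_integral_singleton[of "indicator A" 0] by simp
  ultimately show ?case by (simp add: chain_def)
next
  case (Suc k)
  interpret PL: product_sigma_finite "\<lambda>_::nat. lborel :: (real^2) measure" by (rule product_sigma_finite_lborel)
  have ins: "{..<Suc (Suc k)} = insert (Suc k) {..<Suc k}" by auto
  have ind: "(\<lambda>v. indicator A (v 0) :: ennreal) \<in> borel_measurable (plane_tuples (Suc l))" for l
    by (intro measurable_compose[OF measurable_component_singleton borel_measurable_indicator]) auto
  have m: "(\<lambda>v. indicator A (v 0) * chain (Suc (Suc k)) v) \<in> borel_measurable (plane_tuples (Suc (Suc k)))"
    by (intro borel_measurable_times_ennreal ind chain_measurable) simp
  have "(\<integral>\<^sup>+v. indicator A (v 0) * chain (Suc (Suc k)) v \<partial>plane_tuples (Suc (Suc k))) =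
     (\<integral>\<^sup>+v. (\<integral>\<^sup>+y. indicator A ((v(Suc k := y)) 0) * chain (Suc (Suc k)) (v(Suc k := y)) \<partial>lborel) \<partial>plane_tuples (Suc k))"
    using m unfolding ins by (intro PL.product_nn_integral_insert) auto
  also have "\<dots> \<le> (\<integral>\<^sup>+v. indicator A (v 0) * chain (Suc k) v * ennreal pi \<partial>plane_tuples (Suc k))"
  proof (rule nn_integral_mono)
    fix v :: "nat \<Rightarrow> real^2" assume v: "v \<in> space (plane_tuples (Suc k))"
    have cm: "(\<lambda>y. chain_factor (Suc k) (v(Suc k := y))) \<in> borel_measurable lborel"
    proof (rule measurable_compose[OF _ chain_factor_measurable[of "Suc k" "Suc (Suc k)"]])
      show "(\<lambda>y. v(Suc k := y)) \<in> lborel \<rightarrow>\<^sub>M plane_tuples (Suc (Suc k))"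
        unfolding ins by (rule measurable_component_update[OF v]) simp
    qed auto
    have "(\<integral>\<^sup>+y. indicator A ((v(Suc k := y)) 0) * chain (Suc (Suc k)) (v(Suc k := y)) \<partial>lborel) =
       (\<integral>\<^sup>+y. indicator A (v 0) * chain (Suc k) v * chain_factor (Suc k) (v(Suc k := y)) \<partial>lborel)"
    proof (rule nn_integral_cong)
      fix y :: "real^2"
      have "chain (Suc k) (v(Suc k := y)) = chain (Suc k) v" by (rule chain_cong) auto
      then show "indicator A ((v(Suc k := y)) 0) * chain (Suc (Suc k)) (v(Suc k := y)) =
          indicator A (v 0) * chain (Suc k) v * chain_factor (Suc k) (v(Suc k := y))"
        by (simp add: chain_Suc[of "Suc k"] mult.assoc)
    qed
    also have "\<dots> = indicator A (v 0) * chain (Suc k) v * (\<integral>\<^sup>+y. chain_factor (Suc k) (v(Suc k := y)) \<partial>lborel)"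
      by (rule nn_integral_cmult[OF cm])
    also have "\<dots> \<le> indicator A (v 0) * chain (Suc k) v * ennreal pi"
      by (intro mult_left_mono chain_factor_integral) auto
    finally show "(\<integral>\<^sup>+y. indicator A ((v(Suc k := y)) 0) * chain (Suc (Suc k)) (v(Suc k := y)) \<partial>lborel)
      \<le> indicator A (v 0) * chain (Suc k) v * ennreal pi" .
  qed
  also have "\<dots> = (\<integral>\<^sup>+v. indicator A (v 0) * chain (Suc k) v \<partial>plane_tuples (Suc k)) * ennreal pi"
    by (intro nn_integral_multc borel_measurable_times_ennreal ind chain_measurable) simp
  also have "\<dots> \<le> emeasure lborel A * ennreal pi ^ k * ennreal pi"
    by (intro mult_right_mono Suc.IH) simp
  finally show ?case by (simp add: mult_ac)
qed

text \<open>If a cell with nucleus in \<open>shell j\<close> meets the unit disk, then \<open>core j\<close> contains no nucleus.  For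
  \<open>j < 2\<close> the radius is not positive and \<open>core j\<close> is empty.\<close>

definition shell :: "nat \<Rightarrow> (real^2) set" where
  "shell j = {x. real j \<le> norm x \<and> norm x < real j + 1}"

definition core :: "nat \<Rightarrow> (real^2) set" where
  "core j = ball 0 (real j - 2)"

lemma shell_borel [measurable]: "shell j \<in> sets borel"
  unfolding shell_def by measurable

lemma core_borel: "core j \<in> sets borel" "bounded (core j)"
  by (auto simp: core_def)

lemma in_shell: "x \<in> shell (nat \<lfloor>norm x\<rfloor>)"
  unfolding shell_def by (auto simp: of_nat_nat) 

lemma emeasure_shell: "emeasure lborel (shell j) \<le> ennreal (pi * (real j + 1)\<^sup>2)"
proof -
  have "emeasure lborel (shell j) \<le> emeasure lborel (cball (0::real^2) (real j + 1))"
    by (intro emeasure_mono) (auto simp: shell_def)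
  then show ?thesis by (simp add: emeasure_cball_R2)
qed

text \<open>The void probabilities decay like a Gaussian in the radius, which beats the quadratic
  growth of the shell areas.\<close>

lemma summable_shells:
  assumes "lam > 0"
  shows "summable (\<lambda>j. exp (- (lam * measure lborel (core j))) * (pi * (real j + 1)\<^sup>2))"
proof -
  define c where "c = lam * pi"
  have c: "c > 0" using assms by (simp add: c_def)
  have "summable (\<lambda>m. inverse (real (Suc m) ^ 2))"
    using inverse_power_summable[of 2, where 'a = real] by (subst summable_Suc_iff[of "\<lambda>n. inverse (real n ^ 2)"]) simp
  then have "summable (\<lambda>m. 8 * pi / c\<^sup>2 * inverse (real (Suc m) ^ 2))"
    by (rule summable_mult)
  \<comment> \<open>From index 5 on, the core has radius \<open>x = m + 3\<close>, which is at least
    3, so the outer radius \<open>x + 3\<close> of the shell is at most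
    \<open>2 * x\<close>.\<close>
  then have "summable (\<lambda>m. exp (- (lam * measure lborel (core (m + 5)))) * (pi * (real (m + 5) + 1)\<^sup>2))"
  proof (rule summable_comparison_test[rotated], intro exI[of _ 0] allI impI)
    fix m :: nat
    define x where "x = real m + 3"
    have x: "x \<ge> 3" by (simp add: x_def)
    have e: "measure lborel (core (m + 5)) = pi * x\<^sup>2"
      by (simp add: core_def content_ball unit_ball_vol_2 x_def)
    \<comment> \<open>The quadratic Taylor term already gives decay of order
      \<open>inverse (x ^ 4)\<close>, which leaves a summable inverse square after the area
      factor.\<close>
    have "(c * x\<^sup>2)\<^sup>2 / 2 \<le> exp (c * x\<^sup>2)"
    proof -
      have "0 \<le> c * x\<^sup>2" using c by simp
      from exp_lower_Taylor_quadratic[OF this] this show ?thesis by linarith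
    qed
    moreover have "0 < (c * x\<^sup>2)\<^sup>2 / 2" using c x by simp
    ultimately have "inverse (exp (c * x\<^sup>2)) \<le> inverse ((c * x\<^sup>2)\<^sup>2 / 2)"
      by (intro le_imp_inverse_le)
    then have "exp (- (c * x\<^sup>2)) * (pi * (x + 3)\<^sup>2) \<le> inverse ((c * x\<^sup>2)\<^sup>2 / 2) * (pi * (2 * x)\<^sup>2)"
      using x by (intro mult_mono power_mono) (auto simp: exp_minus)
    also have "\<dots> = 8 * pi / c\<^sup>2 * inverse (x ^ 2)"
      using x c by (simp add: power_mult_distrib field_simps power2_eq_square)
    also have "\<dots> \<le> 8 * pi / c\<^sup>2 * inverse (real (Suc m) ^ 2)"
      using x by (intro mult_left_mono le_imp_inverse_le power_mono) (auto simp: x_def)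
    finally show "norm (exp (- (lam * measure lborel (core (m + 5)))) * (pi * (real (m + 5) + 1)\<^sup>2)) \<le>
        8 * pi / c\<^sup>2 * inverse (real (Suc m) ^ 2)"
      by (simp add: e x_def c_def mult.assoc)
  qed
  then show ?thesis by (subst (asm) summable_iff_shift)
qed

section \<open>Chains over all tuples of nuclei\<close>

context enumerated_poisson
begin

text \<open>The shells are disjoint, so at most one \<open>j\<close> contributes for each tuple; for
  it the void factor records the empty disk that keeps distant nuclei under control.\<close>

definition shell_chain :: "nat \<Rightarrow> nat \<Rightarrow> 'a \<Rightarrow> (nat \<Rightarrow> nat) \<Rightarrow> ennreal" where
  "shell_chain k j \<omega> \<sigma> = void (core j) \<omega> *
     (if inj_on \<sigma> {..<k} then indicator (shell j) (pick k \<omega> \<sigma> 0) * chain k (pick k \<omega> \<sigma>) else 0)"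

definition chain_sum :: "nat \<Rightarrow> 'a \<Rightarrow> ennreal" where
  "chain_sum k \<omega> = (\<integral>\<^sup>+\<sigma>. (\<Sum>j. shell_chain k j \<omega> \<sigma>) \<partial>tuples k)"

lemma shell_chain_measurable:
  assumes "k > 0"
  shows "(\<lambda>x. shell_chain k j (fst x) (snd x)) \<in> borel_measurable (M \<Otimes>\<^sub>M tuples k)"
proof -
  have c: "(\<lambda>\<sigma>. \<sigma> i) \<in> tuples k \<rightarrow>\<^sub>M count_space UNIV" if "i < k" for i
    unfolding tuples_def using that by (intro measurable_component_singleton) simp
  have "Measurable.pred (tuples k) (\<lambda>\<sigma>. \<sigma> i = \<sigma> j)" if "i < k" "j < k" for i j
    by (rule measurable_compose_countable[OF _ c[OF that(1)], where f = "\<lambda>m \<sigma>. m = \<sigma> j"])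
      (rule measurable_compose[OF c[OF that(2)]], simp)
  then have "Measurable.pred (tuples k) (\<lambda>\<sigma>. \<forall>i\<in>{..<k}. \<forall>j\<in>{..<k}. \<sigma> i = \<sigma> j \<longrightarrow> i = j)"
    by (intro pred_intros_finite pred_intros_logic) auto
  from measurable_compose[OF measurable_snd this, of M]
  have m: "{x \<in> space (M \<Otimes>\<^sub>M tuples k). inj_on (snd x) {..<k}} \<in> sets (M \<Otimes>\<^sub>M tuples k)"
    by (simp add: inj_on_def pred_def)
  have "(\<lambda>v. indicator (shell j) (v 0) * chain k v) \<in> borel_measurable (plane_tuples k)"
    using assms by (intro borel_measurable_times_ennreal chain_measurable order_refl
       measurable_compose[OF measurable_component_singleton borel_measurable_indicator]) auto
  note v = measurable_compose[OF pick_measurable this]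
  show ?thesis unfolding shell_chain_def
    by (rule borel_measurable_times_ennreal[OF measurable_compose[OF measurable_fst void_measurable[OF core_borel]]
          measurable_If[OF v _ m]]) simp
qed

lemma chain_sum_measurable:
  assumes "k > 0"
  shows "chain_sum k \<in> borel_measurable M"
proof -
  interpret tup: sigma_finite_measure "tuples k" by (rule sigma_finite_tuples)
  have "(\<lambda>x. \<Sum>j. shell_chain k j (fst x) (snd x)) \<in> borel_measurable (M \<Otimes>\<^sub>M tuples k)"
    by (intro borel_measurable_suminf_order shell_chain_measurable assms)
  from tup.borel_measurable_nn_integral_fst[OF this]
  show ?thesis by (simp add: chain_sum_def[abs_def])
qed

text \<open>On each shell the moment bound yields the void probability of the core times the area of
  the shell, up to powers of \<open>lam\<close> and \<open>pi\<close>;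
  \<open>summable_shells\<close> adds these up.\<close>

lemma expected_chain_sum:
  assumes "k > 0"
  shows "(\<integral>\<^sup>+\<omega>. chain_sum k \<omega> \<partial>M) < \<infinity>"
proof -
  interpret tup: sigma_finite_measure "tuples k" by (rule sigma_finite_tuples)
  obtain l where k: "k = Suc l" using assms by (cases k) auto
  define s where "s j = exp (- (lam * measure lborel (core j))) * (pi * (real j + 1)\<^sup>2)" for j
  define c where "c = ennreal (lam ^ k) * ennreal pi ^ l"
  note sm = shell_chain_measurable[OF assms]
  have "(\<integral>\<^sup>+\<omega>. chain_sum k \<omega> \<partial>M) = (\<integral>\<^sup>+\<omega>. (\<Sum>j. \<integral>\<^sup>+\<sigma>. shell_chain k j \<omega> \<sigma> \<partial>tuples k) \<partial>M)"
    unfolding chain_sum_def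
  proof (intro nn_integral_cong nn_integral_suminf)
    fix \<omega> j assume "\<omega> \<in> space M"
    from measurable_compose[OF measurable_Pair1'[OF this] sm, of j]
    show "shell_chain k j \<omega> \<in> borel_measurable (tuples k)" by simp
  qed
  also have "\<dots> = (\<Sum>j. \<integral>\<^sup>+\<omega>. (\<integral>\<^sup>+\<sigma>. shell_chain k j \<omega> \<sigma> \<partial>tuples k) \<partial>M)"
  proof (rule nn_integral_suminf)
    fix j
    from tup.borel_measurable_nn_integral_fst[OF sm[of j]]
    show "(\<lambda>\<omega>. \<integral>\<^sup>+\<sigma>. shell_chain k j \<omega> \<sigma> \<partial>tuples k) \<in> borel_measurable M" by simp
  qed
  also have "\<dots> \<le> (\<Sum>j. c * ennreal (s j))"
  proof (rule suminf_le)
    fix j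
    have "(\<integral>\<^sup>+\<omega>. (\<integral>\<^sup>+\<sigma>. shell_chain k j \<omega> \<sigma> \<partial>tuples k) \<partial>M) \<le>
      ennreal (exp (- (lam * measure lborel (core j)))) * (ennreal (lam ^ k) * (\<integral>\<^sup>+v. indicator (shell j) (v 0) * chain k v \<partial>plane_tuples k))"
      unfolding shell_chain_def
      using assms by (intro factorial_moment_bound core_borel borel_measurable_times_ennreal chain_measurable order_refl
         measurable_compose[OF measurable_component_singleton borel_measurable_indicator]) auto
    also have "\<dots> \<le> ennreal (exp (- (lam * measure lborel (core j)))) * (ennreal (lam ^ k) * (ennreal (pi * (real j + 1)\<^sup>2) * ennreal pi ^ l))"
      unfolding k
      by (intro mult_left_mono order_trans[OF chain_integral] mult_right_mono emeasure_shell) auto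
    also have "\<dots> = c * ennreal (s j)"
      unfolding c_def s_def by (subst ennreal_mult) (auto simp: mult_ac)
    finally show "(\<integral>\<^sup>+\<omega>. (\<integral>\<^sup>+\<sigma>. shell_chain k j \<omega> \<sigma> \<partial>tuples k) \<partial>M) \<le> c * ennreal (s j)" .
  qed auto
  also have "\<dots> = c * (\<Sum>j. ennreal (s j))" by (rule ennreal_suminf_cmult)
  also have "(\<Sum>j. ennreal (s j)) = ennreal (\<Sum>j. s j)"
    using summable_shells[OF lam] by (intro suminf_ennreal2) (auto simp: s_def)
  also have "c * ennreal (\<Sum>j. s j) < \<infinity>"
    by (simp add: c_def ennreal_mult_less_top ennreal_power)
  finally show ?thesis .
qed

text \<open>\<open>G n\<close> collects the tuples that start with index \<open>n\<close>. Bounds by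
  one chain per cell therefore add up, over all cells, to at most the whole chain sum.\<close>

lemma tuple_le_chain_sum:
  assumes "k > 0" and \<omega>: "\<omega> \<in> space M"
  obtains G where "(\<integral>\<^sup>+n. G n \<partial>count_space UNIV) = chain_sum k \<omega>"
    and "\<And>\<sigma> j. \<sigma> \<in> {..<k} \<rightarrow>\<^sub>E UNIV \<Longrightarrow> shell_chain k j \<omega> \<sigma> \<le> G (\<sigma> 0)"
proof
  define F where "F \<sigma> = (\<Sum>j. shell_chain k j \<omega> \<sigma>)" for \<sigma>
  define G where "G n = (\<integral>\<^sup>+\<sigma>. F \<sigma> * indicator {n} (\<sigma> 0) \<partial>tuples k)" for n
  have c0: "(\<lambda>\<sigma>. \<sigma> 0) \<in> tuples k \<rightarrow>\<^sub>M count_space UNIV"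
    unfolding tuples_def using assms by (intro measurable_component_singleton) simp
  have "(\<lambda>\<sigma>. shell_chain k j \<omega> \<sigma>) \<in> borel_measurable (tuples k)" for j
    using measurable_compose[OF measurable_Pair1'[OF \<omega>] shell_chain_measurable[OF assms(1)], of j] by simp
  then have F: "F \<in> borel_measurable (tuples k)" unfolding F_def[abs_def] by (rule borel_measurable_suminf_order)
  have Fi: "(\<lambda>\<sigma>. F \<sigma> * indicator {n} (\<sigma> 0)) \<in> borel_measurable (tuples k)" for n
    by (intro borel_measurable_times_ennreal F measurable_compose[OF c0]) simp
  have "(\<integral>\<^sup>+n. G n \<partial>count_space UNIV) = (\<integral>\<^sup>+\<sigma>. (\<integral>\<^sup>+n. F \<sigma> * indicator {n} (\<sigma> 0) \<partial>count_space UNIV) \<partial>tuples k)"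
    unfolding G_def by (rule nn_integral_count_space_nn_integral[symmetric, OF _ Fi]) simp
  also have "\<dots> = (\<integral>\<^sup>+\<sigma>. F \<sigma> \<partial>tuples k)"
  proof (rule nn_integral_cong)
    fix \<sigma> :: "nat \<Rightarrow> nat"
    have "(\<integral>\<^sup>+n. F \<sigma> * indicator {n} (\<sigma> 0) \<partial>count_space UNIV) = (\<integral>\<^sup>+n. F \<sigma> * indicator {\<sigma> 0} n \<partial>count_space UNIV)"
      by (intro nn_integral_cong) (auto simp: indicator_def)
    also have "\<dots> = F \<sigma>" by (subst nn_integral_cmult_indicator) auto
    finally show "(\<integral>\<^sup>+n. F \<sigma> * indicator {n} (\<sigma> 0) \<partial>count_space UNIV) = F \<sigma>" .
  qed
  finally show "(\<integral>\<^sup>+n. G n \<partial>count_space UNIV) = chain_sum k \<omega>" by (simp add: F_def chain_sum_def)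
  fix \<sigma> :: "nat \<Rightarrow> nat" and j assume \<sigma>: "\<sigma> \<in> {..<k} \<rightarrow>\<^sub>E UNIV"
  have sing: "{\<sigma>} = Pi\<^sub>E {..<k} (\<lambda>i. {\<sigma> i})" using PiE_singleton[of \<sigma> "{..<k}"] \<sigma> by (simp add: PiE_def)
  have s: "{\<sigma>} \<in> sets (tuples k)" "emeasure (tuples k) {\<sigma>} = 1"
  proof -
    interpret product_sigma_finite "\<lambda>_::nat. count_space (UNIV :: nat set)" by (rule product_sigma_finite_nat)
    show "{\<sigma>} \<in> sets (tuples k)" unfolding sing tuples_def by (intro sets_PiM_I_finite) auto
    show "emeasure (tuples k) {\<sigma>} = 1" unfolding sing tuples_def by (subst emeasure_PiM) auto
  qed
  have "shell_chain k j \<omega> \<sigma> \<le> F \<sigma>"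
    unfolding F_def using sum_le_suminf[of "\<lambda>j. shell_chain k j \<omega> \<sigma>" "{j}"] by simp
  also have "F \<sigma> = (\<integral>\<^sup>+\<tau>. F \<sigma> * indicator {\<sigma>} \<tau> \<partial>tuples k)"
    using s by (simp add: nn_integral_cmult_indicator)
  also have "\<dots> \<le> G (\<sigma> 0)"
    unfolding G_def by (intro nn_integral_mono) (auto simp: indicator_def)
  finally show "shell_chain k j \<omega> \<sigma> \<le> G (\<sigma> 0)" .
qed

text \<open>Written with the enumeration instead of \<open>P\<close>, membership is a countable
  conjunction and measurable without an exceptional null set.\<close>

definition cell :: "nat \<Rightarrow> 'a \<Rightarrow> (real^2) set" where
  "cell n \<omega> = voronoi_cell (range (\<lambda>m. X m \<omega>)) (X n \<omega>)"

definition area_bound :: "'a \<Rightarrow> ennreal" where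
  "area_bound \<omega> = 256 * (chain_sum 1 \<omega> + chain_sum 3 \<omega> + chain_sum 4 \<omega>)"

lemma area_bound_measurable [measurable]: "area_bound \<in> borel_measurable M"
  unfolding area_bound_def[abs_def]
  by (intro borel_measurable_times_ennreal borel_measurable_add chain_sum_measurable) auto

lemma expected_area_bound: "(\<integral>\<^sup>+\<omega>. area_bound \<omega> \<partial>M) < \<infinity>"
  unfolding area_bound_def
  by (subst nn_integral_cmult nn_integral_add; (intro borel_measurable_add chain_sum_measurable)?; simp?)+
     (use expected_chain_sum[of 1] expected_chain_sum[of 3] expected_chain_sum[of 4] in
       \<open>auto simp: ennreal_mult_less_top nn_integral_add chain_sum_measurable\<close>)

text \<open>Each cell meeting the unit disk is charged to one chain that starts at its nucleus, so
  different cells are charged to different summands.\<close>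

lemma sum_inverse_area_le:
  "AE \<omega> in M. (\<integral>\<^sup>+n. indicator {n. cell n \<omega> \<inter> cball 0 1 \<noteq> {}} n * (inverse (emeasure lborel (cell n \<omega>)))\<^sup>2 \<partial>count_space UNIV)
     \<le> area_bound \<omega>"
  using X_enumerates AE_space
proof eventually_elim
  fix \<omega> assume *: "inj (\<lambda>n. X n \<omega>) \<and> P \<omega> = range (\<lambda>n. X n \<omega>)" and \<omega>: "\<omega> \<in> space M"
  have cell_eq: "cell n \<omega> = voronoi_cell (P \<omega>) (X n \<omega>)" for n using * by (simp add: cell_def)
  obtain G1 where G1: "(\<integral>\<^sup>+n. G1 n \<partial>count_space UNIV) = chain_sum 1 \<omega>"
    "\<And>\<sigma> j. \<sigma> \<in> {..<1} \<rightarrow>\<^sub>E UNIV \<Longrightarrow> shell_chain 1 j \<omega> \<sigma> \<le> G1 (\<sigma> 0)"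
    using tuple_le_chain_sum[of 1 \<omega>] \<omega> by auto
  obtain G3 where G3: "(\<integral>\<^sup>+n. G3 n \<partial>count_space UNIV) = chain_sum 3 \<omega>"
    "\<And>\<sigma> j. \<sigma> \<in> {..<3} \<rightarrow>\<^sub>E UNIV \<Longrightarrow> shell_chain 3 j \<omega> \<sigma> \<le> G3 (\<sigma> 0)"
    using tuple_le_chain_sum[of 3 \<omega>] \<omega> by auto
  obtain G4 where G4: "(\<integral>\<^sup>+n. G4 n \<partial>count_space UNIV) = chain_sum 4 \<omega>"
    "\<And>\<sigma> j. \<sigma> \<in> {..<4} \<rightarrow>\<^sub>E UNIV \<Longrightarrow> shell_chain 4 j \<omega> \<sigma> \<le> G4 (\<sigma> 0)"
    using tuple_le_chain_sum[of 4 \<omega>] \<omega> by auto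
  have bound: "(inverse (emeasure lborel (cell n \<omega>)))\<^sup>2 \<le> 256 * (G1 n + G3 n + G4 n)"
    if meets: "cell n \<omega> \<inter> cball 0 1 \<noteq> {}" for n
  proof -
    define x where "x = X n \<omega>"
    define j where "j = nat \<lfloor>norm x\<rfloor>"
    have x: "x \<in> P \<omega>" using * by (auto simp: x_def)
    have shell: "x \<in> shell j" by (simp add: j_def in_shell)
    \<comment> \<open>A point of the cell in the unit disk is at distance at least
      \<open>j - 1\<close> from \<open>x\<close>, but would be at distance less than
      \<open>j - 1\<close> from a nucleus in the core.\<close>
    have "P \<omega> \<inter> core j = {}"
    proof (rule ccontr)
      assume "P \<omega> \<inter> core j \<noteq> {}"
      then obtain w where w: "w \<in> P \<omega>" "norm w < real j - 2" by (auto simp: core_def)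
      obtain y where y: "y \<in> voronoi_cell (P \<omega>) x" "norm y \<le> 1"
        using meets by (auto simp: cell_eq x_def)
      have "dist y x \<le> dist y w" using y w by (auto simp: voronoi_cell_def)
      moreover have "dist y w \<le> norm y + norm w" by (simp add: dist_norm norm_triangle_ineq4)
      moreover have "norm x \<le> norm y + dist y x" using norm_triangle_ineq4[of y "y - x"] by (simp add: dist_norm)
      moreover have "real j \<le> norm x" using shell by (simp add: shell_def)
      ultimately show False using y(2) w(2) by linarith
    qed
    then have v: "void (core j) \<omega> = 1" by (simp add: void_def)
    \<comment> \<open>Turns a list of distinct nuclei into an injective tuple of indices, the
      objects over which \<open>chain_sum\<close> ranges.\<close>
    have key: "chain k (\<lambda>i. ps ! i) \<le> G n"
      if "\<And>\<sigma> j. \<sigma> \<in> {..<k} \<rightarrow>\<^sub>E UNIV \<Longrightarrow> shell_chain k j \<omega> \<sigma> \<le> G (\<sigma> 0)"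
        "length ps = k" "distinct ps" "set ps \<subseteq> P \<omega>" "ps ! 0 = x" "k > 0" for k G ps
    proof -
      have "\<exists>m. ps ! i = X m \<omega>" if "i < k" for i
      proof -
        have "ps ! i \<in> set ps" using that \<open>length ps = k\<close> by simp
        then have "ps ! i \<in> P \<omega>" using \<open>set ps \<subseteq> P \<omega>\<close> by blast
        then show ?thesis using * by auto
      qed
      then obtain m where m: "\<And>i. i < k \<Longrightarrow> ps ! i = X (m i) \<omega>" by metis
      define \<sigma> where "\<sigma> = (\<lambda>i\<in>{..<k}. m i)"
      have \<sigma>: "\<sigma> \<in> {..<k} \<rightarrow>\<^sub>E UNIV" by (auto simp: \<sigma>_def)
      have p: "pick k \<omega> \<sigma> i = ps ! i" if "i < k" for i using m[OF that] that by (simp add: pick_def \<sigma>_def)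
      have "inj_on \<sigma> {..<k}"
      proof (rule inj_onI)
        fix a b assume ab: "a \<in> {..<k}" "b \<in> {..<k}" "\<sigma> a = \<sigma> b"
        then have "ps ! a = ps ! b" using m[of a] m[of b] by (auto simp: \<sigma>_def)
        then show "a = b" using ab \<open>distinct ps\<close> \<open>length ps = k\<close> by (simp add: nth_eq_iff_index_eq)
      qed
      moreover have "\<sigma> 0 = n"
        using m[OF \<open>k > 0\<close>] \<open>ps ! 0 = x\<close> * \<open>k > 0\<close> by (auto simp: \<sigma>_def x_def dest: injD)
      moreover have "chain k (pick k \<omega> \<sigma>) = chain k (\<lambda>i. ps ! i)"
        using p \<open>k > 0\<close> by (intro chain_cong) auto
      ultimately show ?thesis
        using that(1)[OF \<sigma>, of j] shell p[OF \<open>k > 0\<close>] \<open>ps ! 0 = x\<close> by (simp add: shell_chain_def v)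
    qed
    from voronoi_area_chain[OF P_locally_finite[OF \<omega>] x]
    show ?thesis
    proof cases
      case 1
      have "chain 1 (\<lambda>i. [x] ! i) \<le> G1 n" by (rule key[OF G1(2)]) (use x in auto)
      then have "256 * chain 1 (\<lambda>i. [x] ! i) \<le> 256 * (G1 n + G3 n + G4 n)"
        by (intro mult_left_mono) (auto intro: order_trans add_increasing2)
      from order_trans[OF 1 this] show ?thesis unfolding cell_eq x_def .
    next
      case (2 p1 p2)
      have "chain 3 (\<lambda>i. [x, p2, p1] ! i) \<le> G3 n" by (rule key[OF G3(2)]) (use x 2 in auto)
      then have "256 * chain 3 (\<lambda>i. [x, p2, p1] ! i) \<le> 256 * (G1 n + G3 n + G4 n)"
        by (intro mult_left_mono) (auto intro: order_trans add_increasing2 add_increasing)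
      from order_trans[OF 2(4) this] show ?thesis unfolding cell_eq x_def .
    next
      case (3 p1 p2 p3)
      have "chain 4 (\<lambda>i. [x, p3, p2, p1] ! i) \<le> G4 n" by (rule key[OF G4(2)]) (use x 3 in auto)
      then have "256 * chain 4 (\<lambda>i. [x, p3, p2, p1] ! i) \<le> 256 * (G1 n + G3 n + G4 n)"
        by (intro mult_left_mono) (auto intro: order_trans add_increasing)
      from order_trans[OF 3(5) this] show ?thesis unfolding cell_eq x_def .
    qed
  qed
  have "(\<integral>\<^sup>+n. indicator {n. cell n \<omega> \<inter> cball 0 1 \<noteq> {}} n * (inverse (emeasure lborel (cell n \<omega>)))\<^sup>2 \<partial>count_space UNIV) \<le>
     (\<integral>\<^sup>+n. 256 * (G1 n + G3 n + G4 n) \<partial>count_space UNIV)"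
  proof (rule nn_integral_mono)
    fix n
    show "indicator {n. cell n \<omega> \<inter> cball 0 1 \<noteq> {}} n * (inverse (emeasure lborel (cell n \<omega>)))\<^sup>2
        \<le> 256 * (G1 n + G3 n + G4 n)"
    proof (cases "cell n \<omega> \<inter> cball 0 1 = {}")
      case False
      from bound[OF this] show ?thesis using False by (simp only: indicator_def mem_Collect_eq) simp
    qed simp
  qed
  also have "\<dots> = 256 * ((\<integral>\<^sup>+n. G1 n \<partial>count_space UNIV) + (\<integral>\<^sup>+n. G3 n \<partial>count_space UNIV) + (\<integral>\<^sup>+n. G4 n \<partial>count_space UNIV))"
    by (simp add: nn_integral_cmult nn_integral_add)
  also have "\<dots> = area_bound \<omega>" by (simp add: area_bound_def G1 G3 G4)
  finally show "(\<integral>\<^sup>+n. indicator {n. cell n \<omega> \<inter> cball 0 1 \<noteq> {}} n * (inverse (emeasure lborel (cell n \<omega>)))\<^sup>2 \<partial>count_space UNIV)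
     \<le> area_bound \<omega>" .
qed

end

section \<open>Reduction of the K-function to the pair density\<close>

definition pair_weight :: "(real^2) set \<Rightarrow> real^2 \<Rightarrow> real^2 \<Rightarrow> ennreal" where
  "pair_weight S y z = (if same_cell S y z then 0 else inv_area S y * inv_area S z)"

context poisson
begin

definition pair_density :: "real^2 \<Rightarrow> ennreal" where
  "pair_density z = (\<integral>\<^sup>+\<omega>. pair_weight (P \<omega>) 0 z \<partial>M)"

lemma pair_weight_measurable:
  assumes "F \<in> N \<rightarrow>\<^sub>M M" "Y \<in> N \<rightarrow>\<^sub>M borel" "W \<in> N \<rightarrow>\<^sub>M borel"
  shows "(\<lambda>x. pair_weight (P (F x)) (Y x) (W x)) \<in> borel_measurable N"
proof -
  have "{x \<in> space N. same_cell (P (F x)) (Y x) (W x)} \<in> sets N"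
    using same_cell_measurable[OF assms] by (simp add: pred_def)
  then show ?thesis unfolding pair_weight_def
    by (intro measurable_If borel_measurable_times_ennreal inv_area_measurable assms measurable_const) simp_all
qed

lemma pair_density_measurable [measurable]: "pair_density \<in> borel_measurable borel"
proof -
  have "(\<lambda>x. pair_weight (P (snd x)) 0 (fst x)) \<in> borel_measurable (borel \<Otimes>\<^sub>M M)"
    by (rule pair_weight_measurable) auto
  then show ?thesis unfolding pair_density_def[abs_def]
    by (intro borel_measurable_nn_integral) (simp add: split_beta')
qed

lemma expected_pair_weight: "(\<integral>\<^sup>+\<omega>. pair_weight (P \<omega>) y z \<partial>M) = pair_density (z - y)"
proof -
  have "(\<lambda>(b, a, c). (if b then 0 else a * c) :: ennreal) \<in> borel_measurable (count_space UNIV \<Otimes>\<^sub>M borel \<Otimes>\<^sub>M borel)"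
    by measurable
  from stationary[OF this, of y 0 "z - y"] show ?thesis
    unfolding pair_density_def pair_weight_def by (simp cong: if_cong)
qed

end

text \<open>\<open>Y_law\<close> is the averaged law of the \<open>Y n\<close> alone: the event on
  the sequence of the \<open>X n\<close> is taken to be the whole space.\<close>

locale user_process = enumerated_poisson +
  fixes \<Phi> :: "'a \<Rightarrow> (real^2) set" and Y :: "nat \<Rightarrow> 'a \<Rightarrow> real^2"
  assumes Y_measurable [measurable]: "\<And>n. Y n \<in> borel_measurable M"
    and Phi_range: "AE \<omega> in M. \<Phi> \<omega> = range (\<lambda>n. Y n \<omega>)"
    and Y_law: "\<And>N C. (\<And>n. C n \<in> sets borel) \<Longrightarrow>
      emeasure M {\<omega> \<in> space M. \<forall>n<N. Y n \<omega> \<in> C n} =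
      (\<integral>\<^sup>+\<omega>. (\<Prod>n<N. emeasure (uniform_measure lborel (cell n \<omega>)) (C n)) \<partial>M)"

section \<open>Uniform densities on the cells\<close>

context enumerated_poisson
begin

definition area :: "nat \<Rightarrow> 'a \<Rightarrow> ennreal" where
  "area n \<omega> = emeasure lborel (cell n \<omega>)"

definition dens :: "nat \<Rightarrow> 'a \<Rightarrow> real^2 \<Rightarrow> ennreal" where
  "dens n \<omega> y = indicator (cell n \<omega>) y * inverse (area n \<omega>)"

lemma cell_borel': "cell n \<omega> \<in> sets borel"
  by (simp add: cell_def)

lemma in_cell_measurable:
  assumes [measurable]: "F \<in> N \<rightarrow>\<^sub>M M" "y \<in> N \<rightarrow>\<^sub>M borel"
  shows "Measurable.pred N (\<lambda>x. y x \<in> cell n (F x))"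
proof -
  have "(\<lambda>x. X m (F x)) \<in> N \<rightarrow>\<^sub>M borel" for m
    by (rule measurable_compose[OF assms(1) X_measurable])
  then have [measurable]: "(\<lambda>x. dist (y x) (X m (F x))) \<in> borel_measurable N" for m
    by (intro borel_measurable_dist assms(2))
  have "Measurable.pred N (\<lambda>x. \<forall>m. dist (y x) (X n (F x)) \<le> dist (y x) (X m (F x)))"
    by measurable
  then show ?thesis by (simp add: cell_def voronoi_cell_def)
qed

lemma area_measurable: "area n \<in> borel_measurable M"
proof -
  have "Measurable.pred (M \<Otimes>\<^sub>M lborel) (\<lambda>x. snd x \<in> cell n (fst x))"
    by (rule in_cell_measurable) auto
  then have "(\<lambda>x. if snd x \<in> cell n (fst x) then 1 else 0 :: ennreal) \<in> borel_measurable (M \<Otimes>\<^sub>M lborel)"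
    by (intro measurable_If) (simp_all add: pred_def)
  then have "(\<lambda>\<omega>. \<integral>\<^sup>+y. (if y \<in> cell n \<omega> then 1 else 0) \<partial>lborel) \<in> borel_measurable M"
    by (intro lborel.borel_measurable_nn_integral) (simp add: split_beta')
  moreover have "(\<integral>\<^sup>+y. (if y \<in> cell n \<omega> then 1 else 0) \<partial>lborel) = area n \<omega>" for \<omega>
  proof -
    have "(\<integral>\<^sup>+y. (if y \<in> cell n \<omega> then 1 else 0) \<partial>lborel) = (\<integral>\<^sup>+y. indicator (cell n \<omega>) y \<partial>lborel)"
      by (intro nn_integral_cong) (auto simp: indicator_def)
    then show ?thesis by (simp add: area_def cell_borel')
  qed
  ultimately show ?thesis by (simp add: fun_eq_iff[symmetric])
qed

lemma dens_measurable:
  assumes "F \<in> N \<rightarrow>\<^sub>M M" "y \<in> N \<rightarrow>\<^sub>M borel"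
  shows "(\<lambda>x. dens n (F x) (y x)) \<in> borel_measurable N"
proof -
  have "(\<lambda>x. if y x \<in> cell n (F x) then 1 else 0 :: ennreal) \<in> borel_measurable N"
    using in_cell_measurable[OF assms] by (intro measurable_If) (simp_all add: pred_def)
  moreover have "(\<lambda>x. inverse (area n (F x))) \<in> borel_measurable N"
    by (rule borel_measurable_inverse_ennreal[OF measurable_compose[OF assms(1) area_measurable]])
  ultimately have "(\<lambda>x. (if y x \<in> cell n (F x) then 1 else 0) * inverse (area n (F x))) \<in> borel_measurable N"
    by (rule borel_measurable_times_ennreal)
  then show ?thesis by (simp add: dens_def indicator_def of_bool_def)
qed

lemma uniform_cell:
  assumes "C \<in> sets borel"
  shows "emeasure (uniform_measure lborel (cell n \<omega>)) C = (\<integral>\<^sup>+y. dens n \<omega> y * indicator C y \<partial>lborel)"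
proof -
  have "(\<integral>\<^sup>+y. dens n \<omega> y * indicator C y \<partial>lborel) = (\<integral>\<^sup>+y. inverse (area n \<omega>) * indicator (cell n \<omega> \<inter> C) y \<partial>lborel)"
    by (intro nn_integral_cong) (auto simp: dens_def indicator_def)
  also have "\<dots> = inverse (area n \<omega>) * emeasure lborel (cell n \<omega> \<inter> C)"
    using assms cell_borel' by (intro nn_integral_cmult_indicator) simp
  finally show ?thesis
    using assms cell_borel' by (simp add: emeasure_uniform_measure area_def divide_ennreal_def mult.commute)
qed

end

section \<open>Joint law of two user points\<close>

context user_process
begin

text \<open>\<open>uniform_measure\<close> has total mass 0 if the area is 0 or infinite. The total
  probability 1 is the expectation of a product of factors at most 1, so almost surely every factor
  is 1. Positivity and finiteness of all cell areas thus come from the law of the \<open>Y n\<close>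
  rather than from geometry.\<close>

lemma uniform_cell_UNIV:
  "AE \<omega> in M. \<forall>n. emeasure (uniform_measure lborel (cell n \<omega>)) UNIV = 1"
  unfolding AE_all_countable
proof
  fix n
  define f where "f = (\<lambda>\<omega>. \<Prod>k<Suc n. emeasure (uniform_measure lborel (cell k \<omega>)) UNIV)"
  define u where "u k \<omega> = emeasure (uniform_measure lborel (cell k \<omega>)) UNIV" for k \<omega>
  have u: "u k \<omega> = area k \<omega> / area k \<omega>" for k \<omega>
    by (simp add: u_def emeasure_uniform_measure cell_borel' area_def)
  have u_meas: "u k \<in> borel_measurable M" for k
    unfolding u[abs_def] by (intro borel_measurable_divide_ennreal area_measurable)
  have u1: "u k \<omega> \<le> 1" for k \<omega>
    unfolding u by (cases "area k \<omega> = 0 \<or> area k \<omega> = \<infinity>") (auto simp: ennreal_divide_self less_top)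
  have f: "f = (\<lambda>\<omega>. \<Prod>k<Suc n. u k \<omega>)" by (simp add: f_def u_def)
  have fm: "f \<in> borel_measurable M" unfolding f by (intro borel_measurable_prod_ennreal u_meas)
  have f1: "f \<omega> \<le> u n \<omega>" for \<omega>
  proof -
    have "(\<Prod>k<n. u k \<omega>) \<le> 1" by (induction n) (auto intro!: mult_le_one u1)
    from mult_right_mono[OF this, of "u n \<omega>"] show ?thesis unfolding f by simp
  qed
  have "1 = emeasure M {\<omega> \<in> space M. \<forall>k<Suc n. Y k \<omega> \<in> UNIV}"
    by (simp add: emeasure_space_1)
  also have "\<dots> = (\<integral>\<^sup>+\<omega>. f \<omega> \<partial>M)" unfolding f_def by (rule Y_law) simp
  finally have int: "(\<integral>\<^sup>+\<omega>. f \<omega> \<partial>M) = 1" by simp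
  have "(\<integral>\<^sup>+\<omega>. (1 - f \<omega>) \<partial>M) = (\<integral>\<^sup>+\<omega>. 1 \<partial>M) - (\<integral>\<^sup>+\<omega>. f \<omega> \<partial>M)"
    using fm int order_trans[OF f1 u1] by (intro nn_integral_diff) auto
  also have "\<dots> = 0" by (simp add: int emeasure_space_1)
  finally have "AE \<omega> in M. 1 - f \<omega> = 0"
    using fm by (subst (asm) nn_integral_0_iff_AE) auto
  then show "AE \<omega> in M. emeasure (uniform_measure lborel (cell n \<omega>)) UNIV = 1"
  proof eventually_elim
    case (elim \<omega>)
    then have "1 \<le> f \<omega>" by (simp add: diff_eq_0_iff_ennreal)
    then have "1 \<le> u n \<omega>" using f1 order_trans by blast
    then show ?case using u1[of n \<omega>] by (auto simp: u_def)
  qed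
qed

lemma area_positive_finite:
  "AE \<omega> in M. \<forall>n. 0 < area n \<omega> \<and> area n \<omega> < \<infinity>"
  using uniform_cell_UNIV
proof eventually_elim
  case (elim \<omega>)
  show ?case
  proof
    fix n
    have "area n \<omega> / area n \<omega> = 1" using elim by (simp add: emeasure_uniform_measure cell_borel' area_def)
    then show "0 < area n \<omega> \<and> area n \<omega> < \<infinity>" by (cases "area n \<omega> = 0 \<or> area n \<omega> = \<infinity>") (auto simp: less_top zero_less_iff_neq_zero)
  qed
qed

text \<open>The other coordinates are unconstrained and contribute factors that are almost surely
  1.\<close>

lemma pair_law_rectangle:
  assumes "n \<noteq> m" and C: "C \<in> sets borel" and D: "D \<in> sets borel"
  shows "emeasure M {\<omega> \<in> space M. Y n \<omega> \<in> C \<and> Y m \<omega> \<in> D} =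
    (\<integral>\<^sup>+\<omega>. emeasure (uniform_measure lborel (cell n \<omega>)) C * emeasure (uniform_measure lborel (cell m \<omega>)) D \<partial>M)"
proof -
  define E where "E k = (if k = n then C else if k = m then D else UNIV)" for k
  define N where "N = Suc (max n m)"
  have N: "n < N" "m < N" by (auto simp: N_def)
  have "{\<omega> \<in> space M. Y n \<omega> \<in> C \<and> Y m \<omega> \<in> D} = {\<omega> \<in> space M. \<forall>k<N. Y k \<omega> \<in> E k}"
    using N assms(1) by (auto simp: E_def)
  also have "emeasure M \<dots> = (\<integral>\<^sup>+\<omega>. (\<Prod>k<N. emeasure (uniform_measure lborel (cell k \<omega>)) (E k)) \<partial>M)"
    using C D by (intro Y_law) (auto simp: E_def)
  also have "\<dots> = (\<integral>\<^sup>+\<omega>. emeasure (uniform_measure lborel (cell n \<omega>)) C * emeasure (uniform_measure lborel (cell m \<omega>)) D \<partial>M)"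
  proof (rule nn_integral_cong_AE)
    from uniform_cell_UNIV
    show "AE \<omega> in M. (\<Prod>k<N. emeasure (uniform_measure lborel (cell k \<omega>)) (E k)) =
        emeasure (uniform_measure lborel (cell n \<omega>)) C * emeasure (uniform_measure lborel (cell m \<omega>)) D"
    proof eventually_elim
      case (elim \<omega>)
      have "(\<Prod>k<N. emeasure (uniform_measure lborel (cell k \<omega>)) (E k)) =
          (\<Prod>k\<in>{n, m}. emeasure (uniform_measure lborel (cell k \<omega>)) (E k))"
        using N elim by (intro prod.mono_neutral_right) (auto simp: E_def)
      then show ?case using assms(1) by (simp add: E_def)
    qed
  qed
  finally show ?thesis .
qed

text \<open>Rectangles form an intersection-stable generator, so agreement on them extends to all
  nonnegative Borel functions of the pair.\<close>

lemma pair_law: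
  assumes "n \<noteq> m" and f: "f \<in> borel_measurable (borel \<Otimes>\<^sub>M borel)"
  shows "(\<integral>\<^sup>+\<omega>. f (Y n \<omega>, Y m \<omega>) \<partial>M) =
    (\<integral>\<^sup>+\<omega>. (\<integral>\<^sup>+y. (\<integral>\<^sup>+z. dens n \<omega> y * dens m \<omega> z * f (y, z) \<partial>lborel) \<partial>lborel) \<partial>M)"
proof -
  let ?B = "borel :: (real^2) measure" and ?L = "lborel :: (real^2) measure"
  have LL: "sigma_finite_measure (?L \<Otimes>\<^sub>M ?L)" 
    by (intro sigma_finite_pair_measure lborel.sigma_finite_measure_axioms)
  define w where "w x = dens n (fst x) (fst (snd x)) * dens m (fst x) (snd (snd x))" for x
  have sb: "sets (?L \<Otimes>\<^sub>M ?L) = sets (?B \<Otimes>\<^sub>M ?B)" by (intro sets_pair_measure_cong) auto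
  have c1: "(\<lambda>x. fst (snd x)) \<in> M \<Otimes>\<^sub>M (?L \<Otimes>\<^sub>M ?L) \<rightarrow>\<^sub>M ?B"
    using measurable_compose[OF measurable_snd measurable_fst, of M ?L ?L] by simp
  have c2: "(\<lambda>x. snd (snd x)) \<in> M \<Otimes>\<^sub>M (?L \<Otimes>\<^sub>M ?L) \<rightarrow>\<^sub>M ?B"
    using measurable_compose[OF measurable_snd measurable_snd, of M ?L ?L] by simp
  have wm: "w \<in> borel_measurable (M \<Otimes>\<^sub>M (?L \<Otimes>\<^sub>M ?L))"
    unfolding w_def[abs_def]
    by (intro borel_measurable_times_ennreal dens_measurable c1 c2 measurable_fst)
  have sndm: "snd \<in> M \<Otimes>\<^sub>M (?L \<Otimes>\<^sub>M ?L) \<rightarrow>\<^sub>M ?B \<Otimes>\<^sub>M ?B"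
    using measurable_snd[of M "?L \<Otimes>\<^sub>M ?L"] measurable_cong_sets[OF refl sb] by blast
  define \<nu> where "\<nu> = distr (density (M \<Otimes>\<^sub>M (?L \<Otimes>\<^sub>M ?L)) w) (?B \<Otimes>\<^sub>M ?B) snd"
  define \<mu> where "\<mu> = distr M (?B \<Otimes>\<^sub>M ?B) (\<lambda>\<omega>. (Y n \<omega>, Y m \<omega>))"
  have Ym: "(\<lambda>\<omega>. (Y n \<omega>, Y m \<omega>)) \<in> M \<rightarrow>\<^sub>M ?B \<Otimes>\<^sub>M ?B" by simp
  have int_\<nu>: "(\<integral>\<^sup>+x. g x \<partial>\<nu>) = (\<integral>\<^sup>+\<omega>. (\<integral>\<^sup>+y. (\<integral>\<^sup>+z. dens n \<omega> y * dens m \<omega> z * g (y, z) \<partial>lborel) \<partial>lborel) \<partial>M)"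
    if g: "g \<in> borel_measurable (?B \<Otimes>\<^sub>M ?B)" for g
  proof -
    have gs: "(\<lambda>x. g (snd x)) \<in> borel_measurable (M \<Otimes>\<^sub>M (?L \<Otimes>\<^sub>M ?L))"
      by (rule measurable_compose[OF sndm g])
    have wg: "(\<lambda>x. w x * g (snd x)) \<in> borel_measurable (M \<Otimes>\<^sub>M (?L \<Otimes>\<^sub>M ?L))"
      by (intro borel_measurable_times_ennreal wm gs)
    have "(\<integral>\<^sup>+x. g x \<partial>\<nu>) = (\<integral>\<^sup>+x. g (snd x) \<partial>density (M \<Otimes>\<^sub>M (?L \<Otimes>\<^sub>M ?L)) w)"
      unfolding \<nu>_def using g sndm by (subst nn_integral_distr) auto
    also have "\<dots> = (\<integral>\<^sup>+x. w x * g (snd x) \<partial>(M \<Otimes>\<^sub>M (?L \<Otimes>\<^sub>M ?L)))"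
      by (rule nn_integral_density[OF wm gs])
    also have "\<dots> = (\<integral>\<^sup>+\<omega>. (\<integral>\<^sup>+p. w (\<omega>, p) * g p \<partial>(?L \<Otimes>\<^sub>M ?L)) \<partial>M)"
      by (subst sigma_finite_measure.nn_integral_fst[OF LL wg, symmetric]) simp
    also have "\<dots> = (\<integral>\<^sup>+\<omega>. (\<integral>\<^sup>+y. (\<integral>\<^sup>+z. dens n \<omega> y * dens m \<omega> z * g (y, z) \<partial>lborel) \<partial>lborel) \<partial>M)"
    proof (rule nn_integral_cong)
      fix \<omega> assume "\<omega> \<in> space M"
      from measurable_compose[OF measurable_Pair1'[OF this] wg]
      have "(\<lambda>p. w (\<omega>, p) * g p) \<in> borel_measurable (?L \<Otimes>\<^sub>M ?L)" by simp
      from lborel.nn_integral_fst[OF this, symmetric]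
      show "(\<integral>\<^sup>+p. w (\<omega>, p) * g p \<partial>(?L \<Otimes>\<^sub>M ?L)) =
        (\<integral>\<^sup>+y. (\<integral>\<^sup>+z. dens n \<omega> y * dens m \<omega> z * g (y, z) \<partial>lborel) \<partial>lborel)"
        by (simp add: w_def)
    qed
    finally show ?thesis .
  qed
  have "\<mu> = \<nu>"
  proof (rule measure_eqI_generator_eq[OF Int_stable_pair_measure_generator[of ?B ?B]])
    show "{a \<times> b |a b. a \<in> sets ?B \<and> b \<in> sets ?B} \<subseteq> Pow (UNIV \<times> UNIV)" by auto
    show "sets \<mu> = sigma_sets (UNIV \<times> UNIV) {a \<times> b |a b. a \<in> sets ?B \<and> b \<in> sets ?B}"
      "sets \<nu> = sigma_sets (UNIV \<times> UNIV) {a \<times> b |a b. a \<in> sets ?B \<and> b \<in> sets ?B}"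
      by (simp_all add: \<mu>_def \<nu>_def sets_pair_measure)
    fix R assume "R \<in> {a \<times> b |a b. a \<in> sets ?B \<and> b \<in> sets ?B}"
    then obtain C D where R: "R = C \<times> D" and C: "C \<in> sets ?B" and D: "D \<in> sets ?B" by auto
    have "emeasure \<mu> R = emeasure M {\<omega> \<in> space M. Y n \<omega> \<in> C \<and> Y m \<omega> \<in> D}"
      unfolding \<mu>_def R using C D by (subst emeasure_distr[OF Ym]) (auto intro!: arg_cong[where f = "emeasure M"])
    also have "\<dots> = (\<integral>\<^sup>+\<omega>. emeasure (uniform_measure lborel (cell n \<omega>)) C * emeasure (uniform_measure lborel (cell m \<omega>)) D \<partial>M)"
      by (rule pair_law_rectangle[OF assms(1) C D])
    also have "\<dots> = (\<integral>\<^sup>+\<omega>. (\<integral>\<^sup>+y. (\<integral>\<^sup>+z. dens n \<omega> y * dens m \<omega> z * indicator R (y, z) \<partial>lborel) \<partial>lborel) \<partial>M)"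
    proof (rule nn_integral_cong)
      fix \<omega> assume \<omega>: "\<omega> \<in> space M"
      have d: "dens k \<omega> \<in> borel_measurable ?L" for k
        using dens_measurable[of "\<lambda>_. \<omega>" ?L "\<lambda>y. y" k] \<omega> by simp
      have dC: "(\<lambda>y. dens n \<omega> y * indicator C y) \<in> borel_measurable ?L" and dD: "(\<lambda>y. dens m \<omega> y * indicator D y) \<in> borel_measurable ?L"
        using C D by (intro borel_measurable_times_ennreal d borel_measurable_indicator; simp)+
      have "(\<integral>\<^sup>+y. (\<integral>\<^sup>+z. dens n \<omega> y * dens m \<omega> z * indicator R (y, z) \<partial>lborel) \<partial>lborel) =
        (\<integral>\<^sup>+y. (\<integral>\<^sup>+z. (dens n \<omega> y * indicator C y) * (dens m \<omega> z * indicator D z) \<partial>lborel) \<partial>lborel)"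
        unfolding R indicator_times by (simp add: mult_ac)
      also have "\<dots> = (\<integral>\<^sup>+y. (dens n \<omega> y * indicator C y) * (\<integral>\<^sup>+z. dens m \<omega> z * indicator D z \<partial>lborel) \<partial>lborel)"
        by (intro nn_integral_cong nn_integral_cmult dD)
      also have "\<dots> = (\<integral>\<^sup>+y. dens n \<omega> y * indicator C y \<partial>lborel) * (\<integral>\<^sup>+z. dens m \<omega> z * indicator D z \<partial>lborel)"
        by (rule nn_integral_multc[OF dC])
      finally show "emeasure (uniform_measure lborel (cell n \<omega>)) C * emeasure (uniform_measure lborel (cell m \<omega>)) D =
        (\<integral>\<^sup>+y. (\<integral>\<^sup>+z. dens n \<omega> y * dens m \<omega> z * indicator R (y, z) \<partial>lborel) \<partial>lborel)"
        by (simp add: uniform_cell[OF C] uniform_cell[OF D])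
    qed
    also have "\<dots> = (\<integral>\<^sup>+x. indicator R x \<partial>\<nu>)"
      using C D unfolding R by (intro int_\<nu>[symmetric] borel_measurable_indicator pair_measureI)
    also have "\<dots> = emeasure \<nu> R"
      using C D unfolding R by (intro nn_integral_indicator) (simp add: \<nu>_def)
    finally show "emeasure \<mu> R = emeasure \<nu> R" .
  next
    show "range (\<lambda>_::nat. UNIV \<times> UNIV) \<subseteq> {a \<times> b |a b. a \<in> sets ?B \<and> b \<in> sets ?B}"
      by (auto intro!: exI[of _ UNIV])
    show "(\<Union>i::nat. UNIV \<times> UNIV) = (UNIV \<times> UNIV :: ((real^2) \<times> (real^2)) set)" by auto
    show "emeasure \<mu> (UNIV \<times> UNIV) \<noteq> \<infinity>" for i :: nat
      using prob_space.emeasure_space_1[OF prob_space_distr[OF Ym]] by (simp add: \<mu>_def space_pair_measure)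
  qed
  moreover have "(\<integral>\<^sup>+\<omega>. f (Y n \<omega>, Y m \<omega>) \<partial>M) = (\<integral>\<^sup>+x. f x \<partial>\<mu>)"
    unfolding \<mu>_def using f by (subst nn_integral_distr[OF Ym]) auto
  ultimately show ?thesis using int_\<nu>[OF f] by simp
qed

end

context enumerated_poisson
begin

lemma dens_tie_free:
  assumes *: "inj (\<lambda>n. X n \<omega>)" "P \<omega> = range (\<lambda>n. X n \<omega>)" and \<omega>: "\<omega> \<in> space M" and tf: "tie_free (P \<omega>) y"
  obtains n where "y \<in> cell n \<omega>" "\<And>k. dens k \<omega> y = indicator {n} k * inverse (area n \<omega>)"
    "inv_area (P \<omega>) y = inverse (area n \<omega>)" "{w. same_cell (P \<omega>) y w} = cell n \<omega>"
    "\<And>k. y \<in> cell k \<omega> \<Longrightarrow> k = n"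
proof -
  have c: "cell k \<omega> = voronoi_cell (P \<omega>) (X k \<omega>)" for k by (simp add: cell_def *(2))
  have XP: "X k \<omega> \<in> P \<omega>" for k unfolding *(2) by (rule rangeI)
  then have "P \<omega> \<noteq> {}" by blast
  from exists_voronoi_cell[OF P_locally_finite[OF \<omega>] this, of y]
  obtain x where x: "x \<in> P \<omega>" "y \<in> voronoi_cell (P \<omega>) x" by blast
  then obtain n where "x = X n \<omega>" unfolding *(2) by blast
  with x have n: "y \<in> cell n \<omega>" by (simp only: c)
  have uniq: "k = n" if "y \<in> cell k \<omega>" for k
  proof -
    have "X k \<omega> = X n \<omega>"
      using tf that n XP unfolding tie_free_def c by blast
    then show "k = n" by (rule injD[OF *(1)])
  qed
  show ?thesis
  proof (rule that[OF n])
    show "dens k \<omega> y = indicator {n} k * inverse (area n \<omega>)" for k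
      
    proof (cases "k = n")
      case False
      then have "y \<notin> cell k \<omega>" using uniq by blast
      with False show ?thesis by (simp add: dens_def)
    qed (simp add: dens_def n)
    show "inv_area (P \<omega>) y = inverse (area n \<omega>)"
      unfolding area_def c by (rule inv_area_eq[OF tf XP n[unfolded c]])
    show "{w. same_cell (P \<omega>) y w} = cell n \<omega>"
      unfolding c by (rule same_cell_eq_voronoi[OF tf XP n[unfolded c]])
    show "k = n" if "y \<in> cell k \<omega>" for k using uniq[OF that] .
  qed
qed

text \<open>Off ties a single pair of indices can contribute, and leaving out the diagonal becomes
  the condition that \<open>y\<close> and \<open>z\<close> lie in different cells.\<close>

lemma sum_dens_pairs:
  assumes *: "inj (\<lambda>n. X n \<omega>)" "P \<omega> = range (\<lambda>n. X n \<omega>)" and \<omega>: "\<omega> \<in> space M"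
    and tf: "tie_free (P \<omega>) y" "tie_free (P \<omega>) z"
  shows "(\<integral>\<^sup>+n. (\<integral>\<^sup>+m. (if n = m then 0 else dens n \<omega> y * dens m \<omega> z) \<partial>count_space UNIV) \<partial>count_space UNIV) = pair_weight (P \<omega>) y z"
proof -
  obtain n where n: "y \<in> cell n \<omega>" "\<And>k. dens k \<omega> y = indicator {n} k * inverse (area n \<omega>)"
    "inv_area (P \<omega>) y = inverse (area n \<omega>)" "{w. same_cell (P \<omega>) y w} = cell n \<omega>"
    using dens_tie_free[OF * \<omega> tf(1)] by metis
  obtain m where m: "z \<in> cell m \<omega>" "\<And>k. dens k \<omega> z = indicator {m} k * inverse (area m \<omega>)"
    "inv_area (P \<omega>) z = inverse (area m \<omega>)" "{w. same_cell (P \<omega>) z w} = cell m \<omega>"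
    using dens_tie_free[OF * \<omega> tf(2)] by metis
  have same: "same_cell (P \<omega>) y z \<longleftrightarrow> n = m"
  proof -
    have "same_cell (P \<omega>) y z \<longleftrightarrow> z \<in> cell n \<omega>" using n(4) by auto
    also have "\<dots> \<longleftrightarrow> n = m"
    proof
      assume "z \<in> cell n \<omega>"
      then have "X n \<omega> = X m \<omega>"
        using tf(2) m(1) unfolding tie_free_def cell_def *(2) by blast
      then show "n = m" by (rule injD[OF *(1)])
    qed (use m in simp)
    finally show ?thesis .
  qed
  have "(\<integral>\<^sup>+k. (\<integral>\<^sup>+l. (if k = l then 0 else dens k \<omega> y * dens l \<omega> z) \<partial>count_space UNIV) \<partial>count_space UNIV) =
    (\<integral>\<^sup>+k. (\<integral>\<^sup>+l. (pair_weight (P \<omega>) y z * indicator {n} k) * indicator {m} l \<partial>count_space UNIV) \<partial>count_space UNIV)"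
    by (intro nn_integral_cong) (auto simp: pair_weight_def same n m indicator_def)
  also have "\<dots> = (\<integral>\<^sup>+k. pair_weight (P \<omega>) y z * indicator {n} k \<partial>count_space UNIV)"
    by (intro nn_integral_cong) (simp add: nn_integral_cmult_indicator)
  also have "\<dots> = pair_weight (P \<omega>) y z"
    by (simp add: nn_integral_cmult_indicator)
  finally show ?thesis .
qed

end

lemma nn_integral_range:
  fixes y :: "nat \<Rightarrow> 'b"
  assumes "inj y"
  shows "(\<integral>\<^sup>+x. g x \<partial>count_space (range y \<inter> B)) = (\<integral>\<^sup>+n. g (y n) * indicator B (y n) \<partial>count_space UNIV)"
proof -
  have "(\<integral>\<^sup>+x. g x \<partial>count_space (range y \<inter> B)) = (\<integral>\<^sup>+x. g x * indicator B x \<partial>count_space (range y))"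
    by (simp add: nn_integral_count_space_indicator[of "range y \<inter> B"] nn_integral_count_space_indicator[of "range y"]
        indicator_inter_arith mult_ac)
  also have "\<dots> = (\<integral>\<^sup>+n. g (y n) * indicator B (y n) \<partial>count_space UNIV)"
    by (rule nn_integral_bij_count_space[symmetric]) (rule inj_on_imp_bij_betw[OF assms])
  finally show ?thesis .
qed

section \<open>From sums over pairs of points to the integral of the pair density\<close>

context user_process
begin

text \<open>A pair of user points has a joint density, so coincidences have probability 0. Since
  \<open>\<Phi> \<omega>\<close> is a set, this is what turns sums over its points into sums over
  indices.\<close>

lemma Y_inj: "AE \<omega> in M. inj (\<lambda>n. Y n \<omega>)"
proof -
  have "AE \<omega> in M. Y n \<omega> \<noteq> Y m \<omega>" if "n \<noteq> m" for n m
  proof -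
    define f :: "(real^2) \<times> (real^2) \<Rightarrow> ennreal" where "f p = indicator {p. fst p = snd p} p" for p
    have "{p :: (real^2) \<times> (real^2). fst p = snd p} \<in> sets borel"
      by (intro borel_closed closed_Collect_eq continuous_intros)
    then have fm: "f \<in> borel_measurable (borel \<Otimes>\<^sub>M borel)"
      unfolding f_def[abs_def] borel_prod by simp
    have "(\<integral>\<^sup>+\<omega>. f (Y n \<omega>, Y m \<omega>) \<partial>M) =
      (\<integral>\<^sup>+\<omega>. (\<integral>\<^sup>+y. (\<integral>\<^sup>+z. dens n \<omega> y * dens m \<omega> z * f (y, z) \<partial>lborel) \<partial>lborel) \<partial>M)"
      by (rule pair_law[OF that fm])
    also have "\<dots> = 0"
    proof -
      have "(\<integral>\<^sup>+z. dens n \<omega> y * dens m \<omega> z * f (y, z) \<partial>lborel) = 0" for \<omega> y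
      proof -
        have "AE z in lborel. z \<noteq> y" by (rule AE_lborel_singleton)
        then have "AE z in lborel. dens n \<omega> y * dens m \<omega> z * f (y, z) = 0"
          by eventually_elim (auto simp: f_def)
        then have "(\<integral>\<^sup>+z. dens n \<omega> y * dens m \<omega> z * f (y, z) \<partial>lborel) = (\<integral>\<^sup>+z. 0 \<partial>(lborel :: (real^2) measure))"
          by (rule nn_integral_cong_AE)
        then show ?thesis by simp
      qed
      then show ?thesis by simp
    qed
    finally have "(\<integral>\<^sup>+\<omega>. f (Y n \<omega>, Y m \<omega>) \<partial>M) = 0" .
    moreover have "(\<lambda>\<omega>. f (Y n \<omega>, Y m \<omega>)) \<in> borel_measurable M"
      by (rule measurable_compose[OF _ fm]) simp
    ultimately have "AE \<omega> in M. f (Y n \<omega>, Y m \<omega>) = 0" by (simp add: nn_integral_0_iff_AE)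
    then show ?thesis by eventually_elim (auto simp: f_def)
  qed
  then have "AE \<omega> in M. \<forall>n m. n \<noteq> m \<longrightarrow> Y n \<omega> \<noteq> Y m \<omega>"
    unfolding AE_all_countable by auto
  then show ?thesis by eventually_elim (auto simp: inj_def)
qed

definition palm_sum :: "real \<Rightarrow> (real^2) set \<Rightarrow> ennreal" where
  "palm_sum r B = (\<integral>\<^sup>+\<omega>. (\<integral>\<^sup>+x. emeasure (count_space UNIV) (\<Phi> \<omega> \<inter> (cball x r - {x})) \<partial>count_space (\<Phi> \<omega> \<inter> B)) \<partial>M)"

definition near :: "real \<Rightarrow> (real^2) set \<Rightarrow> (real^2) \<times> (real^2) \<Rightarrow> ennreal" where
  "near r B p = indicator B (fst p) * indicator (cball 0 r) (snd p - fst p)"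

lemma near_measurable:
  assumes [measurable]: "B \<in> sets borel"
  shows "near r B \<in> borel_measurable (borel \<Otimes>\<^sub>M borel)"
proof -
  have "(\<lambda>p :: (real^2) \<times> (real^2). snd p - fst p) \<in> borel \<Otimes>\<^sub>M borel \<rightarrow>\<^sub>M borel"
    by measurable
  then have "(\<lambda>p :: (real^2) \<times> (real^2). indicator (cball 0 r) (snd p - fst p) :: ennreal) \<in> borel_measurable (borel \<Otimes>\<^sub>M borel)"
    by (rule measurable_compose[OF _ borel_measurable_indicator]) simp
  then show ?thesis unfolding near_def[abs_def]
    by (intro borel_measurable_times_ennreal measurable_compose[OF measurable_fst borel_measurable_indicator] assms)
qed

lemma palm_sum_pairs:
  assumes B: "B \<in> sets borel"
  shows "palm_sum r B = (\<integral>\<^sup>+n. (\<integral>\<^sup>+m. (if n = m then 0 else \<integral>\<^sup>+\<omega>. near r B (Y n \<omega>, Y m \<omega>) \<partial>M) \<partial>count_space UNIV) \<partial>count_space UNIV)"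
proof -
  have nm: "(\<lambda>\<omega>. if n = m then 0 else near r B (Y n \<omega>, Y m \<omega>)) \<in> borel_measurable M" for n m
    using measurable_compose[OF _ near_measurable[OF B], of "\<lambda>\<omega>. (Y n \<omega>, Y m \<omega>)" M r] by simp
  have "palm_sum r B = (\<integral>\<^sup>+\<omega>. (\<integral>\<^sup>+n. (\<integral>\<^sup>+m. (if n = m then 0 else near r B (Y n \<omega>, Y m \<omega>)) \<partial>count_space UNIV) \<partial>count_space UNIV) \<partial>M)"
    unfolding palm_sum_def
  proof (rule nn_integral_cong_AE)
    from Y_inj Phi_range
    show "AE \<omega> in M. (\<integral>\<^sup>+x. emeasure (count_space UNIV) (\<Phi> \<omega> \<inter> (cball x r - {x})) \<partial>count_space (\<Phi> \<omega> \<inter> B)) =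
      (\<integral>\<^sup>+n. (\<integral>\<^sup>+m. (if n = m then 0 else near r B (Y n \<omega>, Y m \<omega>)) \<partial>count_space UNIV) \<partial>count_space UNIV)"
    proof eventually_elim
      case (elim \<omega>)
      have "emeasure (count_space UNIV) (\<Phi> \<omega> \<inter> (cball (Y n \<omega>) r - {Y n \<omega>})) =
          (\<integral>\<^sup>+m. (if n = m then 0 else indicator (cball 0 r) (Y m \<omega> - Y n \<omega>)) \<partial>count_space UNIV)" for n
      proof -
        have "emeasure (count_space UNIV) (\<Phi> \<omega> \<inter> (cball (Y n \<omega>) r - {Y n \<omega>})) =
           (\<integral>\<^sup>+x. indicator (\<Phi> \<omega> \<inter> (cball (Y n \<omega>) r - {Y n \<omega>})) x \<partial>count_space UNIV)"
          by simp
        also have "\<dots> = (\<integral>\<^sup>+x. 1 \<partial>count_space (\<Phi> \<omega> \<inter> (cball (Y n \<omega>) r - {Y n \<omega>})))"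
          by (simp add: emeasure_count_space)
        also have "\<dots> = (\<integral>\<^sup>+m. indicator (cball (Y n \<omega>) r - {Y n \<omega>}) (Y m \<omega>) \<partial>count_space UNIV)"
          unfolding elim(2) by (subst nn_integral_range[OF elim(1)]) simp
        also have "\<dots> = (\<integral>\<^sup>+m. (if n = m then 0 else indicator (cball 0 r) (Y m \<omega> - Y n \<omega>)) \<partial>count_space UNIV)"
          using elim(1) by (intro nn_integral_cong) (auto simp: indicator_def dist_norm norm_minus_commute dest: injD)
        finally show ?thesis .
      qed
      then have "(\<integral>\<^sup>+x. emeasure (count_space UNIV) (\<Phi> \<omega> \<inter> (cball x r - {x})) \<partial>count_space (\<Phi> \<omega> \<inter> B)) =
         (\<integral>\<^sup>+n. (\<integral>\<^sup>+m. (if n = m then 0 else indicator (cball 0 r) (Y m \<omega> - Y n \<omega>)) \<partial>count_space UNIV) * indicator B (Y n \<omega>) \<partial>count_space UNIV)"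
        using nn_integral_range[OF elim(1), where B = B and g = "\<lambda>x. emeasure (count_space UNIV) (\<Phi> \<omega> \<inter> (cball x r - {x}))"]
        by (simp add: elim(2))
      also have "\<dots> = (\<integral>\<^sup>+n. (\<integral>\<^sup>+m. (if n = m then 0 else near r B (Y n \<omega>, Y m \<omega>)) \<partial>count_space UNIV) \<partial>count_space UNIV)"
        by (intro nn_integral_cong, subst nn_integral_multc[symmetric])
           (auto intro!: nn_integral_cong simp: near_def mult.commute)
      finally show ?case .
    qed
  qed
  also have "\<dots> = (\<integral>\<^sup>+n. (\<integral>\<^sup>+\<omega>. (\<integral>\<^sup>+m. (if n = m then 0 else near r B (Y n \<omega>, Y m \<omega>)) \<partial>count_space UNIV) \<partial>M) \<partial>count_space UNIV)"
    using nm by (intro nn_integral_count_space_nn_integral) (auto simp: nn_integral_count_space_nat intro!: borel_measurable_suminf_order)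
  also have "\<dots> = (\<integral>\<^sup>+n. (\<integral>\<^sup>+m. (\<integral>\<^sup>+\<omega>. (if n = m then 0 else near r B (Y n \<omega>, Y m \<omega>)) \<partial>M) \<partial>count_space UNIV) \<partial>count_space UNIV)"
    using nm by (intro nn_integral_cong nn_integral_count_space_nn_integral) auto
  also have "\<dots> = (\<integral>\<^sup>+n. (\<integral>\<^sup>+m. (if n = m then 0 else \<integral>\<^sup>+\<omega>. near r B (Y n \<omega>, Y m \<omega>) \<partial>M) \<partial>count_space UNIV) \<partial>count_space UNIV)"
    by (intro nn_integral_cong) auto
  finally show ?thesis .
qed

definition ball_mass :: "real \<Rightarrow> ennreal" where
  "ball_mass r = (\<integral>\<^sup>+w. pair_density w * indicator (cball 0 r) w \<partial>lborel)"

text \<open>Summed over indices, the joint densities give \<open>pair_weight\<close>, whose mean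
  depends on \<open>z - y\<close> only; a translation then separates the window from the
  disk.\<close>

lemma palm_sum_eq:
  assumes B[measurable]: "B \<in> sets borel"
  shows "palm_sum r B = emeasure lborel B * ball_mass r"
proof -
  let ?L = "lborel :: (real^2) measure"
  have LL: "sigma_finite_measure (?L \<Otimes>\<^sub>M ?L)"
    by (intro sigma_finite_pair_measure lborel.sigma_finite_measure_axioms)
  interpret P2: pair_sigma_finite M "?L \<Otimes>\<^sub>M ?L"
    by (rule pair_sigma_finite.intro[OF sigma_finite_measure_axioms LL])
  define d where "d n m x = (if n = m then 0 else dens n (fst x) (fst (snd x)) * dens m (fst x) (snd (snd x)) * near r B (snd x))"
    for n m and x :: "'a \<times> (real^2) \<times> (real^2)"
  have c1: "(\<lambda>x. fst (snd x)) \<in> M \<Otimes>\<^sub>M (?L \<Otimes>\<^sub>M ?L) \<rightarrow>\<^sub>M borel"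
    using measurable_compose[OF measurable_snd measurable_fst, of M ?L ?L] by simp
  have c2: "(\<lambda>x. snd (snd x)) \<in> M \<Otimes>\<^sub>M (?L \<Otimes>\<^sub>M ?L) \<rightarrow>\<^sub>M borel"
    using measurable_compose[OF measurable_snd measurable_snd, of M ?L ?L] by simp
  have nearL: "near r B \<in> borel_measurable (?L \<Otimes>\<^sub>M ?L)"
    using near_measurable[OF B, of r] by (simp cong: measurable_cong_sets sets_pair_measure_cong)
  have near2: "(\<lambda>x. near r B (snd x)) \<in> borel_measurable (M \<Otimes>\<^sub>M (?L \<Otimes>\<^sub>M ?L))"
    by (rule measurable_compose[OF measurable_snd nearL])
  have dm: "d n m \<in> borel_measurable (M \<Otimes>\<^sub>M (?L \<Otimes>\<^sub>M ?L))" for n m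
    unfolding d_def[abs_def] 
    by (cases "n = m") (auto intro!: borel_measurable_times_ennreal dens_measurable c1 c2 measurable_fst near2)
  have "palm_sum r B = (\<integral>\<^sup>+n. (\<integral>\<^sup>+m. (\<integral>\<^sup>+x. d n m x \<partial>(M \<Otimes>\<^sub>M (?L \<Otimes>\<^sub>M ?L))) \<partial>count_space UNIV) \<partial>count_space UNIV)"
    unfolding palm_sum_pairs[OF B]
  proof (intro nn_integral_cong)
    fix n m :: nat
    show "(if n = m then 0 else \<integral>\<^sup>+\<omega>. near r B (Y n \<omega>, Y m \<omega>) \<partial>M) = (\<integral>\<^sup>+x. d n m x \<partial>(M \<Otimes>\<^sub>M (?L \<Otimes>\<^sub>M ?L)))"
    proof (cases "n = m")
      case False
      have "(\<integral>\<^sup>+x. d n m x \<partial>(M \<Otimes>\<^sub>M (?L \<Otimes>\<^sub>M ?L))) = (\<integral>\<^sup>+\<omega>. (\<integral>\<^sup>+p. d n m (\<omega>, p) \<partial>(?L \<Otimes>\<^sub>M ?L)) \<partial>M)"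
        by (rule sigma_finite_measure.nn_integral_fst[OF LL dm, symmetric])
      also have "\<dots> = (\<integral>\<^sup>+\<omega>. (\<integral>\<^sup>+y. (\<integral>\<^sup>+z. d n m (\<omega>, y, z) \<partial>lborel) \<partial>lborel) \<partial>M)"
        by (intro nn_integral_cong lborel.nn_integral_fst[symmetric] measurable_compose[OF measurable_Pair1' dm])
      finally show ?thesis
        using False pair_law[OF False near_measurable[OF B], of r] by (simp add: d_def)
    qed (simp add: d_def)
  qed
  also have "\<dots> = (\<integral>\<^sup>+n. (\<integral>\<^sup>+x. (\<integral>\<^sup>+m. d n m x \<partial>count_space UNIV) \<partial>(M \<Otimes>\<^sub>M (?L \<Otimes>\<^sub>M ?L))) \<partial>count_space UNIV)"
    using dm by (intro nn_integral_cong nn_integral_count_space_nn_integral[symmetric]) auto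
  also have "\<dots> = (\<integral>\<^sup>+x. (\<integral>\<^sup>+n. (\<integral>\<^sup>+m. d n m x \<partial>count_space UNIV) \<partial>count_space UNIV) \<partial>(M \<Otimes>\<^sub>M (?L \<Otimes>\<^sub>M ?L)))"
    using dm by (intro nn_integral_count_space_nn_integral[symmetric]) (auto simp: nn_integral_count_space_nat intro!: borel_measurable_suminf_order)
  also have "\<dots> = (\<integral>\<^sup>+\<omega>. (\<integral>\<^sup>+p. (\<integral>\<^sup>+n. (\<integral>\<^sup>+m. d n m (\<omega>, p) \<partial>count_space UNIV) \<partial>count_space UNIV) \<partial>(?L \<Otimes>\<^sub>M ?L)) \<partial>M)"
    using dm by (intro sigma_finite_measure.nn_integral_fst[OF LL, symmetric])
       (auto simp: nn_integral_count_space_nat intro!: borel_measurable_suminf_order)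
  also have "\<dots> = (\<integral>\<^sup>+\<omega>. (\<integral>\<^sup>+p. pair_weight (P \<omega>) (fst p) (snd p) * near r B p \<partial>(?L \<Otimes>\<^sub>M ?L)) \<partial>M)"
  proof (rule nn_integral_cong_AE)
    from X_enumerates AE_space
    show "AE \<omega> in M. (\<integral>\<^sup>+p. (\<integral>\<^sup>+n. (\<integral>\<^sup>+m. d n m (\<omega>, p) \<partial>count_space UNIV) \<partial>count_space UNIV) \<partial>(?L \<Otimes>\<^sub>M ?L)) =
       (\<integral>\<^sup>+p. pair_weight (P \<omega>) (fst p) (snd p) * near r B p \<partial>(?L \<Otimes>\<^sub>M ?L))"
    proof eventually_elim
      case (elim \<omega>)
      then have "countable (P \<omega>)" by auto
      from AE_tie_free[OF this] have tf: "AE y in ?L. tie_free (P \<omega>) y" .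
      obtain N where N: "{y. \<not> tie_free (P \<omega>) y} \<subseteq> N" "N \<in> null_sets ?L" using tf by (auto elim: AE_E simp: null_sets_def)
      have "N \<times> UNIV \<in> null_sets (?L \<Otimes>\<^sub>M ?L)" "UNIV \<times> N \<in> null_sets (?L \<Otimes>\<^sub>M ?L)"
        using N(2) lborel.emeasure_pair_measure_Times[of N ?L UNIV] lborel.emeasure_pair_measure_Times[of UNIV ?L N]
        by (auto simp: null_sets_def)
      then have "N \<times> UNIV \<union> UNIV \<times> N \<in> null_sets (?L \<Otimes>\<^sub>M ?L)" by (rule null_sets.Un)
      \<comment> \<open>Ties are null in each coordinate and hence for the product measure.\<close>
      then have "AE p in ?L \<Otimes>\<^sub>M ?L. tie_free (P \<omega>) (fst p) \<and> tie_free (P \<omega>) (snd p)"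
        by (rule AE_I') (use N(1) in auto)
      then show ?case
      proof (intro nn_integral_cong_AE, eventually_elim)
        fix p assume p: "tie_free (P \<omega>) (fst p) \<and> tie_free (P \<omega>) (snd p)"
        have "(\<integral>\<^sup>+n. (\<integral>\<^sup>+m. d n m (\<omega>, p) \<partial>count_space UNIV) \<partial>count_space UNIV) =
          (\<integral>\<^sup>+n. (\<integral>\<^sup>+m. (if n = m then 0 else dens n \<omega> (fst p) * dens m \<omega> (snd p)) * near r B p \<partial>count_space UNIV) \<partial>count_space UNIV)"
          by (intro nn_integral_cong) (auto simp: d_def)
        also have "\<dots> = (\<integral>\<^sup>+n. (\<integral>\<^sup>+m. (if n = m then 0 else dens n \<omega> (fst p) * dens m \<omega> (snd p)) \<partial>count_space UNIV) \<partial>count_space UNIV) * near r B p"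
          by (simp add: nn_integral_multc)
        also have "\<dots> = pair_weight (P \<omega>) (fst p) (snd p) * near r B p"
          using elim p by (subst sum_dens_pairs) auto
        finally show "(\<integral>\<^sup>+n. (\<integral>\<^sup>+m. d n m (\<omega>, p) \<partial>count_space UNIV) \<partial>count_space UNIV) =
          pair_weight (P \<omega>) (fst p) (snd p) * near r B p" .
      qed
    qed
  qed
  also have "\<dots> = (\<integral>\<^sup>+p. (\<integral>\<^sup>+\<omega>. pair_weight (P \<omega>) (fst p) (snd p) * near r B p \<partial>M) \<partial>(?L \<Otimes>\<^sub>M ?L))"
  proof (rule P2.Fubini'[symmetric])
    have "(\<lambda>x. pair_weight (P (fst x)) (fst (snd x)) (snd (snd x)) * near r B (snd x)) \<in> borel_measurable (M \<Otimes>\<^sub>M (?L \<Otimes>\<^sub>M ?L))"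
      by (intro borel_measurable_times_ennreal pair_weight_measurable measurable_fst c1 c2 near2)
    then show "(\<lambda>(\<omega>, p). pair_weight (P \<omega>) (fst p) (snd p) * near r B p) \<in> borel_measurable (M \<Otimes>\<^sub>M (?L \<Otimes>\<^sub>M ?L))"
      by (simp add: split_beta')
  qed
  also have "\<dots> = (\<integral>\<^sup>+p. pair_density (snd p - fst p) * near r B p \<partial>(?L \<Otimes>\<^sub>M ?L))"
  proof (rule nn_integral_cong)
    fix p :: "(real^2) \<times> (real^2)"
    have "(\<lambda>\<omega>. pair_weight (P \<omega>) (fst p) (snd p)) \<in> borel_measurable M"
      using pair_weight_measurable[of "\<lambda>\<omega>. \<omega>" M "\<lambda>_. fst p" "\<lambda>_. snd p"] by simp
    then show "(\<integral>\<^sup>+\<omega>. pair_weight (P \<omega>) (fst p) (snd p) * near r B p \<partial>M) = pair_density (snd p - fst p) * near r B p"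
      by (simp add: nn_integral_multc expected_pair_weight)
  qed
  also have "\<dots> = (\<integral>\<^sup>+y. (\<integral>\<^sup>+z. pair_density (z - y) * near r B (y, z) \<partial>lborel) \<partial>lborel)"
  proof -
    have "(\<lambda>p. snd p - fst p) \<in> ?L \<Otimes>\<^sub>M ?L \<rightarrow>\<^sub>M borel" by measurable
    then have "(\<lambda>p. pair_density (snd p - fst p) * near r B p) \<in> borel_measurable (?L \<Otimes>\<^sub>M ?L)"
      by (intro borel_measurable_times_ennreal nearL measurable_compose[OF _ pair_density_measurable])
    from lborel.nn_integral_fst[OF this] show ?thesis by simp
  qed
  also have "\<dots> = (\<integral>\<^sup>+y. ball_mass r * indicator B y \<partial>lborel)"
  proof (rule nn_integral_cong)
    fix y :: "real^2"
    have [measurable]: "(\<lambda>w. pair_density w * indicator (cball 0 r) w) \<in> borel_measurable borel"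
      by (intro borel_measurable_times_ennreal pair_density_measurable borel_measurable_indicator) simp
    have "(\<integral>\<^sup>+z. pair_density (z - y) * near r B (y, z) \<partial>lborel) =
       (\<integral>\<^sup>+z. (pair_density ((-y) + z) * indicator (cball 0 r) ((-y) + z)) * indicator B y \<partial>lborel)"
      by (intro nn_integral_cong) (simp add: near_def mult_ac)
    also have "\<dots> = (\<integral>\<^sup>+z. pair_density ((-y) + z) * indicator (cball 0 r) ((-y) + z) \<partial>lborel) * indicator B y"
      by (rule nn_integral_multc) measurable
    also have "(\<integral>\<^sup>+z. pair_density ((-y) + z) * indicator (cball 0 r) ((-y) + z) \<partial>lborel) = ball_mass r"
      unfolding ball_mass_def by (rule nn_integral_lborel_translate) simp
    finally show "(\<integral>\<^sup>+z. pair_density (z - y) * near r B (y, z) \<partial>lborel) = ball_mass r * indicator B y" .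
  qed
  also have "\<dots> = ball_mass r * emeasure lborel B"
    by (rule nn_integral_cmult_indicator) simp
  finally show ?thesis by (simp add: mult.commute)
qed

text \<open>The area of the window cancels, so one pair of constants will serve all windows
  \<open>B\<close>.\<close>

lemma K_function_eq:
  assumes "B \<in> sets borel" "bounded B" "measure lborel B > 0"
  shows "K_function M \<Phi> lam B r = enn2real (ball_mass r) / lam"
proof -
  define b where "b = measure lborel B"
  have b: "emeasure lborel B = ennreal b" "b > 0"
    using assms emeasure_bounded_finite[OF assms(2)] by (auto simp: b_def emeasure_eq_ennreal_measure)
  have "K_function M \<Phi> lam B r = enn2real (ennreal b * ball_mass r / ennreal (lam * b))"
    using palm_sum_eq[OF assms(1), of r] unfolding K_function_Campbell palm_sum_def[symmetric] b(1)[symmetric]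
    by (simp add: b_def)
  also have "ennreal b * ball_mass r / ennreal (lam * b) = ennreal (1 / lam) * ball_mass r"
  proof -
    have "ennreal b * ball_mass r / ennreal (lam * b) = ball_mass r * (ennreal b * inverse (ennreal (lam * b)))"
      by (simp add: divide_ennreal_def mult_ac)
    also have "ennreal b * inverse (ennreal (lam * b)) = ennreal (1 / lam)"
      using b lam by (simp add: inverse_ennreal ennreal_mult[symmetric] field_simps)
    finally show ?thesis by (simp add: mult.commute)
  qed
  also have "enn2real \<dots> = enn2real (ball_mass r) / lam"
    using lam by (simp add: enn2real_mult)
  finally show ?thesis .
qed

end

section \<open>Upper bound and continuity of the pair density\<close>

text \<open>The weight \<open>s\<close> shifts cost between the two factors: \<open>s = 1\<close>
  suffices for the upper bound, while continuity needs a weight that depends on the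
  distance.\<close>

lemma ennreal_mult_le_sum_squares:
  fixes a b :: ennreal
  assumes "s > 0"
  shows "a * b \<le> ennreal (s\<^sup>2) * a\<^sup>2 + ennreal (inverse (s\<^sup>2)) * b\<^sup>2"
proof -
  have sq: "x * y \<le> x\<^sup>2 + y\<^sup>2" for x y :: ennreal
  proof (cases "x \<le> y")
    case True
    then have "x * y \<le> y\<^sup>2" by (simp add: power2_eq_square mult_right_mono)
    then show ?thesis by (simp add: add_increasing)
  next
    case False
    then have "x * y \<le> x\<^sup>2" by (simp add: power2_eq_square mult_left_mono)
    then show ?thesis by (simp add: add_increasing2)
  qed
  have "ennreal s * ennreal (inverse s) = 1" using assms by (simp add: ennreal_mult[symmetric])
  then have "a * b = (ennreal s * a) * (ennreal (inverse s) * b)"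
    by (metis (no_types, lifting) mult.assoc mult.commute mult.left_neutral)
  also have "\<dots> \<le> (ennreal s * a)\<^sup>2 + (ennreal (inverse s) * b)\<^sup>2" by (rule sq)
  also have "\<dots> = ennreal (s\<^sup>2) * a\<^sup>2 + ennreal (inverse (s\<^sup>2)) * b\<^sup>2"
    using assms by (simp add: power_mult_distrib ennreal_power power_inverse)
  finally show ?thesis .
qed

lemma nn_integral_lborel_scale:
  fixes f :: "real^2 \<Rightarrow> ennreal"
  assumes [measurable]: "f \<in> borel_measurable borel" and c: "c > 0"
  shows "(\<integral>\<^sup>+x. f x \<partial>lborel) = ennreal (c\<^sup>2) * (\<integral>\<^sup>+x. f (c *\<^sub>R x) \<partial>lborel)"
proof -
  have "(\<integral>\<^sup>+x. f x \<partial>lborel) = (\<integral>\<^sup>+x. f x \<partial>density (distr lborel borel (\<lambda>x. 0 + c *\<^sub>R x)) (\<lambda>_. ennreal (\<bar>c\<bar> ^ DIM(real^2))))"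
    using lborel_affine[of c "0 :: real^2"] c by simp
  also have "\<dots> = ennreal (c\<^sup>2) * (\<integral>\<^sup>+x. f (c *\<^sub>R x) \<partial>lborel)"
    using c by (simp add: nn_integral_density nn_integral_distr nn_integral_cmult)
  finally show ?thesis .
qed

lemma AE_tie_free_translates:
  assumes "countable S"
  shows "AE y in lborel. tie_free S (y + z)"
proof -
  from AE_tie_free[OF assms] obtain N where N: "{y. \<not> tie_free S y} \<subseteq> N" "N \<in> null_sets lborel"
    by (auto elim: AE_E simp: null_sets_def)
  have "(+) (-z) ` N \<in> null_sets lborel"
  proof -
    have Nb: "N \<in> sets borel" using N by auto
    have "(+) (-z) ` N = (\<lambda>x. x + z) -` N \<inter> space borel"
      by (auto simp: image_iff) (metis add_diff_cancel)
    then have "(+) (-z) ` N \<in> sets borel" using measurable_sets[of "\<lambda>x. x + z" borel borel N] Nb by simp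
    then show ?thesis using N emeasure_lborel_translate[OF Nb, of "-z"] by (auto simp: null_sets_def)
  qed
  then show ?thesis
  proof (rule AE_I')
    show "{y \<in> space lborel. \<not> tie_free S (y + z)} \<subseteq> (+) (-z) ` N"
    proof
      fix y assume "y \<in> {y \<in> space lborel. \<not> tie_free S (y + z)}"
      then have "y + z \<in> N" using N by auto
      then show "y \<in> (+) (-z) ` N" by (intro image_eqI[of _ _ "y + z"]) simp_all
    qed
  qed
qed

text \<open>Here \<open>pi\<close> is the area of the unit disk over which points are
  averaged.\<close>

lemma cancel_pi: "a * ennreal pi \<le> ennreal (pi * b) \<Longrightarrow> 0 \<le> b \<Longrightarrow> a \<le> ennreal b"
  by (cases a) (auto simp: ennreal_mult[symmetric] ennreal_mult_top top_unique mult.commute[of _ pi])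

section \<open>Averaged second moments\<close>

context poisson
begin

definition cut_moment :: "real^2 \<Rightarrow> ennreal" where
  "cut_moment z = (\<integral>\<^sup>+\<omega>. (if same_cell (P \<omega>) 0 z then 0 else (inv_area (P \<omega>) 0)\<^sup>2) \<partial>M)"

definition second_moment :: ennreal where
  "second_moment = (\<integral>\<^sup>+\<omega>. (inv_area (P \<omega>) 0)\<^sup>2 \<partial>M)"

lemma expected_cut_moment:
  "(\<integral>\<^sup>+\<omega>. (if same_cell (P \<omega>) y z then 0 else (inv_area (P \<omega>) y)\<^sup>2) \<partial>M) = cut_moment (z - y)"
proof -
  have "(\<lambda>(b, a, c). (if b then 0 else a\<^sup>2) :: ennreal) \<in> borel_measurable (count_space UNIV \<Otimes>\<^sub>M borel \<Otimes>\<^sub>M borel)"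
    by measurable
  from stationary[OF this, of y 0 "z - y"] show ?thesis
    unfolding cut_moment_def by (simp cong: if_cong)
qed

lemma expected_second_moment: "(\<integral>\<^sup>+\<omega>. (inv_area (P \<omega>) y)\<^sup>2 \<partial>M) = second_moment"
proof -
  have "(\<lambda>(b :: bool, a, c :: ennreal). a\<^sup>2 :: ennreal) \<in> borel_measurable (count_space UNIV \<Otimes>\<^sub>M borel \<Otimes>\<^sub>M borel)"
    by measurable
  from stationary[OF this, of y 0] show ?thesis
    unfolding second_moment_def by simp
qed

lemma cut_weight_measurable:
  assumes "F \<in> N \<rightarrow>\<^sub>M M" "Y \<in> N \<rightarrow>\<^sub>M borel" "W \<in> N \<rightarrow>\<^sub>M borel"
  shows "(\<lambda>x. (if same_cell (P (F x)) (Y x) (W x) then 0 else (inv_area (P (F x)) (Y x))\<^sup>2)) \<in> borel_measurable N"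
proof -
  have m: "{x \<in> space N. same_cell (P (F x)) (Y x) (W x)} \<in> sets N"
    using same_cell_measurable[OF assms] by (simp add: pred_def)
  show ?thesis
    by (intro measurable_If[OF _ _ m] measurable_const borel_measurable_power_ennreal inv_area_measurable assms) simp
qed

text \<open>Passes from a fixed point, where stationarity makes the expectation constant, to a
  spatial integral inside each realization, where the geometry of the cells can be used.\<close>

lemma average:
  assumes f: "(\<lambda>x. f (fst x) (snd x)) \<in> borel_measurable (M \<Otimes>\<^sub>M lborel)"
    and c: "\<And>y. (\<integral>\<^sup>+\<omega>. f \<omega> y \<partial>M) = c" and B: "(B :: (real^2) set) \<in> sets borel"
  shows "(\<integral>\<^sup>+\<omega>. (\<integral>\<^sup>+y. f \<omega> y * indicator B y \<partial>lborel) \<partial>M) = c * emeasure lborel B"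
proof -
  interpret P2: pair_sigma_finite M lborel
    by (rule pair_sigma_finite.intro[OF sigma_finite_measure_axioms lborel.sigma_finite_measure_axioms])
  have "(\<lambda>x. indicator B (snd x) :: ennreal) \<in> borel_measurable (M \<Otimes>\<^sub>M lborel)"
    using B by (intro measurable_compose[OF measurable_snd borel_measurable_indicator]) simp
  with f have "(\<lambda>x. f (fst x) (snd x) * indicator B (snd x)) \<in> borel_measurable (M \<Otimes>\<^sub>M lborel)"
    by (rule borel_measurable_times_ennreal)
  then have "(\<integral>\<^sup>+\<omega>. (\<integral>\<^sup>+y. f \<omega> y * indicator B y \<partial>lborel) \<partial>M) = (\<integral>\<^sup>+y. (\<integral>\<^sup>+\<omega>. f \<omega> y * indicator B y \<partial>M) \<partial>lborel)"
    by (intro P2.Fubini'[symmetric]) (simp add: split_beta')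
  also have "\<dots> = (\<integral>\<^sup>+y. c * indicator B y \<partial>lborel)"
  proof (rule nn_integral_cong)
    fix y :: "real^2"
    have "(\<lambda>\<omega>. f \<omega> y) \<in> borel_measurable M"
      using measurable_compose[OF measurable_Pair2'[of y lborel] f] by simp
    then show "(\<integral>\<^sup>+\<omega>. f \<omega> y * indicator B y \<partial>M) = c * indicator B y"
      by (simp add: nn_integral_multc c)
  qed
  also have "\<dots> = c * emeasure lborel B"
    using B by (intro nn_integral_cmult_indicator) simp
  finally show ?thesis .
qed

end

section \<open>Linear upper bound and modulus of continuity\<close>

context enumerated_poisson
begin

text \<open>Take \<open>C = False\<close> for the plain second moment of the inverse cell area.\<close>

lemma cut_integral_le:
  assumes u: "norm u \<le> 1"
    and bound: "\<And>n. emeasure lborel {y \<in> cball 0 1. y \<in> cell n \<omega> \<and> \<not> (C \<and> y + u \<in> cell n \<omega>)} \<le> c"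
    and *: "inj (\<lambda>n. X n \<omega>)" "P \<omega> = range (\<lambda>n. X n \<omega>)" and \<omega>: "\<omega> \<in> space M"
  shows "(\<integral>\<^sup>+y. (if C \<and> same_cell (P \<omega>) y (y + u) then 0 else (inv_area (P \<omega>) y)\<^sup>2) * indicator (cball 0 1) y \<partial>lborel)
    \<le> c * (\<integral>\<^sup>+n. indicator {n. cell n \<omega> \<inter> cball 0 1 \<noteq> {}} n * (inverse (emeasure lborel (cell n \<omega>)))\<^sup>2 \<partial>count_space UNIV)"
proof -
  define A where "A n = {y \<in> cball 0 1. y \<in> cell n \<omega> \<and> \<not> (C \<and> y + u \<in> cell n \<omega>)}" for n
  have Ab: "A n \<in> sets lborel" for n
  proof -
    note [measurable] = cell_borel'[of n \<omega>]
    have "A n \<in> sets borel" unfolding A_def by measurable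
    then show ?thesis by simp
  qed
  have "countable (P \<omega>)" by (simp add: *(2))
  from AE_tie_free[OF this]
  have "AE y in lborel. (if C \<and> same_cell (P \<omega>) y (y + u) then 0 else (inv_area (P \<omega>) y)\<^sup>2) * indicator (cball 0 1) y
     = (\<integral>\<^sup>+n. (inverse (area n \<omega>))\<^sup>2 * indicator (A n) y \<partial>count_space UNIV)"
  proof eventually_elim
    case (elim y)
    obtain n where n: "y \<in> cell n \<omega>" "\<And>k. dens k \<omega> y = indicator {n} k * inverse (area n \<omega>)"
      "inv_area (P \<omega>) y = inverse (area n \<omega>)" "{w. same_cell (P \<omega>) y w} = cell n \<omega>"
      "\<And>k. y \<in> cell k \<omega> \<Longrightarrow> k = n"
      using dens_tie_free[OF * \<omega> elim] by metis
    have same: "same_cell (P \<omega>) y w \<longleftrightarrow> w \<in> cell n \<omega>" for w using n(4) by auto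
    have "(\<integral>\<^sup>+k. (inverse (area k \<omega>))\<^sup>2 * indicator (A k) y \<partial>count_space UNIV) =
      (\<integral>\<^sup>+k. (inverse (area n \<omega>))\<^sup>2 * indicator (A n) y * indicator {n} k \<partial>count_space UNIV)"
    proof (rule nn_integral_cong)
      fix k
      show "(inverse (area k \<omega>))\<^sup>2 * indicator (A k) y = (inverse (area n \<omega>))\<^sup>2 * indicator (A n) y * indicator {n} k"
      proof (cases "k = n")
        case False
        then have "y \<notin> A k" using n(5)[of k] by (auto simp: A_def)
        with False show ?thesis by simp
      qed simp
    qed
    also have "\<dots> = (inverse (area n \<omega>))\<^sup>2 * indicator (A n) y"
      by (simp add: nn_integral_cmult_indicator)
    finally show ?case using n(1) by (simp add: same n(3) A_def indicator_def)
  qed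
  then have "(\<integral>\<^sup>+y. (if C \<and> same_cell (P \<omega>) y (y + u) then 0 else (inv_area (P \<omega>) y)\<^sup>2) * indicator (cball 0 1) y \<partial>lborel) =
    (\<integral>\<^sup>+y. (\<integral>\<^sup>+n. (inverse (area n \<omega>))\<^sup>2 * indicator (A n) y \<partial>count_space UNIV) \<partial>lborel)"
    by (rule nn_integral_cong_AE)
  also have "\<dots> = (\<integral>\<^sup>+n. (\<integral>\<^sup>+y. (inverse (area n \<omega>))\<^sup>2 * indicator (A n) y \<partial>lborel) \<partial>count_space UNIV)"
    using Ab by (intro nn_integral_count_space_nn_integral) auto
  also have "\<dots> = (\<integral>\<^sup>+n. (inverse (area n \<omega>))\<^sup>2 * emeasure lborel (A n) \<partial>count_space UNIV)"
    by (intro nn_integral_cong nn_integral_cmult_indicator Ab)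
  also have "\<dots> \<le> (\<integral>\<^sup>+n. c * (indicator {n. cell n \<omega> \<inter> cball 0 1 \<noteq> {}} n * (inverse (emeasure lborel (cell n \<omega>)))\<^sup>2) \<partial>count_space UNIV)"
  proof (rule nn_integral_mono)
    fix n
    show "(inverse (area n \<omega>))\<^sup>2 * emeasure lborel (A n) \<le> c * (indicator {n. cell n \<omega> \<inter> cball 0 1 \<noteq> {}} n * (inverse (emeasure lborel (cell n \<omega>)))\<^sup>2)"
    proof (cases "cell n \<omega> \<inter> cball 0 1 = {}")
      case True
      then have "A n = {}" by (auto simp: A_def)
      then show ?thesis by simp
    next
      case False
      then show ?thesis
        using mult_right_mono[OF bound[of n], of "(inverse (area n \<omega>))\<^sup>2"] by (simp add: A_def area_def mult.commute)
    qed
  qed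
  also have "\<dots> = c * (\<integral>\<^sup>+n. indicator {n. cell n \<omega> \<inter> cball 0 1 \<noteq> {}} n * (inverse (emeasure lborel (cell n \<omega>)))\<^sup>2 \<partial>count_space UNIV)"
    by (rule nn_integral_cmult) simp
  finally show ?thesis .
qed

definition moment :: real where
  "moment = enn2real (\<integral>\<^sup>+\<omega>. area_bound \<omega> \<partial>M)"

lemma moment: "(\<integral>\<^sup>+\<omega>. area_bound \<omega> \<partial>M) = ennreal moment" "0 \<le> moment"
  using expected_area_bound by (auto simp: moment_def)

lemma averaged_cut_le:
  assumes u: "norm u \<le> 1" and c: "0 \<le> c"
    and bound: "\<And>n \<omega>. emeasure lborel {y \<in> cball 0 1. y \<in> cell n \<omega> \<and> \<not> (C \<and> y + u \<in> cell n \<omega>)} \<le> ennreal c"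
  shows "(\<integral>\<^sup>+\<omega>. (\<integral>\<^sup>+y. (if C \<and> same_cell (P \<omega>) y (y + u) then 0 else (inv_area (P \<omega>) y)\<^sup>2) * indicator (cball 0 1) y \<partial>lborel) \<partial>M)
    \<le> ennreal (c * moment)"
proof -
  have "(\<integral>\<^sup>+\<omega>. (\<integral>\<^sup>+y. (if C \<and> same_cell (P \<omega>) y (y + u) then 0 else (inv_area (P \<omega>) y)\<^sup>2) * indicator (cball 0 1) y \<partial>lborel) \<partial>M)
    \<le> (\<integral>\<^sup>+\<omega>. ennreal c * area_bound \<omega> \<partial>M)"
  proof (rule nn_integral_mono_AE)
    from X_enumerates AE_space sum_inverse_area_le
    show "AE \<omega> in M. (\<integral>\<^sup>+y. (if C \<and> same_cell (P \<omega>) y (y + u) then 0 else (inv_area (P \<omega>) y)\<^sup>2) * indicator (cball 0 1) y \<partial>lborel)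
       \<le> ennreal c * area_bound \<omega>"
    proof eventually_elim
      case (elim \<omega>)
      then have *: "inj (\<lambda>n. X n \<omega>)" "P \<omega> = range (\<lambda>n. X n \<omega>)" "\<omega> \<in> space M" by auto
      show ?case
        by (rule order_trans[OF cut_integral_le[OF u bound *] mult_left_mono[OF elim(3)]]) simp
    qed
  qed
  also have "\<dots> = ennreal c * ennreal moment"
    by (subst nn_integral_cmult[OF area_bound_measurable]) (simp add: moment)
  finally show ?thesis using c moment(2) by (simp add: ennreal_mult)
qed

lemma second_moment_le: "second_moment \<le> ennreal moment"
proof (rule cancel_pi)
  have "(\<lambda>x. (inv_area (P (fst x)) (snd x))\<^sup>2) \<in> borel_measurable (M \<Otimes>\<^sub>M lborel)"
    by (intro borel_measurable_power_ennreal inv_area_measurable) auto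
  from average[OF this expected_second_moment, of "cball 0 1"]
  have "second_moment * ennreal pi = (\<integral>\<^sup>+\<omega>. (\<integral>\<^sup>+y. (inv_area (P \<omega>) y)\<^sup>2 * indicator (cball 0 1) y \<partial>lborel) \<partial>M)"
    by (simp add: emeasure_cball_R2)
  also have "\<dots> \<le> ennreal (pi * moment)"
  proof -
    have "emeasure lborel {y \<in> cball 0 1. y \<in> cell n \<omega> \<and> \<not> (False \<and> y + 0 \<in> cell n \<omega>)} \<le> ennreal pi" for n \<omega>
    proof -
      have "emeasure lborel {y \<in> cball 0 1. y \<in> cell n \<omega> \<and> \<not> (False \<and> y + 0 \<in> cell n \<omega>)} \<le> emeasure lborel (cball (0::real^2) 1)"
        by (intro emeasure_mono) auto
      then show ?thesis by (simp add: emeasure_cball_R2)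
    qed
    from averaged_cut_le[OF _ _ this] show ?thesis by simp
  qed
  finally show "second_moment * ennreal pi \<le> ennreal (pi * moment)" .
qed (rule moment)

text \<open>The shift bound is the same for every cell, so it factors out of the sum; the area of
  the averaging disk cancels its \<open>pi\<close>.\<close>

lemma cut_moment_le:
  assumes u: "norm u \<le> 1"
  shows "cut_moment u \<le> ennreal (9 * norm u * moment)"
proof (rule cancel_pi)
  have add: "(\<lambda>x. snd x + u) \<in> M \<Otimes>\<^sub>M lborel \<rightarrow>\<^sub>M borel" by measurable
  have m: "(\<lambda>x. (if same_cell (P (fst x)) (snd x) (snd x + u) then 0 else (inv_area (P (fst x)) (snd x))\<^sup>2)) \<in> borel_measurable (M \<Otimes>\<^sub>M lborel)"
    by (rule cut_weight_measurable[OF measurable_fst _ add]) simp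
  have "(\<integral>\<^sup>+\<omega>. (if same_cell (P \<omega>) y (y + u) then 0 else (inv_area (P \<omega>) y)\<^sup>2) \<partial>M) = cut_moment u" for y
    using expected_cut_moment[of y "y + u"] by simp
  from average[OF m this, of "cball 0 1"]
  have "cut_moment u * ennreal pi = (\<integral>\<^sup>+\<omega>. (\<integral>\<^sup>+y. (if same_cell (P \<omega>) y (y + u) then 0 else (inv_area (P \<omega>) y)\<^sup>2) * indicator (cball 0 1) y \<partial>lborel) \<partial>M)"
    by (simp add: emeasure_cball_R2)
  also have "\<dots> \<le> ennreal ((9 * pi * norm u) * moment)"
  proof -
    have "emeasure lborel {y \<in> cball 0 1. y \<in> cell n \<omega> \<and> \<not> (True \<and> y + u \<in> cell n \<omega>)} \<le> ennreal (9 * pi * norm u)" for n \<omega>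
      using convex_shift_boundary[OF convex_voronoi_cell voronoi_cell_borel u] by (simp add: cell_def)
    from averaged_cut_le[OF u _ this] show ?thesis by simp
  qed
  finally show "cut_moment u * ennreal pi \<le> ennreal (pi * (9 * norm u * moment))" by (simp add: mult_ac)
qed (simp add: moment)

text \<open>Seen from \<open>z\<close>, the second square is a cut moment for the shift
  \<open>- z\<close>; the 18 is twice the 9 of \<open>cut_moment_le\<close>.\<close>

lemma pair_density_le:
  assumes "norm z \<le> 1"
  shows "pair_density z \<le> ennreal (18 * norm z * moment)"
proof -
  have "pair_density z \<le> (\<integral>\<^sup>+\<omega>. (if same_cell (P \<omega>) 0 z then 0 else (inv_area (P \<omega>) 0)\<^sup>2) +
      (if same_cell (P \<omega>) z 0 then 0 else (inv_area (P \<omega>) z)\<^sup>2) \<partial>M)"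
    unfolding pair_density_def
  proof (rule nn_integral_mono)
    fix \<omega>
    show "pair_weight (P \<omega>) 0 z \<le> (if same_cell (P \<omega>) 0 z then 0 else (inv_area (P \<omega>) 0)\<^sup>2) +
      (if same_cell (P \<omega>) z 0 then 0 else (inv_area (P \<omega>) z)\<^sup>2)"
      using ennreal_mult_le_sum_squares[of 1 "inv_area (P \<omega>) 0" "inv_area (P \<omega>) z"]
      by (simp add: pair_weight_def same_cell_commute[of _ z])
  qed
  also have "\<dots> = cut_moment z + cut_moment (- z)"
    using expected_cut_moment[of 0 z] expected_cut_moment[of z 0]
      cut_weight_measurable[of "\<lambda>\<omega>. \<omega>" M "\<lambda>_. 0" "\<lambda>_. z"] cut_weight_measurable[of "\<lambda>\<omega>. \<omega>" M "\<lambda>_. z" "\<lambda>_. 0"]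
    by (subst nn_integral_add) auto
  also have "\<dots> \<le> ennreal (9 * norm z * moment) + ennreal (9 * norm z * moment)"
    using cut_moment_le[of z] cut_moment_le[of "-z"] assms by (intro add_mono) auto
  also have "\<dots> = ennreal (18 * norm z * moment)"
    using moment(2) by (subst ennreal_plus[symmetric]) auto
  finally show ?thesis .
qed

text \<open>Off ties the weight sees its second argument only through the cell that contains
  it.\<close>

lemma same_cell_pair_weight:
  assumes *: "inj (\<lambda>n. X n \<omega>)" "P \<omega> = range (\<lambda>n. X n \<omega>)" and \<omega>: "\<omega> \<in> space M"
    and tf: "tie_free (P \<omega>) a" "tie_free (P \<omega>) b" and same: "same_cell (P \<omega>) a b"
  shows "pair_weight (P \<omega>) y a = pair_weight (P \<omega>) y b"
proof -
  obtain x where x: "x \<in> P \<omega>" "a \<in> voronoi_cell (P \<omega>) x" "b \<in> voronoi_cell (P \<omega>) x"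
    using same by (auto simp: same_cell_def)
  have "{w. same_cell (P \<omega>) a w} = {w. same_cell (P \<omega>) b w}"
    using same_cell_eq_voronoi[OF tf(1) x(1,2)] same_cell_eq_voronoi[OF tf(2) x(1,3)] by simp
  then have "same_cell (P \<omega>) a w \<longleftrightarrow> same_cell (P \<omega>) b w" for w by blast
  then show ?thesis
    by (simp add: pair_weight_def same_cell_commute[of _ y] inv_area_def)
qed

text \<open>Replacing \<open>z\<close> by \<open>z'\<close> changes the weight only where
  \<open>y + z\<close> and \<open>y + z'\<close> lie in different cells. There the smallness belongs
  to the square at \<open>y + z\<close>, while the square at \<open>y\<close> is merely bounded;
  \<open>s\<close> trades the two off.\<close>

lemma pair_density_continuity:
  assumes z: "norm (z' - z) \<le> 1" and s: "s > 0"
  shows "pair_density z \<le> pair_density z' + ennreal ((s\<^sup>2 + inverse (s\<^sup>2) * (9 * norm (z' - z))) * moment)"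
proof -
  define cutw where "cutw \<omega> y = (if same_cell (P \<omega>) (y + z) (y + z') then 0 else (inv_area (P \<omega>) (y + z))\<^sup>2)" for \<omega> y
  define rest where "rest \<omega> y = ennreal (s\<^sup>2) * (inv_area (P \<omega>) y)\<^sup>2 + ennreal (inverse (s\<^sup>2)) * cutw \<omega> y" for \<omega> y
  have add: "(\<lambda>x. snd x + v) \<in> M \<Otimes>\<^sub>M lborel \<rightarrow>\<^sub>M borel" for v :: "real^2" by measurable
  have snd: "snd \<in> M \<Otimes>\<^sub>M lborel \<rightarrow>\<^sub>M (borel :: (real^2) measure)" by simp
  have pw: "(\<lambda>x. pair_weight (P (fst x)) (snd x) (snd x + v)) \<in> borel_measurable (M \<Otimes>\<^sub>M lborel)" for v
    by (rule pair_weight_measurable[OF measurable_fst snd add])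
  have iv: "(\<lambda>x. (inv_area (P (fst x)) (snd x))\<^sup>2) \<in> borel_measurable (M \<Otimes>\<^sub>M lborel)"
    by (intro borel_measurable_power_ennreal inv_area_measurable measurable_fst snd)
  have cw: "(\<lambda>x. cutw (fst x) (snd x)) \<in> borel_measurable (M \<Otimes>\<^sub>M lborel)"
    unfolding cutw_def by (rule cut_weight_measurable[OF measurable_fst add add])
  have rw: "(\<lambda>x. rest (fst x) (snd x)) \<in> borel_measurable (M \<Otimes>\<^sub>M lborel)"
    unfolding rest_def by (intro borel_measurable_add borel_measurable_times_ennreal iv cw measurable_const) auto
  have e1: "(\<integral>\<^sup>+\<omega>. pair_weight (P \<omega>) y (y + v) \<partial>M) = pair_density v" for y v
    using expected_pair_weight[of y "y + v"] by simp
  define R where "R = ennreal (s\<^sup>2) * second_moment + ennreal (inverse (s\<^sup>2)) * cut_moment (z' - z)"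
  have e2: "(\<integral>\<^sup>+\<omega>. pair_weight (P \<omega>) y (y + z') + rest \<omega> y \<partial>M) = pair_density z' + R" for y
  proof -
    have 1: "(\<lambda>\<omega>. pair_weight (P \<omega>) y (y + z')) \<in> borel_measurable M"
      using measurable_compose[OF measurable_Pair2'[of y lborel] pw] by simp
    have 2: "(\<lambda>\<omega>. (inv_area (P \<omega>) y)\<^sup>2) \<in> borel_measurable M"
      using measurable_compose[OF measurable_Pair2'[of y lborel] iv] by simp
    have 3: "(\<lambda>\<omega>. cutw \<omega> y) \<in> borel_measurable M"
      using measurable_compose[OF measurable_Pair2'[of y lborel] cw] by simp
    have "(\<integral>\<^sup>+\<omega>. cutw \<omega> y \<partial>M) = cut_moment (z' - z)"
      unfolding cutw_def expected_cut_moment by simp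
    then show ?thesis
      unfolding rest_def R_def using 1 2 3
      by (simp add: nn_integral_add nn_integral_cmult e1 expected_second_moment)
  qed
  have "pair_density z * ennreal pi = (\<integral>\<^sup>+\<omega>. (\<integral>\<^sup>+y. pair_weight (P \<omega>) y (y + z) * indicator (cball 0 1) y \<partial>lborel) \<partial>M)"
    using average[OF pw[of z] e1, of "cball 0 1"] by (simp add: emeasure_cball_R2)
  also have "\<dots> \<le> (\<integral>\<^sup>+\<omega>. (\<integral>\<^sup>+y. (pair_weight (P \<omega>) y (y + z') + rest \<omega> y) * indicator (cball 0 1) y \<partial>lborel) \<partial>M)"
  proof (rule nn_integral_mono_AE)
    from X_enumerates AE_space
    show "AE \<omega> in M. (\<integral>\<^sup>+y. pair_weight (P \<omega>) y (y + z) * indicator (cball 0 1) y \<partial>lborel) \<le>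
        (\<integral>\<^sup>+y. (pair_weight (P \<omega>) y (y + z') + rest \<omega> y) * indicator (cball 0 1) y \<partial>lborel)"
    proof eventually_elim
      case (elim \<omega>)
      then have *: "inj (\<lambda>n. X n \<omega>)" "P \<omega> = range (\<lambda>n. X n \<omega>)" "\<omega> \<in> space M" by auto
      have c: "countable (P \<omega>)" by (simp add: *(2))
      from AE_tie_free_translates[OF c, of z] AE_tie_free_translates[OF c, of z']
      have "AE y in lborel. pair_weight (P \<omega>) y (y + z) \<le> pair_weight (P \<omega>) y (y + z') + rest \<omega> y"
      proof eventually_elim
        case (elim y)
        show ?case
        proof (cases "same_cell (P \<omega>) (y + z) (y + z')")
          case True
          then show ?thesis using same_cell_pair_weight[OF * elim True, of y] by simp
        next
          case False
          have "pair_weight (P \<omega>) y (y + z) \<le> inv_area (P \<omega>) y * inv_area (P \<omega>) (y + z)"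
            by (simp add: pair_weight_def)
          also have "\<dots> \<le> rest \<omega> y"
            unfolding rest_def cutw_def using False ennreal_mult_le_sum_squares[OF s] by simp
          finally show ?thesis by (simp add: add_increasing)
        qed
      qed
      then have "AE y in lborel. pair_weight (P \<omega>) y (y + z) * indicator (cball 0 1) y \<le>
          (pair_weight (P \<omega>) y (y + z') + rest \<omega> y) * indicator (cball 0 1) y"
        by eventually_elim (rule mult_right_mono, simp_all)
      then show ?case by (rule nn_integral_mono_AE)
    qed
  qed
  also have "\<dots> = (pair_density z' + R) * ennreal pi"
    using average[OF borel_measurable_add[OF pw[of z'] rw] e2, of "cball 0 1"] by (simp add: emeasure_cball_R2)
  finally have "pair_density z \<le> pair_density z' + R"
    using ennreal_mult_le_mult_iff[of "ennreal pi"] by (simp add: mult.commute)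
  also have "R \<le> ennreal (s\<^sup>2) * ennreal moment + ennreal (inverse (s\<^sup>2)) * ennreal (9 * norm (z' - z) * moment)"
    unfolding R_def by (intro add_mono mult_left_mono second_moment_le cut_moment_le z) auto
  also have "\<dots> = ennreal ((s\<^sup>2 + inverse (s\<^sup>2) * (9 * norm (z' - z))) * moment)"
    using moment(2) by (simp add: ennreal_mult[symmetric] ennreal_plus[symmetric] algebra_simps del: ennreal_plus)
  finally show ?thesis by (simp add: add_left_mono)
qed

end

section \<open>Lower bound and differentiation of the K-function\<close>

lemma cball_cover:
  obtains C :: "(real^2) set" where "finite C" "cball 0 10 \<subseteq> (\<Union>c\<in>C. ball c 1)"
proof -
  have "compact (cball (0::real^2) 10)" by simp
  from compactE_image[OF this, of "cball 0 10" "\<lambda>c. ball c 1"] show ?thesis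
    using that by (metis (no_types, lifting) UN_I centre_in_ball open_ball subsetI zero_less_one)
qed

context poisson
begin

text \<open>This is the density hypothesis of \<open>voronoi_cell_small\<close>, as a condition on
  the outcome.\<close>

definition filled :: "real \<Rightarrow> 'w \<Rightarrow> bool" where
  "filled l \<omega> \<longleftrightarrow> (\<forall>w\<in>cball 0 (10 * l). \<exists>p\<in>P \<omega>. dist w p < 2 * l)"

text \<open>A union bound suffices: the number of balls needed does not depend on the scale \<open>l\<close>,
  while the probability that a given one is empty decays in \<open>l\<close>.\<close>

lemma filled_event:
  obtains l E where "1 \<le> l" "E \<in> sets M" "0 < emeasure M E" "\<And>\<omega>. \<omega> \<in> E \<Longrightarrow> filled l \<omega>"
proof -
  obtain C :: "(real^2) set" where C: "finite C" "cball 0 10 \<subseteq> (\<Union>c\<in>C. ball c 1)" by (rule cball_cover)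
  \<comment> \<open>Chosen so that \<open>card C < 1 + lam * pi * l\<^sup>2\<close>, which is at
    most the exponential; the union bound then stays below 1.\<close>
  define l where "l = 1 + real (card C) / (lam * pi)"
  have l: "1 \<le> l" using lam by (simp add: l_def)
  define D where "D c = {\<omega> \<in> space M. P \<omega> \<inter> ball (l *\<^sub>R c) l = {}}" for c
  have D: "D c \<in> sets M" for c unfolding D_def by (rule empty_measurable) auto
  have pD: "prob (D c) = exp (- (lam * (pi * l\<^sup>2)))" for c
    unfolding D_def using l by (subst empty_prob) (auto simp: content_ball unit_ball_vol_2)
  define E where "E = space M - (\<Union>c\<in>C. D c)"
  have UD: "(\<Union>c\<in>C. D c) \<in> sets M" using D C(1) by auto
  then have E: "E \<in> sets M" by (auto simp: E_def)
  have "prob (\<Union>c\<in>C. D c) \<le> (\<Sum>c\<in>C. prob (D c))"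
    using C(1) D by (intro finite_measure_subadditive_finite) auto
  also have "\<dots> = real (card C) * exp (- (lam * (pi * l\<^sup>2)))" by (simp add: pD)
  also have "\<dots> < 1"
  proof -
    have "real (card C) = (lam * pi) * (l - 1)" using lam by (simp add: l_def)
    also have "\<dots> < 1 + (lam * pi) * l" using lam by (simp add: algebra_simps add_pos_pos)
    also have "\<dots> \<le> 1 + (lam * pi) * l\<^sup>2"
      using l lam by (intro add_left_mono mult_left_mono) (auto simp: power2_eq_square)
    also have "\<dots> \<le> exp (lam * (pi * l\<^sup>2))" using exp_ge_add_one_self[of "lam * (pi * l\<^sup>2)"] by (simp add: mult.assoc)
    finally show ?thesis by (simp add: exp_minus field_simps)
  qed
  finally have "prob E > 0" using UD by (simp add: E_def prob_compl)
  moreover have "filled l \<omega>" if "\<omega> \<in> E" for \<omega>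
    unfolding filled_def
  proof
    fix w :: "real^2" assume w: "w \<in> cball 0 (10 * l)"
    then have "(1 / l) *\<^sub>R w \<in> cball 0 10" using l by (simp add: field_simps)
    then obtain c where c: "c \<in> C" "(1 / l) *\<^sub>R w \<in> ball c 1" using C(2) by blast
    have "P \<omega> \<inter> ball (l *\<^sub>R c) l \<noteq> {}" using \<open>\<omega> \<in> E\<close> c(1) unfolding E_def D_def by blast
    then obtain p where p: "p \<in> P \<omega>" "p \<in> ball (l *\<^sub>R c) l" by blast
    have "dist w (l *\<^sub>R c) = l * dist ((1 / l) *\<^sub>R w) c"
    proof -
      have "w - l *\<^sub>R c = l *\<^sub>R ((1 / l) *\<^sub>R w - c)" using l by (simp add: algebra_simps)
      then show ?thesis using l by (simp add: dist_norm)
    qed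
    also have "\<dots> < l * 1" using c(2) l by (intro mult_strict_left_mono) (auto simp: dist_commute)
    finally have "dist w p < 2 * l" using p(2) dist_triangle[of w p "l *\<^sub>R c"] by simp
    then show "\<exists>p\<in>P \<omega>. dist w p < 2 * l" using p(1) by blast
  qed
  ultimately show ?thesis using that[of l E] l E by (simp add: emeasure_eq_measure)
qed

end

context user_process
begin

text \<open>The cell \<open>V\<close> of the origin alone suffices. Points that leave it under the
  shift fill at least \<open>1 / k\<close> of its area, and each carries the inverse area of
  \<open>V\<close> times the inverse area of another cell, which is at most
  \<open>4 * pi * l\<^sup>2\<close> large; so the area of \<open>V\<close> cancels. All of
  \<open>V\<close> lies within \<open>4 * l\<close> of the origin because both its nucleus and its
  extent are controlled up to \<open>2 * l\<close>.\<close>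

lemma filled_cell_lower:
  assumes *: "inj (\<lambda>n. X n \<omega>)" "P \<omega> = range (\<lambda>n. X n \<omega>)" and \<omega>: "\<omega> \<in> space M"
    and area: "\<forall>n. 0 < area n \<omega> \<and> area n \<omega> < \<infinity>"
    and fill: "filled l \<omega>" and l: "1 \<le> l" and z: "z \<noteq> 0" "norm z \<le> 1"
  shows "ennreal (norm z / (24 * pi * l ^ 3)) \<le> (\<integral>\<^sup>+y. pair_weight (P \<omega>) y (y + z) * indicator (cball 0 (4 * l)) y \<partial>lborel)"
proof -
  have c: "cell k \<omega> = voronoi_cell (P \<omega>) (X k \<omega>)" for k by (simp add: cell_def *(2))
  have XP: "X k \<omega> \<in> P \<omega>" for k unfolding *(2) by (rule rangeI)
  note dense = fill[unfolded filled_def, rule_format]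
  have l0: "l > 0" using l by simp
  have small: "dist y (X k \<omega>) < 2 * l" "cell k \<omega> \<subseteq> cball (X k \<omega>) (2 * l)" if "y \<in> cell k \<omega>" "norm y \<le> 5 * l" for y k
    using voronoi_cell_small[OF dense l0 that(1)[unfolded c] that(2) XP] by (simp_all add: c)
  obtain n where n: "0 \<in> cell n \<omega>"
  proof -
    have "P \<omega> \<noteq> {}" using XP by blast
    from exists_voronoi_cell[OF P_locally_finite[OF \<omega>] this, of 0] *(2) show ?thesis
      using that unfolding cell_def by auto
  qed
  define V where "V = cell n \<omega>"
  have Vb: "V \<in> sets borel" by (simp add: V_def cell_borel')
  have V: "V \<subseteq> cball (X n \<omega>) (2 * l)" "norm (X n \<omega>) < 2 * l"
    using small[OF n] l0 by (auto simp: V_def)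
  have V4: "norm y \<le> 4 * l" if "y \<in> V" for y
  proof -
    have "norm y \<le> norm (X n \<omega>) + dist (X n \<omega>) y"
      using norm_triangle_ineq[of "X n \<omega>" "y - X n \<omega>"] by (simp add: dist_norm norm_minus_commute)
    then show ?thesis using V that by force
  qed
  define A where "A = {y \<in> V. y + z \<notin> V}"
  have A[measurable]: "A \<in> sets borel"
  proof -
    note [measurable] = Vb
    show ?thesis unfolding A_def by measurable
  qed
  \<comment> \<open>The added 1 gives the strict inequality that \<open>shift_boundary_lower\<close>
    requires for diameter \<open>4 * l\<close>. As \<open>norm z \<le> 1 \<le> l\<close>,
    \<open>k\<close> is at most \<open>6 * l / norm z\<close>; with the factor 4 of the neighbouring
    area this makes the 24.\<close>
  define k where "k = nat \<lceil>4 * l / norm z\<rceil> + 1"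
  have "4 * l / norm z < real k" unfolding k_def by linarith
  then have k1: "2 * (2 * l) < real k * norm z" using z(1) by (simp add: field_simps)
  have "real k \<le> 4 * l / norm z + 2"
  proof -
    have "0 \<le> 4 * l / norm z" using l0 by simp
    then have "real (nat \<lceil>4 * l / norm z\<rceil>) = of_int \<lceil>4 * l / norm z\<rceil>" by simp
    then show ?thesis unfolding k_def using of_int_ceiling_le_add_one[of "4 * l / norm z"] by linarith
  qed
  moreover have "2 \<le> 2 * l / norm z" using l z by (simp add: field_simps)
  ultimately have k2: "real k \<le> 6 * l / norm z" by (simp add: add_divide_distrib[symmetric])
  have kpos: "real k > 0" by (simp add: k_def)
  have "area n \<omega> \<le> of_nat k * emeasure lborel A"
    unfolding area_def A_def V_def[symmetric] by (rule shift_boundary_lower[OF Vb V(1) k1])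
  then have "area n \<omega> * inverse (area n \<omega>) \<le> of_nat k * emeasure lborel A * inverse (area n \<omega>)"
    by (rule mult_right_mono) simp
  moreover have "area n \<omega> * inverse (area n \<omega>) = 1"
  proof -
    have "area n \<omega> \<noteq> 0" "area n \<omega> < top" using area[rule_format, of n] by auto
    then show ?thesis unfolding divide_ennreal_def[symmetric] by (rule ennreal_divide_self)
  qed
  ultimately have one: "1 \<le> of_nat k * (emeasure lborel A * inverse (area n \<omega>))" by (simp add: mult.assoc)
  have AE: "AE y in lborel. inverse (area n \<omega>) * inverse (ennreal (4 * pi * l\<^sup>2)) * indicator A y \<le>
      pair_weight (P \<omega>) y (y + z) * indicator (cball 0 (4 * l)) y"
  proof -
    have "countable (P \<omega>)" by (simp add: *(2))
    from AE_tie_free[OF this] AE_tie_free_translates[OF this, of z] show ?thesis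
    proof eventually_elim
      case (elim y)
      show ?case
      proof (cases "y \<in> A")
        case True
        then have y: "y \<in> cell n \<omega>" "y + z \<notin> cell n \<omega>" "norm y \<le> 4 * l"
          using V4 by (auto simp: A_def V_def)
        obtain i where i: "y \<in> cell i \<omega>" "inv_area (P \<omega>) y = inverse (area i \<omega>)"
           "{w. same_cell (P \<omega>) y w} = cell i \<omega>" "\<And>k. y \<in> cell k \<omega> \<Longrightarrow> k = i"
          using dens_tie_free[OF * \<omega> elim(1)] by metis
        obtain j where j: "y + z \<in> cell j \<omega>" "inv_area (P \<omega>) (y + z) = inverse (area j \<omega>)"
          using dens_tie_free[OF * \<omega> elim(2)] by metis
        have "n = i" using i(4)[OF y(1)] .
        then have ns: "\<not> same_cell (P \<omega>) y (y + z)" using i(3) y(2) by auto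
        have "norm (y + z) \<le> 5 * l" using norm_triangle_ineq[of y z] y(3) z(2) l by linarith
        from small(2)[OF j(1) this] have "area j \<omega> \<le> emeasure lborel (cball (X j \<omega>) (2 * l))"
          unfolding area_def by (intro emeasure_mono) auto
        also have "\<dots> = ennreal (4 * pi * l\<^sup>2)" using l0 by (simp add: emeasure_cball_R2 power_mult_distrib mult_ac)
        finally have "inverse (ennreal (4 * pi * l\<^sup>2)) \<le> inverse (area j \<omega>)" by (rule ennreal_inverse_antimono)
        then have "inverse (area n \<omega>) * inverse (ennreal (4 * pi * l\<^sup>2)) \<le> inverse (area i \<omega>) * inverse (area j \<omega>)"
          unfolding \<open>n = i\<close> by (rule mult_left_mono) simp
        then show ?thesis using ns y(3) True by (simp add: pair_weight_def i(2) j(2))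
      qed simp
    qed
  qed
  have "ennreal (norm z / (24 * pi * l ^ 3)) = ennreal (norm z / (6 * l)) * inverse (ennreal (4 * pi * l\<^sup>2))"
    using l0 by (simp add: inverse_ennreal ennreal_mult[symmetric] field_simps power3_eq_cube power2_eq_square)
  also have "\<dots> \<le> ennreal (1 / real k) * inverse (ennreal (4 * pi * l\<^sup>2))"
    using k2 kpos z(1) l0 by (intro mult_right_mono ennreal_leI) (auto simp: field_simps)
  also have "\<dots> \<le> (ennreal (1 / real k) * (of_nat k * (emeasure lborel A * inverse (area n \<omega>)))) * inverse (ennreal (4 * pi * l\<^sup>2))"
    using mult_left_mono[OF one, of "ennreal (1 / real k)"] by (intro mult_right_mono) simp_all
  also have "\<dots> = (ennreal (1 / real k) * of_nat k) * (emeasure lborel A * inverse (area n \<omega>)) * inverse (ennreal (4 * pi * l\<^sup>2))"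
    by (simp add: mult.assoc)
  also have "ennreal (1 / real k) * of_nat k = 1"
    using kpos by (simp add: ennreal_of_nat_eq_real_of_nat ennreal_mult[symmetric])
  also have "1 * (emeasure lborel A * inverse (area n \<omega>)) * inverse (ennreal (4 * pi * l\<^sup>2)) =
     (\<integral>\<^sup>+y. inverse (area n \<omega>) * inverse (ennreal (4 * pi * l\<^sup>2)) * indicator A y \<partial>lborel)"
    by (subst nn_integral_cmult_indicator) (auto simp: mult_ac)
  also have "\<dots> \<le> (\<integral>\<^sup>+y. pair_weight (P \<omega>) y (y + z) * indicator (cball 0 (4 * l)) y \<partial>lborel)"
    by (rule nn_integral_mono_AE[OF AE])
  finally show ?thesis .
qed

text \<open>The bound for single realizations is averaged over the disk of radius
  \<open>4 * l\<close>, of area \<open>b\<close>, on an event of probability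
  \<open>p\<close>.\<close>

lemma pair_density_ge:
  obtains c where "c > 0" "\<And>z. z \<noteq> 0 \<Longrightarrow> norm z \<le> 1 \<Longrightarrow> ennreal (c * norm z) \<le> pair_density z"
proof -
  obtain l E where l: "1 \<le> l" and E: "E \<in> sets M" "0 < emeasure M E" "\<And>\<omega>. \<omega> \<in> E \<Longrightarrow> filled l \<omega>"
    by (rule filled_event) blast
  define p where "p = prob E"
  have p: "p > 0" "emeasure M E = ennreal p" using E(2) by (auto simp: p_def emeasure_eq_measure)
  define b where "b = pi * (4 * l)\<^sup>2"
  have b: "b > 0" using l by (simp add: b_def)
  define c where "c = p / (24 * pi * l ^ 3) / b"
  have c: "c > 0" using p b l by (simp add: c_def)
  have "ennreal (c * norm z) \<le> pair_density z" if z: "z \<noteq> 0" "norm z \<le> 1" for z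
  proof -
    define a where "a = norm z / (24 * pi * l ^ 3)"
    have a: "a \<ge> 0" using l by (simp add: a_def)
    have add: "(\<lambda>x. snd x + z) \<in> M \<Otimes>\<^sub>M lborel \<rightarrow>\<^sub>M borel" by measurable
    have pw: "(\<lambda>x. pair_weight (P (fst x)) (snd x) (snd x + z)) \<in> borel_measurable (M \<Otimes>\<^sub>M lborel)"
      by (rule pair_weight_measurable[OF measurable_fst _ add]) simp
    have e1: "(\<integral>\<^sup>+\<omega>. pair_weight (P \<omega>) y (y + z) \<partial>M) = pair_density z" for y
      using expected_pair_weight[of y "y + z"] by simp
    have "ennreal a * ennreal p = (\<integral>\<^sup>+\<omega>. ennreal a * indicator E \<omega> \<partial>M)"
      using E(1) by (simp add: nn_integral_cmult_indicator p)
    also have "\<dots> \<le> (\<integral>\<^sup>+\<omega>. (\<integral>\<^sup>+y. pair_weight (P \<omega>) y (y + z) * indicator (cball 0 (4 * l)) y \<partial>lborel) \<partial>M)"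
    proof (rule nn_integral_mono_AE)
      from X_enumerates AE_space area_positive_finite
      show "AE \<omega> in M. ennreal a * indicator E \<omega> \<le> (\<integral>\<^sup>+y. pair_weight (P \<omega>) y (y + z) * indicator (cball 0 (4 * l)) y \<partial>lborel)"
      proof eventually_elim
        case (elim \<omega>)
        show ?case
        proof (cases "\<omega> \<in> E")
          case True
          then show ?thesis
            using filled_cell_lower[OF _ _ elim(2,3) E(3)[OF True] l z] elim(1) by (simp add: a_def)
        qed simp
      qed
    qed
    also have "\<dots> = pair_density z * ennreal b"
      using average[OF pw e1, of "cball 0 (4 * l)"] l by (simp add: emeasure_cball_R2 b_def)
    finally have "ennreal (a * p) \<le> pair_density z * ennreal b" using a p by (simp add: ennreal_mult)
    then have "ennreal (a * p) * ennreal (1 / b) \<le> pair_density z * ennreal b * ennreal (1 / b)"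
      by (rule mult_right_mono) simp
    also have "\<dots> = pair_density z" using b by (simp add: mult.assoc ennreal_mult[symmetric])
    also have "ennreal (a * p) * ennreal (1 / b) = ennreal (c * norm z)"
    proof -
      have "0 \<le> a * p" using a p by simp
      then have "ennreal (a * p) * ennreal (1 / b) = ennreal (a * p * (1 / b))"
        using b by (intro ennreal_mult[symmetric]) auto
      then show ?thesis by (simp add: a_def c_def mult.commute)
    qed
    finally show ?thesis .
  qed
  with c show ?thesis by (rule that)
qed

text \<open>This is \<open>pi\<close> times the mean of the pair density over the circle of radius
  \<open>r\<close>, written as an area integral of its radial extension. At the single point
  \<open>w = 0\<close>, division by zero yields the origin.\<close>

definition radial_mean :: "real \<Rightarrow> ennreal" where
  "radial_mean r = (\<integral>\<^sup>+w. pair_density ((r / norm w) *\<^sub>R w) * indicator (cball 0 1) w \<partial>lborel)"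

lemma radial_measurable: "(\<lambda>w. pair_density ((r / norm w) *\<^sub>R w)) \<in> borel_measurable borel"
  by (rule measurable_compose[OF _ pair_density_measurable]) measurable

text \<open>The extended density is constant on rays, so dilating the disk only rescales
  area.\<close>

lemma radial_integral:
  assumes "b > 0"
  shows "(\<integral>\<^sup>+w. pair_density ((r / norm w) *\<^sub>R w) * indicator (cball 0 b) w \<partial>lborel) = ennreal (b\<^sup>2) * radial_mean r"
proof -
  have m: "(\<lambda>w. pair_density ((r / norm w) *\<^sub>R w) * indicator (cball 0 b) w) \<in> borel_measurable borel"
    by (intro borel_measurable_times_ennreal radial_measurable borel_measurable_indicator) simp
  have "(\<integral>\<^sup>+w. pair_density ((r / norm w) *\<^sub>R w) * indicator (cball 0 b) w \<partial>lborel) =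
     ennreal (b\<^sup>2) * (\<integral>\<^sup>+w. pair_density ((r / norm (b *\<^sub>R w)) *\<^sub>R (b *\<^sub>R w)) * indicator (cball 0 b) (b *\<^sub>R w) \<partial>lborel)"
    by (rule nn_integral_lborel_scale[OF m assms])
  also have "(\<integral>\<^sup>+w. pair_density ((r / norm (b *\<^sub>R w)) *\<^sub>R (b *\<^sub>R w)) * indicator (cball 0 b) (b *\<^sub>R w) \<partial>lborel) = radial_mean r"
    unfolding radial_mean_def using assms by (intro nn_integral_cong) (auto simp: indicator_def)
  finally show ?thesis .
qed

lemma radial_mean_bounds:
  assumes r: "0 < r" "r \<le> 1" and c: "\<And>z. z \<noteq> 0 \<Longrightarrow> norm z \<le> 1 \<Longrightarrow> ennreal (c * norm z) \<le> pair_density z" "c > 0"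
  shows "ennreal (pi * (c * r)) \<le> radial_mean r" "radial_mean r \<le> ennreal (pi * (18 * r * moment))"
proof -
  have ne: "AE w in lborel. w \<noteq> (0::real^2)" by (rule AE_lborel_singleton)
  have nz: "norm ((r / norm w) *\<^sub>R w) = r" if "w \<noteq> 0" for w :: "real^2" using that r by simp
  have "ennreal (pi * (c * r)) = (\<integral>\<^sup>+w. ennreal (c * r) * indicator (cball (0::real^2) 1) w \<partial>lborel)"
    using r c by (subst nn_integral_cmult_indicator) (auto simp: emeasure_cball_R2 ennreal_mult[symmetric] mult.commute)
  also have "\<dots> \<le> radial_mean r" unfolding radial_mean_def
  proof (rule nn_integral_mono_AE)
    from ne show "AE w in lborel. ennreal (c * r) * indicator (cball 0 1) w \<le> pair_density ((r / norm w) *\<^sub>R w) * indicator (cball 0 1) w"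
    proof eventually_elim
      case (elim w)
      then show ?case using c(1)[of "(r / norm w) *\<^sub>R w"] nz[OF elim] r by (intro mult_right_mono) auto
    qed
  qed
  finally show "ennreal (pi * (c * r)) \<le> radial_mean r" .
  have "radial_mean r \<le> (\<integral>\<^sup>+w. ennreal (18 * r * moment) * indicator (cball (0::real^2) 1) w \<partial>lborel)"
    unfolding radial_mean_def
  proof (rule nn_integral_mono_AE)
    from ne show "AE w in lborel. pair_density ((r / norm w) *\<^sub>R w) * indicator (cball 0 1) w \<le> ennreal (18 * r * moment) * indicator (cball 0 1) w"
    proof eventually_elim
      case (elim w)
      then show ?case using pair_density_le[of "(r / norm w) *\<^sub>R w"] nz[OF elim] r by (intro mult_right_mono) auto
    qed
  qed
  also have "\<dots> = ennreal (pi * (18 * r * moment))"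
    using r moment(2) by (subst nn_integral_cmult_indicator) (auto simp: emeasure_cball_R2 ennreal_mult[symmetric] mult.commute)
  finally show "radial_mean r \<le> ennreal (pi * (18 * r * moment))" .
qed

lemma ball_mass_finite: "b \<le> 1 \<Longrightarrow> ball_mass b < \<infinity>"
proof -
  assume b: "b \<le> 1"
  have "ball_mass b \<le> (\<integral>\<^sup>+w. ennreal (18 * moment) * indicator (cball (0::real^2) 1) w \<partial>lborel)"
    unfolding ball_mass_def
  proof (rule nn_integral_mono)
    fix w :: "real^2"
    show "pair_density w * indicator (cball 0 b) w \<le> ennreal (18 * moment) * indicator (cball 0 1) w"
    proof (cases "norm w \<le> b")
      case True
      with b have w: "norm w \<le> 1" by simp
      have "18 * norm w * moment \<le> 18 * moment"
        using w moment(2) by (intro mult_right_mono) auto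
      then have "pair_density w \<le> ennreal (18 * moment)"
        using pair_density_le[OF w] by (meson ennreal_leI order_trans)
      then show ?thesis using True w by simp
    qed simp
  qed
  also have "\<dots> < \<infinity>"
    by (subst nn_integral_cmult_indicator) (auto simp: emeasure_cball_R2 ennreal_mult_less_top)
  finally show ?thesis .
qed

text \<open>A point of the annulus and its radial projection to the circle of radius
  \<open>r\<close> differ by at most \<open>b - a\<close>, so the density and its radial extension
  differ there by at most \<open>e\<close>. Allowing any \<open>r\<close> from \<open>a\<close> to
  \<open>b\<close> covers difference quotients from both sides.\<close>

lemma annulus_estimate:
  assumes "0 < a" "a \<le> r" "r \<le> b" "b \<le> 1" and s: "s > 0"
  defines "e \<equiv> (s\<^sup>2 + inverse (s\<^sup>2) * (9 * (b - a))) * moment"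
  shows "\<bar>enn2real (ball_mass b) - enn2real (ball_mass a) - (b\<^sup>2 - a\<^sup>2) * enn2real (radial_mean r)\<bar> \<le> (b\<^sup>2 - a\<^sup>2) * (pi * e)"
proof -
  define N :: "(real^2) set" where "N = cball 0 b - cball 0 a"
  have N[measurable]: "N \<in> sets borel" by (simp add: N_def)
  have ab: "0 < b" "a \<le> b" "a\<^sup>2 \<le> b\<^sup>2" using assms by (auto intro: power_mono)
  have e: "e \<ge> 0" unfolding e_def using ab moment(2) by simp
  define k where "k w = pair_density ((r / norm w) *\<^sub>R w)" for w :: "real^2"
  have km[measurable]: "k \<in> borel_measurable borel" unfolding k_def[abs_def] by (rule radial_measurable)
  have split: "(\<integral>\<^sup>+w. f w * indicator (cball 0 b) w \<partial>lborel) =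
      (\<integral>\<^sup>+w. f w * indicator (cball 0 a) w \<partial>lborel) + (\<integral>\<^sup>+w. f w * indicator N w \<partial>lborel)"
    if f: "f \<in> borel_measurable borel" for f :: "real^2 \<Rightarrow> ennreal"
  proof -
    have m: "(\<lambda>w. f w * indicator D w) \<in> borel_measurable lborel" if "D \<in> sets borel" for D
      using f that by (intro borel_measurable_times_ennreal borel_measurable_indicator) auto
    have "(\<integral>\<^sup>+w. f w * indicator (cball 0 b) w \<partial>lborel) = (\<integral>\<^sup>+w. f w * indicator (cball 0 a) w + f w * indicator N w \<partial>lborel)"
      using ab by (intro nn_integral_cong) (auto simp: indicator_def N_def)
    then show ?thesis by (subst (asm) nn_integral_add[OF m m]) auto
  qed
  have Nh: "ball_mass b = ball_mass a + (\<integral>\<^sup>+w. pair_density w * indicator N w \<partial>lborel)"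
    unfolding ball_mass_def by (rule split) simp
  have Nk: "ennreal (b\<^sup>2) * radial_mean r = ennreal (a\<^sup>2) * radial_mean r + (\<integral>\<^sup>+w. k w * indicator N w \<partial>lborel)"
    using split[OF km] radial_integral[OF ab(1), of r] radial_integral[OF assms(1), of r] by (simp add: k_def)
  have N1: "ennreal (pi * b\<^sup>2) = ennreal (pi * a\<^sup>2) + emeasure lborel N"
    using split[of "\<lambda>_. 1"] ab assms(1) by (simp add: emeasure_cball_R2)
  have "emeasure lborel N \<le> emeasure lborel (cball (0::real^2) b)"
    by (intro emeasure_mono) (auto simp: N_def)
  also have "\<dots> < \<infinity>" using ab by (simp add: emeasure_cball_R2)
  finally have finN: "emeasure lborel N < \<infinity>" .
  have eN: "emeasure lborel N = ennreal (pi * (b\<^sup>2 - a\<^sup>2))"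
  proof -
    define t where "t = enn2real (emeasure lborel N)"
    have t: "emeasure lborel N = ennreal t" "t \<ge> 0" using finN by (auto simp: t_def ennreal_enn2real)
    have "ennreal (pi * b\<^sup>2) = ennreal (pi * a\<^sup>2 + t)"
      unfolding N1 t(1) using t(2) by (intro ennreal_plus[symmetric]) auto
    then have "pi * b\<^sup>2 = pi * a\<^sup>2 + t" using t(2) by (subst (asm) ennreal_inj) auto
    then have "t = pi * (b\<^sup>2 - a\<^sup>2)" by (simp add: right_diff_distrib)
    then show ?thesis by (simp only: t(1))
  qed
  have near: "norm ((r / norm w) *\<^sub>R w - w) \<le> b - a" if "w \<in> N" for w
  proof -
    have w: "a < norm w" "norm w \<le> b" using that by (auto simp: N_def)
    have "(r / norm w) *\<^sub>R w - w = ((r - norm w) / norm w) *\<^sub>R w"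
      using w assms(1) by (simp add: diff_divide_distrib scaleR_left_diff_distrib)
    moreover have "w \<noteq> 0" using w assms(1) by auto
    ultimately have "norm ((r / norm w) *\<^sub>R w - w) = \<bar>r - norm w\<bar>" by simp
    then show ?thesis using w assms by auto
  qed
  have cont: "pair_density x \<le> pair_density y + ennreal e" if "norm (y - x) \<le> b - a" for x y
  proof -
    have "norm (y - x) \<le> 1" using that assms by linarith
    from pair_density_continuity[OF this s]
    have "pair_density x \<le> pair_density y + ennreal ((s\<^sup>2 + inverse (s\<^sup>2) * (9 * norm (y - x))) * moment)" .
    also have "\<dots> \<le> pair_density y + ennreal e"
      unfolding e_def using that moment(2) by (intro add_left_mono ennreal_leI mult_right_mono add_left_mono mult_left_mono) auto
    finally show ?thesis .
  qed
  have err: "(\<integral>\<^sup>+w. f w * indicator N w \<partial>lborel) \<le> (\<integral>\<^sup>+w. g w * indicator N w \<partial>lborel) + ennreal (e * (pi * (b\<^sup>2 - a\<^sup>2)))"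
    if [measurable]: "f \<in> borel_measurable borel" "g \<in> borel_measurable borel"
      and le: "\<And>w. w \<in> N \<Longrightarrow> f w \<le> g w + ennreal e" for f g :: "real^2 \<Rightarrow> ennreal"
  proof -
    have "(\<integral>\<^sup>+w. f w * indicator N w \<partial>lborel) \<le> (\<integral>\<^sup>+w. g w * indicator N w + ennreal e * indicator N w \<partial>lborel)"
      using le by (intro nn_integral_mono) (auto simp: indicator_def)
    also have "\<dots> = (\<integral>\<^sup>+w. g w * indicator N w \<partial>lborel) + ennreal e * emeasure lborel N"
      by (subst nn_integral_add) (auto simp: nn_integral_cmult_indicator)
    finally show ?thesis using e ab by (simp add: eN ennreal_mult)
  qed
  have u1: "(\<integral>\<^sup>+w. pair_density w * indicator N w \<partial>lborel) \<le> (\<integral>\<^sup>+w. k w * indicator N w \<partial>lborel) + ennreal (e * (pi * (b\<^sup>2 - a\<^sup>2)))"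
    by (rule err) (auto simp: k_def intro!: cont near)
  have u2: "(\<integral>\<^sup>+w. k w * indicator N w \<partial>lborel) \<le> (\<integral>\<^sup>+w. pair_density w * indicator N w \<partial>lborel) + ennreal (e * (pi * (b\<^sup>2 - a\<^sup>2)))"
    using near by (intro err) (auto simp: k_def norm_minus_commute intro!: cont)
  have "r > 0" "r \<le> 1" using assms by auto
  have Jfin: "radial_mean r < \<infinity>"
  proof -
    obtain c where c: "c > 0" "\<And>z. z \<noteq> 0 \<Longrightarrow> norm z \<le> 1 \<Longrightarrow> ennreal (c * norm z) \<le> pair_density z" using pair_density_ge by blast
    show ?thesis by (rule le_less_trans[OF radial_mean_bounds(2)[OF \<open>r > 0\<close> \<open>r \<le> 1\<close> c(2,1)]]) simp_all
  qed
  \<comment> \<open>All masses are finite, so the additive identities may be subtracted as real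
    numbers.\<close>
  define Ib Ia Jr where "Ib = enn2real (ball_mass b)" and "Ia = enn2real (ball_mass a)" and "Jr = enn2real (radial_mean r)"
  have fin: "ball_mass b < \<infinity>" "ball_mass a < \<infinity>" using ball_mass_finite[of a] ball_mass_finite[of b] assms by auto
  have re: "ball_mass b = ennreal Ib" "ball_mass a = ennreal Ia" "radial_mean r = ennreal Jr" "0 \<le> Ib" "0 \<le> Ia" "0 \<le> Jr"
    using fin Jfin by (auto simp: Ib_def Ia_def Jr_def ennreal_enn2real)
  define H where "H = enn2real (\<integral>\<^sup>+w. pair_density w * indicator N w \<partial>lborel)"
  define K where "K = enn2real (\<integral>\<^sup>+w. k w * indicator N w \<partial>lborel)"
  have "(\<integral>\<^sup>+w. pair_density w * indicator N w \<partial>lborel) \<le> ball_mass b" unfolding Nh by simp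
  from le_less_trans[OF this fin(1)] have H: "(\<integral>\<^sup>+w. pair_density w * indicator N w \<partial>lborel) = ennreal H" "0 \<le> H"
    by (simp_all add: H_def ennreal_enn2real)
  have "(\<integral>\<^sup>+w. k w * indicator N w \<partial>lborel) \<le> ennreal (b\<^sup>2) * radial_mean r" unfolding Nk by simp
  also have "\<dots> < \<infinity>" using Jfin by (simp add: ennreal_mult_less_top)
  finally have K: "(\<integral>\<^sup>+w. k w * indicator N w \<partial>lborel) = ennreal K" "0 \<le> K"
    by (simp_all add: K_def ennreal_enn2real)
  have "ennreal Ib = ennreal (Ia + H)"
    using Nh H re by (simp add: ennreal_plus)
  then have 1: "Ib = Ia + H" using re H by (subst (asm) ennreal_inj) auto
  have "ennreal (b\<^sup>2 * Jr) = ennreal (a\<^sup>2 * Jr + K)"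
    using Nk re K by (simp add: ennreal_plus ennreal_mult)
  then have 2: "b\<^sup>2 * Jr = a\<^sup>2 * Jr + K" using re K by (subst (asm) ennreal_inj) auto
  have ee: "0 \<le> e * (pi * (b\<^sup>2 - a\<^sup>2))" using e ab by simp
  have "ennreal H \<le> ennreal (K + e * (pi * (b\<^sup>2 - a\<^sup>2)))"
    using u1 unfolding H(1) K(1) ennreal_plus[OF K(2) ee] .
  then have 3: "H \<le> K + e * (pi * (b\<^sup>2 - a\<^sup>2))" using K ee by (subst (asm) ennreal_le_iff) auto
  have "ennreal K \<le> ennreal (H + e * (pi * (b\<^sup>2 - a\<^sup>2)))"
    using u2 unfolding H(1) K(1) ennreal_plus[OF H(2) ee] .
  then have 4: "K \<le> H + e * (pi * (b\<^sup>2 - a\<^sup>2))" using H ee by (subst (asm) ennreal_le_iff) auto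
  have "Ib - Ia - (b\<^sup>2 - a\<^sup>2) * Jr = H - K" using 1 2 by (simp add: algebra_simps)
  moreover have "(b\<^sup>2 - a\<^sup>2) * (pi * e) = e * (pi * (b\<^sup>2 - a\<^sup>2))" by simp
  ultimately show ?thesis unfolding Ib_def[symmetric] Ia_def[symmetric] Jr_def[symmetric] using 3 4 by linarith
qed

text \<open>The increment is \<open>b\<^sup>2 - r\<^sup>2\<close> times the radial mean up to an
  error of order \<open>\<bar>b - r\<bar> powr (3/2)\<close>, so the quotient tends to
  \<open>2 * r\<close> times the radial mean.\<close>

lemma ball_mass_derivative:
  assumes r: "0 < r" "r < 1"
  shows "((\<lambda>b. enn2real (ball_mass b)) has_real_derivative 2 * r * enn2real (radial_mean r)) (at r)"
proof -
  define Jr where "Jr = enn2real (radial_mean r)"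
  define q where "q b = (enn2real (ball_mass b) - enn2real (ball_mass r)) / (b - r)" for b
  have est: "\<bar>q b - (b + r) * Jr\<bar> \<le> 20 * pi * moment * sqrt \<bar>b - r\<bar>" if b: "0 < b" "b < 1" "b \<noteq> r" for b
  proof -
    define d where "d = \<bar>b - r\<bar>"
    have d: "d > 0" using b by (simp add: d_def)
    \<comment> \<open>With \<open>s\<^sup>2 = sqrt d\<close> both terms of \<open>e\<close> have
      order \<open>sqrt d\<close>, and 1 + 9 gives the 10.\<close>
    define s where "s = sqrt (sqrt d)"
    have s: "s > 0" "s\<^sup>2 = sqrt d" using d by (auto simp: s_def)
    define e where "e = (s\<^sup>2 + inverse (s\<^sup>2) * (9 * d)) * moment"
    have "d / sqrt d = sqrt d" using d by (intro real_div_sqrt) simp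
    moreover have "inverse (sqrt d) * (9 * d) = 9 * (d / sqrt d)" by (simp add: divide_inverse)
    ultimately have "inverse (sqrt d) * (9 * d) = 9 * sqrt d" by simp
    then have e: "e = 10 * sqrt d * moment" unfolding e_def s(2) by simp
    have "\<bar>enn2real (ball_mass b) - enn2real (ball_mass r) - (b\<^sup>2 - r\<^sup>2) * Jr\<bar> \<le> \<bar>b\<^sup>2 - r\<^sup>2\<bar> * (pi * e)"
    proof (cases "r < b")
      case True
      then have "r\<^sup>2 \<le> b\<^sup>2" using r by (intro power_mono) auto
      then have ab: "\<bar>b\<^sup>2 - r\<^sup>2\<bar> = b\<^sup>2 - r\<^sup>2" by simp
      have dd: "d = b - r" using True by (simp add: d_def)
      show ?thesis
        unfolding ab Jr_def e_def dd using True b r s(1) by (intro annulus_estimate) auto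
    next
      case False
      then have "b\<^sup>2 \<le> r\<^sup>2" using b by (intro power_mono) auto
      then have ab: "\<bar>b\<^sup>2 - r\<^sup>2\<bar> = r\<^sup>2 - b\<^sup>2" by simp
      have dd: "d = r - b" using False by (simp add: d_def)
      have "enn2real (ball_mass b) - enn2real (ball_mass r) - (b\<^sup>2 - r\<^sup>2) * Jr = - (enn2real (ball_mass r) - enn2real (ball_mass b) - (r\<^sup>2 - b\<^sup>2) * Jr)"
        by (simp add: left_diff_distrib)
      then have neg: "\<bar>enn2real (ball_mass b) - enn2real (ball_mass r) - (b\<^sup>2 - r\<^sup>2) * Jr\<bar> = \<bar>enn2real (ball_mass r) - enn2real (ball_mass b) - (r\<^sup>2 - b\<^sup>2) * Jr\<bar>"
        by (simp only: abs_minus_cancel)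
      show ?thesis
        unfolding ab neg unfolding Jr_def e_def dd using False b r s(1) by (intro annulus_estimate) auto
    qed
    moreover have "b\<^sup>2 - r\<^sup>2 = (b - r) * (b + r)" by (simp add: power2_eq_square square_diff_square_factored mult.commute)
    moreover have "enn2real (ball_mass b) - enn2real (ball_mass r) = (b - r) * q b" using b(3) by (simp add: q_def)
    ultimately have "\<bar>(b - r) * q b - (b - r) * (b + r) * Jr\<bar> \<le> \<bar>(b - r) * (b + r)\<bar> * (pi * e)"
      by simp
    then have "\<bar>(b - r) * (q b - (b + r) * Jr)\<bar> \<le> \<bar>(b - r) * (b + r)\<bar> * (pi * e)"
      by (simp add: right_diff_distrib mult.assoc)
    then have "d * \<bar>q b - (b + r) * Jr\<bar> \<le> d * ((b + r) * (pi * e))"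
      using b r by (simp add: abs_mult d_def mult_ac)
    then have "\<bar>q b - (b + r) * Jr\<bar> \<le> (b + r) * (pi * e)" using d by simp
    also have "\<dots> \<le> 2 * (pi * e)" using b r d moment(2) by (intro mult_right_mono) (auto simp: e)
    also have "\<dots> = 20 * pi * moment * sqrt \<bar>b - r\<bar>" by (simp add: e d_def)
    finally show ?thesis .
  qed
  have "((\<lambda>b. q b - (b + r) * Jr) \<longlongrightarrow> 0) (at r)"
  proof (rule Lim_null_comparison)
    have "\<forall>\<^sub>F b in at r. b \<in> {0<..<1} - {r}"
      using r by (intro eventually_at_in_open) auto
    then show "\<forall>\<^sub>F b in at r. norm (q b - (b + r) * Jr) \<le> 20 * pi * moment * sqrt \<bar>b - r\<bar>"
    proof eventually_elim
      case (elim b)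
      then show ?case using est[of b] by (simp only: real_norm_def) simp
    qed
    have "((\<lambda>b. 20 * pi * moment * sqrt \<bar>b - r\<bar>) \<longlongrightarrow> 20 * pi * moment * sqrt \<bar>r - r\<bar>) (at r)"
      by (intro tendsto_intros)
    then show "((\<lambda>b. 20 * pi * moment * sqrt \<bar>b - r\<bar>) \<longlongrightarrow> 0) (at r)" by simp
  qed
  moreover have "((\<lambda>b. (b + r) * Jr) \<longlongrightarrow> (r + r) * Jr) (at r)" by (intro tendsto_intros)
  ultimately have "((\<lambda>b. (q b - (b + r) * Jr) + (b + r) * Jr) \<longlongrightarrow> 0 + (r + r) * Jr) (at r)" by (rule tendsto_add)
  then have "(q \<longlongrightarrow> 2 * r * Jr) (at r)" by simp
  then show ?thesis by (simp add: has_field_derivative_iff q_def[abs_def] Jr_def)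
qed

text \<open>Dividing the derivative by \<open>2 * pi * r\<close> leaves the radial mean over
  \<open>pi * lam\<close>, which the pointwise bounds on the pair density confine between multiples
  of \<open>r\<close>.\<close>

lemma pair_correlation_bounds:
  "\<exists>c\<^sub>1>0. \<exists>c\<^sub>2>0. \<exists>r\<^sub>0>0. \<forall>B. B \<in> sets borel \<and> bounded B \<and> measure lborel B > 0 \<longrightarrow>
     (\<forall>r. 0 < r \<and> r < r\<^sub>0 \<longrightarrow>
        K_function M \<Phi> lam B differentiable (at r) \<and>
        c\<^sub>1 * r \<le> pair_correlation M \<Phi> lam B r \<and>
        pair_correlation M \<Phi> lam B r \<le> c\<^sub>2 * r)"
proof -
  obtain c where c: "c > 0" "\<And>z. z \<noteq> 0 \<Longrightarrow> norm z \<le> 1 \<Longrightarrow> ennreal (c * norm z) \<le> pair_density z" using pair_density_ge by blast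
  define c1 where "c1 = c / lam"
  \<comment> \<open>The added 1 makes the constant positive even if \<open>moment\<close> is
    0.\<close>
  define c2 where "c2 = (18 * moment + 1) / lam"
  have pos: "c1 > 0" "c2 > 0" using c lam moment(2) by (auto simp: c1_def c2_def add_nonneg_pos)
  have "K_function M \<Phi> lam B differentiable (at r) \<and> c1 * r \<le> pair_correlation M \<Phi> lam B r \<and>
      pair_correlation M \<Phi> lam B r \<le> c2 * r"
    if B: "B \<in> sets borel" "bounded B" "measure lborel B > 0" and r: "0 < r" "r < 1" for B r
  proof -
    have K: "K_function M \<Phi> lam B = (\<lambda>r. enn2real (ball_mass r) / lam)"
      by (rule ext) (rule K_function_eq[OF B])
    have der: "(K_function M \<Phi> lam B has_real_derivative (2 * r * enn2real (radial_mean r)) / lam) (at r)"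
      unfolding K by (rule DERIV_cdivide[OF ball_mass_derivative[OF r]])
    have g: "pair_correlation M \<Phi> lam B r = enn2real (radial_mean r) / (pi * lam)"
      unfolding pair_correlation_def DERIV_imp_deriv[OF der] using r lam by (simp add: field_simps)
    have r1: "r \<le> 1" using r by simp
    note Jb = radial_mean_bounds[OF r(1) r1 c(2,1)]
    have "radial_mean r < \<infinity>" using le_less_trans[OF Jb(2)] by simp
    then have lo: "pi * (c * r) \<le> enn2real (radial_mean r)"
      using enn2real_mono[OF Jb(1)] r c by simp
    have up: "enn2real (radial_mean r) \<le> pi * (18 * r * moment)"
      using enn2real_mono[OF Jb(2)] r moment(2) by simp
    have "c1 * r \<le> pair_correlation M \<Phi> lam B r"
      unfolding g c1_def using lo lam by (simp add: field_simps)
    moreover have "pair_correlation M \<Phi> lam B r \<le> c2 * r"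
    proof -
      have "pi * (18 * r * moment) \<le> pi * ((18 * moment + 1) * r)" using r by (simp add: algebra_simps)
      then show ?thesis unfolding g c2_def using up lam by (simp add: field_simps)
    qed
    moreover have "K_function M \<Phi> lam B differentiable (at r)"
      using der unfolding real_differentiable_def by blast
    ultimately show ?thesis by blast
  qed
  note main = this
  show ?thesis
  proof (rule exI[of _ c1], rule conjI[OF pos(1)], rule exI[of _ c2], rule conjI[OF pos(2)],
      rule exI[of _ 1], rule conjI[OF zero_less_one], intro allI impI)
    fix B :: "(real^2) set" and r :: real
    assume "B \<in> sets borel \<and> bounded B \<and> measure lborel B > 0" "0 < r \<and> r < 1"
    then show "K_function M \<Phi> lam B differentiable (at r) \<and> c1 * r \<le> pair_correlation M \<Phi> lam B r \<and>
        pair_correlation M \<Phi> lam B r \<le> c2 * r"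
      using main[of B r] by blast
  qed
qed

end

theorem lemma1:
  fixes M :: "'w measure" and P \<Phi> :: "'w \<Rightarrow> (real ^ 2) set" and lam :: real
  assumes "lam > 0"
    and "poisson_process M lam P"
    and "user_process_I M P \<Phi>"
  shows "\<exists>c\<^sub>1>0. \<exists>c\<^sub>2>0. \<exists>r\<^sub>0>0. \<forall>B. B \<in> sets borel \<and> bounded B \<and> measure lborel B > 0 \<longrightarrow>
           (\<forall>r. 0 < r \<and> r < r\<^sub>0 \<longrightarrow>
              K_function M \<Phi> lam B differentiable (at r) \<and>
              c\<^sub>1 * r \<le> pair_correlation M \<Phi> lam B r \<and>
              pair_correlation M \<Phi> lam B r \<le> c\<^sub>2 * r)"
proof -
  obtain X Y :: "nat \<Rightarrow> 'w \<Rightarrow> real ^ 2" where XY: "\<And>n. X n \<in> borel_measurable M" "\<And>n. Y n \<in> borel_measurable M"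
    and ae: "AE \<omega> in M. inj (\<lambda>n. X n \<omega>) \<and> P \<omega> = range (\<lambda>n. X n \<omega>) \<and> \<Phi> \<omega> = range (\<lambda>n. Y n \<omega>)"
    and law: "\<And>S N C. S \<in> sets (Pi\<^sub>M UNIV (\<lambda>_::nat. borel)) \<Longrightarrow> (\<And>n. C n \<in> sets borel) \<Longrightarrow>
           emeasure M {\<omega> \<in> space M. (\<lambda>n. X n \<omega>) \<in> S \<and> (\<forall>n<N. Y n \<omega> \<in> C n)} =
           (\<integral>\<^sup>+\<omega>\<in>{\<omega> \<in> space M. (\<lambda>n. X n \<omega>) \<in> S}.
              (\<Prod>n<N. emeasure (uniform_measure lborel (voronoi_cell (P \<omega>) (X n \<omega>))) (C n)) \<partial>M)"
    using assms(3) unfolding user_process_I_def by blast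
  interpret prob_space M using assms(2) by (simp add: poisson_process_def)
  interpret enumerated_poisson M lam P X
  proof
    show "AE \<omega> in M. inj (\<lambda>n. X n \<omega>) \<and> P \<omega> = range (\<lambda>n. X n \<omega>)" using ae by eventually_elim simp
  qed (use assms XY in auto)
  interpret user_process M lam P X \<Phi> Y
  proof
    show "AE \<omega> in M. \<Phi> \<omega> = range (\<lambda>n. Y n \<omega>)" using ae by eventually_elim simp
    fix N and C :: "nat \<Rightarrow> (real^2) set" assume C: "\<And>n. C n \<in> sets borel"
    have sp: "space (Pi\<^sub>M UNIV (\<lambda>_::nat. borel :: (real^2) measure)) = UNIV" by (simp add: space_PiM)
    have U: "UNIV \<in> sets (Pi\<^sub>M UNIV (\<lambda>_::nat. borel :: (real^2) measure))"
      unfolding sp[symmetric] by (rule sets.top)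
    have "emeasure M {\<omega> \<in> space M. \<forall>n<N. Y n \<omega> \<in> C n} =
       (\<integral>\<^sup>+\<omega>. (\<Prod>n<N. emeasure (uniform_measure lborel (voronoi_cell (P \<omega>) (X n \<omega>))) (C n)) * indicator (space M) \<omega> \<partial>M)"
      using law[OF U C, of N] by simp
    also have "\<dots> = (\<integral>\<^sup>+\<omega>. (\<Prod>n<N. emeasure (uniform_measure lborel (cell n \<omega>)) (C n)) \<partial>M)"
    proof (rule nn_integral_cong_AE)
      from ae AE_space
      show "AE \<omega> in M. (\<Prod>n<N. emeasure (uniform_measure lborel (voronoi_cell (P \<omega>) (X n \<omega>))) (C n)) * indicator (space M) \<omega> =
        (\<Prod>n<N. emeasure (uniform_measure lborel (cell n \<omega>)) (C n))"
        by eventually_elim (simp add: cell_def)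
    qed
    finally show "emeasure M {\<omega> \<in> space M. \<forall>n<N. Y n \<omega> \<in> C n} =
      (\<integral>\<^sup>+\<omega>. (\<Prod>n<N. emeasure (uniform_measure lborel (cell n \<omega>)) (C n)) \<partial>M)" .
  qed (use XY in auto)
  show ?thesis by (rule pair_correlation_bounds)
qed

end
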